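(* Let $P$ be an arbitrary knot projection. The circle number $|\tau(P)|$ is invariant under strong (1, 2) homotopy; that is, if $P$ and $P'$ are strongly (1, 2) homotopic knot projections, then $|\tau(P)|=|\tau(P')|$.
   Context: A knot projection is the image of a generic immersion of a circle into the 2-sphere $S^2$ (the only singularities are finitely many transverse double points). It is regarded as a 4-valent graph whose vertices are the double points, and is considered up to isotopy of the sphere. A 1-gon (resp. 2-gon) is the boundary of a disk that is a face (the interior of the disk is disjoint from the projection) and whose boundary has exactly one vertex and one edge (resp. exactly two vertices and two edges). A 2-gon is coherent if, after orienting the knot projection, its two edges are oriented consistently around its boundary (independent of the chosen orientation). The move RI (first flat Reidemeister move) locally adds or removes a 1-gon (kink). The second flat Reidemeister move replaces, inside a disk, two disjoint arcs by two arcs crossing each other at two points and forming a 2-gon, or the inverse; it is called strong RII if this 2-gon is coherent. Two knot projections are strongly (1, 2) homotopic if they are related by a finite sequence of moves RI and strong RII, together with isotopies. Non-Seifert resolution $A^{-1}$: orient $P$ arbitrarily; of the two planar smoothings of a double point, $A^{-1}$ is the one that does not respect the orientation, i.e. it joins the two incoming branches to each other and the two outgoing branches to each other. This does not depend on the orientation chosen. Applying $A^{-1}$ simultaneously at every double point of $P$ (with respect to an orientation of $P$) yields a finite collection $\tau(P)$ of pairwise disjoint simple closed curves on $S^2$, called the circle arrangement of $P$. The circle number $|\tau(P)|$ is the number of circles in $\tau(P)$. *)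

theory Defs
  imports "HOL-Analysis.Analysis"
begin

section \<open>Knot projections\<close>

abbreviation S2 :: "(real^3) set" where
  "S2 \<equiv> sphere 0 1"

abbreviation S2_top :: "(real^3) topology" where
  "S2_top \<equiv> top_of_set S2"

text \<open>The circle is \<open>\<real>/\<int>\<close>; maps from the circle are 1-periodic functions on the reals, and
  \<open>x - y \<in> \<int>\<close> says that two parameters are the same point of the circle.\<close>

definition smooth :: "(real \<Rightarrow> real^3) \<Rightarrow> bool" where
  "smooth f \<longleftrightarrow> (\<forall>k x. ((\<lambda>g y. vector_derivative g (at y)) ^^ k) f differentiable (at x))"

definition immersion :: "(real \<Rightarrow> real^3) \<Rightarrow> bool" where
  "immersion f \<longleftrightarrow> smooth f \<and>
     (\<forall>x. f (x + 1) = f x \<and> f x \<in> S2 \<and> vector_derivative f (at x) \<noteq> 0)"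

definition double_points :: "(real \<Rightarrow> real^3) \<Rightarrow> (real^3) set" where
  "double_points f = {p. \<exists>x y. x - y \<notin> \<int> \<and> f x = p \<and> f y = p}"

text \<open>The last conjunct is transversality: the two tangent vectors are linearly independent.\<close>

definition generic_immersion :: "(real \<Rightarrow> real^3) \<Rightarrow> bool" where
  "generic_immersion f \<longleftrightarrow> immersion f \<and> finite (double_points f) \<and>
     (\<forall>x y z. f x = f y \<and> f y = f z \<longrightarrow> x - y \<in> \<int> \<or> y - z \<in> \<int> \<or> x - z \<in> \<int>) \<and>
     (\<forall>x y. f x = f y \<and> x - y \<notin> \<int> \<longrightarrow>
        \<not> collinear {0, vector_derivative f (at x), vector_derivative f (at y)})"

definition knot_projection :: "(real^3) set \<Rightarrow> bool" where
  "knot_projection P \<longleftrightarrow> (\<exists>f. generic_immersion f \<and> P = range f)"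

definition isotopic :: "(real^3) set \<Rightarrow> (real^3) set \<Rightarrow> bool" where
  "isotopic P Q \<longleftrightarrow>
     (\<exists>h. homotopic_with (homeomorphic_map S2_top S2_top) S2_top S2_top id h \<and> h ` P = Q)"

section \<open>Faces with one or two edges\<close>

definition disk :: "(real^3) set \<Rightarrow> bool" where
  "disk D \<longleftrightarrow> D \<subseteq> S2 \<and> D homeomorphic cball (0::complex) 1"

definition bounds_face :: "(real^3) set \<Rightarrow> (real^3) set \<Rightarrow> bool" where
  "bounds_face P C \<longleftrightarrow>
     (\<exists>B. disk B \<and> (S2_top interior_of B) \<inter> P = {} \<and> S2_top frontier_of B = C)"

definition one_gon :: "(real \<Rightarrow> real^3) \<Rightarrow> real \<Rightarrow> real \<Rightarrow> bool" where
  "one_gon f s t \<longleftrightarrow> s < t \<and> t < s + 1 \<and> f s = f t \<and>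
     f ` {s<..<t} \<inter> double_points f = {} \<and> bounds_face (range f) (f ` {s..t})"

text \<open>The edges of the 2-gon are the images of \<open>{s..t}\<close> and \<open>{u..v}\<close>.\<close>

definition two_gon :: "(real \<Rightarrow> real^3) \<Rightarrow> real \<Rightarrow> real \<Rightarrow> real \<Rightarrow> real \<Rightarrow> bool" where
  "two_gon f s t u v \<longleftrightarrow> s < t \<and> t < s + 1 \<and> u < v \<and> v < u + 1 \<and>
     f s \<noteq> f t \<and> {f s, f t} = {f u, f v} \<and> {f s, f t} \<subseteq> double_points f \<and>
     f ` {s<..<t} \<inter> double_points f = {} \<and> f ` {u<..<v} \<inter> double_points f = {} \<and>
     f ` {s<..<t} \<inter> f ` {u<..<v} = {} \<and>
     bounds_face (range f) (f ` {s..t} \<union> f ` {u..v})"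

definition coherent_two_gon ::
    "(real \<Rightarrow> real^3) \<Rightarrow> real \<Rightarrow> real \<Rightarrow> real \<Rightarrow> real \<Rightarrow> bool" where
  "coherent_two_gon f s t u v \<longleftrightarrow> two_gon f s t u v \<and> f t = f u \<and> f v = f s"

section \<open>Moves\<close>

text \<open>The curves \<open>f\<close> and \<open>g\<close> differ only inside the disk \<open>D\<close>, which each of them meets exactly
  in the parameters \<open>I\<close> (modulo 1).\<close>

definition local_change ::
    "(real^3) set \<Rightarrow> real set \<Rightarrow> (real \<Rightarrow> real^3) \<Rightarrow> (real \<Rightarrow> real^3) \<Rightarrow> bool" where
  "local_change D I f g \<longleftrightarrow> disk D \<and> generic_immersion f \<and> generic_immersion g \<and>
     (\<forall>x\<in>interior I. f x \<in> S2_top interior_of D \<and> g x \<in> S2_top interior_of D) \<and>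
     (\<forall>x. (\<forall>n::int. x + of_int n \<notin> I) \<longrightarrow> f x = g x \<and> f x \<notin> D)"

text \<open>Both moves are stated in the direction that adds crossings. In the first one an embedded arc
  is replaced by an arc with the same end points whose only self-crossing is the vertex of a
  1-gon.\<close>

definition RI :: "(real^3) set \<Rightarrow> (real^3) set \<Rightarrow> bool" where
  "RI P Q \<longleftrightarrow> (\<exists>f g D a b s t. P = range f \<and> Q = range g \<and>
     a < s \<and> s < t \<and> t < b \<and> b < a + 1 \<and> local_change D {a..b} f g \<and>
     inj_on f {a..b} \<and> inj_on g ({a..b} - {s}) \<and> one_gon g s t)"

definition strong_RII :: "(real^3) set \<Rightarrow> (real^3) set \<Rightarrow> bool" where
  "strong_RII P Q \<longleftrightarrow> (\<exists>f g D a b c d s t u v. P = range f \<and> Q = range g \<and>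
     a < s \<and> s < t \<and> t < b \<and> b < c \<and> c < u \<and> u < v \<and> v < d \<and> d < a + 1 \<and>
     local_change D ({a..b} \<union> {c..d}) f g \<and>
     inj_on f ({a..b} \<union> {c..d}) \<and>
     inj_on g {a..b} \<and> inj_on g {c..d} \<and> g ` {a..b} \<inter> g ` {c..d} = {g s, g t} \<and>
     coherent_two_gon g s t u v)"

definition strongly_12_homotopic :: "(real^3) set \<Rightarrow> (real^3) set \<Rightarrow> bool" where
  "strongly_12_homotopic =
     equivclp (\<lambda>P Q. knot_projection P \<and> knot_projection Q \<and>
                (isotopic P Q \<or> RI P Q \<or> strong_RII P Q))"

section \<open>The non-Seifert resolution and the circle arrangement\<close>

text \<open>A chart in which the curve near the double point \<open>p\<close> is the union of the two coordinate
  axes of the unit disk, both of them traversed in the positive direction. The chart need not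
  preserve the orientation of the sphere.\<close>

definition crossing_chart :: "(real \<Rightarrow> real^3) \<Rightarrow> real^3 \<Rightarrow> (complex \<Rightarrow> real^3) \<Rightarrow> bool" where
  "crossing_chart f p \<phi> \<longleftrightarrow>
     continuous_on (cball 0 1) \<phi> \<and> inj_on \<phi> (cball 0 1) \<and> \<phi> ` cball 0 1 \<subseteq> S2 \<and> \<phi> 0 = p \<and>
     range f \<inter> \<phi> ` cball 0 1 = \<phi> ` (closed_segment (-1) 1 \<union> closed_segment (-\<i>) \<i>) \<and>
     (\<exists>s t. f s = p \<and> f t = p \<and>
        (\<forall>\<^sub>F x in at_left s. f x \<in> \<phi> ` open_segment (-1) 0) \<and>
        (\<forall>\<^sub>F x in at_right s. f x \<in> \<phi> ` open_segment 0 1) \<and>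
        (\<forall>\<^sub>F x in at_left t. f x \<in> \<phi> ` open_segment (-\<i>) 0) \<and>
        (\<forall>\<^sub>F x in at_right t. f x \<in> \<phi> ` open_segment 0 \<i>))"

text \<open>In every chart the incoming half-axes, ending at \<open>-1\<close> and \<open>-\<i>\<close>, are joined to each other,
  and so are the outgoing ones, ending at \<open>1\<close> and \<open>\<i>\<close>.\<close>

definition non_Seifert_resolution :: "(real \<Rightarrow> real^3) \<Rightarrow> (real^3) set \<Rightarrow> bool" where
  "non_Seifert_resolution f T \<longleftrightarrow>
     (\<exists>\<phi>. (\<forall>p\<in>double_points f. crossing_chart f p (\<phi> p)) \<and>
        disjoint_family_on (\<lambda>p. \<phi> p ` cball 0 1) (double_points f) \<and>
        T = (range f - (\<Union>p\<in>double_points f. \<phi> p ` cball 0 1)) \<union>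
            (\<Union>p\<in>double_points f. \<phi> p ` (closed_segment (-1) (-\<i>) \<union> closed_segment 1 \<i>)))"

text \<open>Since an oriented parametrisation and charts are chosen, the arrangement is determined only up to
  isotopy; \<open>\<tau>\<close> picks one.\<close>

definition circle_arrangement :: "(real^3) set \<Rightarrow> (real^3) set set \<Rightarrow> bool" where
  "circle_arrangement P \<C> \<longleftrightarrow>
     (\<exists>f T. generic_immersion f \<and> P = range f \<and> non_Seifert_resolution f T \<and> \<C> = components T)"

definition \<tau> :: "(real^3) set \<Rightarrow> (real^3) set set" where
  "\<tau> P = (SOME \<C>. circle_arrangement P \<C>)"

definition circle_number :: "(real^3) set \<Rightarrow> nat" where
  "circle_number P = card (\<tau> P)"

end

(* The circle number depends only on the cyclic word of double points read off while running along
   the curve. Each edge is joined at its tail to the other edge leaving the same double point, and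
   at its head to the other edge arriving there; the circles are the classes of edges under the
   equivalence this generates ("circuits"). A kink only subdivides one class. A coherent 2-gon cuts
   two strands into three edges each, and the resolution reconnects them so that the outer parts of
   each strand are joined again, through the inner edge of the other strand.

   That the word depends only on the image of the curve (up to reversal and homeomorphisms of the
   sphere) is shown by following two parametrisations along the edges: at a double point they
   continue in the same way because opposite half-branches are distinguished from neighbouring ones
   by the complementary regions on whose boundary they lie. *)

theory Submission
  imports Defs
begin

section \<open>Counting equivalence classes and components\<close>

text \<open>\<open>\<tau>\<close> fixes an arrangement by choice among all parametrisations and all
  charts, so a count is needed that is blind to these choices. \<open>circuits\<close> sees a curve
  only through coincidences of parameters, which turns the two moves into statements about maps of
  the parameter line that collapse arcs to points. Smoothness and transversality serve to produce
  charts, hence some resolution. The obstacle is isotopy: the homeomorphism at its end may turn a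
  smooth parametrisation into one that is merely continuous, so tangents cannot decide which
  half-branch continues which at a double point, and a continuous curve with the same image could a
  priori turn there. For this reason \<open>circuits\<close> is studied for continuous curves with
  finitely many double points, and charts are carried along as separate data.\<close>

definition classes :: "('a \<Rightarrow> 'a \<Rightarrow> bool) \<Rightarrow> 'a set set" where
  "classes R = range (\<lambda>x. Collect (equivclp R x))"

lemma equivclp_hom:
  assumes "equivclp R x y" and "\<And>x y. R x y \<Longrightarrow> equivclp S (\<kappa> x) (\<kappa> y)"
  shows "equivclp S (\<kappa> x) (\<kappa> y)"
  using assms(1)
proof (induction rule: equivclp_induct)
  case base
  show ?case by simp
next
  case (step y z)
  then have "equivclp S (\<kappa> y) (\<kappa> z)"
    using assms(2) equivclp_sym by metis
  with step show ?case
    using equivclp_trans by metis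
qed

lemma Collect_equivclp_eq: "Collect (equivclp R x) = Collect (equivclp R y) \<longleftrightarrow> equivclp R x y"
  by (metis (no_types, lifting) Collect_cong equivclp_refl equivclp_sym equivclp_trans mem_Collect_eq)

text \<open>The two maps need only be inverse to each other up to the generated equivalences. This
  allows comparing classes of real parameters with classes of natural numbers, and two curves by
  maps that collapse arcs.\<close>

lemma card_classes_eq:
  assumes RS: "\<And>x y. R x y \<Longrightarrow> equivclp S (\<kappa> x) (\<kappa> y)"
    and SR: "\<And>x y. S x y \<Longrightarrow> equivclp R (\<kappa>' x) (\<kappa>' y)"
    and RR: "\<And>x. equivclp R (\<kappa>' (\<kappa> x)) x"
    and SS: "\<And>x. equivclp S (\<kappa> (\<kappa>' x)) x"
  shows "card (classes R) = card (classes S)"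
proof -
  \<comment> \<open>The union over all members makes the induced map on classes independent of a
    representative.\<close>
  define h where "h X = (\<Union>x\<in>X. Collect (equivclp S (\<kappa> x)))" for X
  define h' where "h' X = (\<Union>x\<in>X. Collect (equivclp R (\<kappa>' x)))" for X
  have h: "h (Collect (equivclp R x)) = Collect (equivclp S (\<kappa> x))" for x
    unfolding h_def using equivclp_hom[of R x _ S \<kappa>, OF _ RS] equivclp_trans[of S] equivclp_refl[of R x]
    by blast
  have h': "h' (Collect (equivclp S x)) = Collect (equivclp R (\<kappa>' x))" for x
    unfolding h'_def using equivclp_hom[of S x _ R \<kappa>', OF _ SR] equivclp_trans[of R] equivclp_refl[of S x]
    by blast
  have "bij_betw h (classes R) (classes S)"
  proof (rule bij_betw_byWitness[where f' = h'])
    show "\<forall>X\<in>classes R. h' (h X) = X"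
      unfolding classes_def by (auto simp: h h' Collect_equivclp_eq RR)
    show "\<forall>X\<in>classes S. h (h' X) = X"
      unfolding classes_def by (auto simp: h h' Collect_equivclp_eq SS)
    show "h ` classes R \<subseteq> classes S" "h' ` classes S \<subseteq> classes R"
      unfolding classes_def by (auto simp: h h')
  qed
  then show ?thesis
    by (rule bij_betw_same_card)
qed

text \<open>Sets joined by a chain of meeting sets have a connected union; unions over different
  classes are disjoint, and closed because there are only finitely many different sets. Finiteness
  is asked of the range of \<open>A\<close> because the edges will be indexed by all natural
  numbers, with repetitions.\<close>

lemma card_components_eq_classes:
  fixes A :: "'i \<Rightarrow> 'a::topological_space set"
  assumes fin: "finite (range A)" and con: "\<And>i. connected (A i)" and clo: "\<And>i. closed (A i)"
    and ne: "\<And>i. A i \<noteq> {}" and R: "\<And>i j. R i j \<longleftrightarrow> A i \<inter> A j \<noteq> {}"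
  shows "card (components (\<Union>i. A i)) = card (classes R)"
proof -
  define K where "K i = (\<Union>j\<in>Collect (equivclp R i). A j)" for i
  have sub: "A i \<subseteq> K i" for i
    unfolding K_def using equivclp_refl[of R i] by blast
  have K_eq: "K i = K j \<longleftrightarrow> equivclp R i j" for i j
  proof
    assume "K i = K j"
    obtain x where "x \<in> A i" using ne by blast
    then have "x \<in> K j"
      using sub \<open>K i = K j\<close> by blast
    then obtain k where "equivclp R j k" "x \<in> A k"
      unfolding K_def by blast
    moreover have "R i k"
      using R \<open>x \<in> A i\<close> \<open>x \<in> A k\<close> by blast
    ultimately show "equivclp R i j"
      by (meson equivclp_sym equivclp_trans r_into_equivclp)
  next
    assume "equivclp R i j"
    then show "K i = K j"
      unfolding K_def using Collect_equivclp_eq by metis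
  qed
  have K_disj: "K i \<inter> K j = {}" if "\<not> equivclp R i j" for i j
  proof (rule ccontr)
    assume "K i \<inter> K j \<noteq> {}"
    then obtain x k l where "equivclp R i k" "equivclp R j l" "x \<in> A k" "x \<in> A l"
      unfolding K_def by blast
    then have "equivclp R i k" "equivclp R l j" "R k l"
      using R by (auto intro: equivclp_sym)
    then show False
      using that by (meson equivclp_trans r_into_equivclp)
  qed
  have K_con: "connected (K i)" for i
  proof -
    \<comment> \<open>A chain from \<open>i\<close> to \<open>j\<close> yields a connected set
      containing both ends; all these sets share \<open>A i\<close>.\<close>
    have "\<exists>C. connected C \<and> A i \<subseteq> C \<and> A j \<subseteq> C \<and> C \<subseteq> K i" if "equivclp R i j" for j
      using that
    proof (induction rule: equivclp_induct)
      case base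
      then show ?case using con sub by blast
    next
      case (step y z)
      then obtain C where C: "connected C" "A i \<subseteq> C" "A y \<subseteq> C" "C \<subseteq> K i" by blast
      have "A y \<inter> A z \<noteq> {}"
        using step R by blast
      then have "connected (C \<union> A z)"
        using C con by (intro connected_Un) auto
      moreover have "A z \<subseteq> K i"
        unfolding K_def using step equivclp_into_equivclp by fast
      ultimately show ?case
        using C by (intro exI[of _ "C \<union> A z"]) auto
    qed
    then obtain C where C: "\<And>j. equivclp R i j \<Longrightarrow> connected (C j) \<and> A i \<subseteq> C j \<and> A j \<subseteq> C j \<and> C j \<subseteq> K i"
      by metis
    have "K i = (\<Union>j\<in>Collect (equivclp R i). C j)"
      using C unfolding K_def by blast
    also have "connected \<dots>"
    proof (rule connected_Union)
      have "A i \<subseteq> \<Inter> (C ` Collect (equivclp R i))" using C by blast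
      then show "\<Inter> (C ` Collect (equivclp R i)) \<noteq> {}" using ne by blast
    qed (use C in auto)
    finally show ?thesis .
  qed
  have fin': "finite (A ` J)" for J
    using fin by (rule finite_subset[rotated]) auto
  have K_clo: "closed (K i)" for i
    unfolding K_def using fin' clo by (intro closed_Union) auto
  have K_comp: "K i \<in> components (\<Union>i. A i)" for i
  proof -
    define L where "L = (\<Union>j\<in>{j. \<not> equivclp R i j}. A j)"
    have U: "(\<Union>i. A i) = K i \<union> L"
      unfolding K_def L_def by blast
    have c2: "closed L"
      unfolding L_def using fin' clo by (intro closed_Union) auto
    have d: "K i \<inter> L = {}"
      unfolding L_def using K_disj sub by blast
    have Kne: "K i \<noteq> {}" using ne sub by blast
    \<comment> \<open>A connected \<open>E\<close> cannot meet both of the disjoint closed sets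
      \<open>K i\<close> and \<open>L\<close>.\<close>
    have "E = K i" if E: "K i \<subseteq> E" "E \<subseteq> K i \<union> L" "connected E" for E
    proof -
      have "K i \<inter> L \<inter> E = {}" "K i \<inter> E \<noteq> {}" using d Kne E(1) by auto
      then have "L \<inter> E = {}"
        using connected_closedD[OF E(3) _ E(2) K_clo c2] by auto
      then show ?thesis using E by auto
    qed
    then show ?thesis
      unfolding in_components_maximal U using Kne K_con[of i] by auto
  qed
  have "components (\<Union>i. A i) = range K"
  proof (rule antisym)
    show "range K \<subseteq> components (\<Union>i. A i)"
      using K_comp by blast
    show "components (\<Union>i. A i) \<subseteq> range K"
    proof
      fix C assume C: "C \<in> components (\<Union>i. A i)"
      then obtain x i where "x \<in> C" "x \<in> A i"
        by (metis UN_E ex_in_conv in_components_nonempty in_components_subset subsetD)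
      then have "K i \<inter> C \<noteq> {}" using sub by blast
      then show "C \<in> range K"
        using C K_comp components_eq by blast
    qed
  qed
  moreover have "bij_betw (\<lambda>X. \<Union>j\<in>X. A j) (classes R) (range K)"
  proof -
    have "inj_on (\<lambda>X. \<Union>j\<in>X. A j) (classes R)"
      unfolding inj_on_def classes_def using K_eq[unfolded K_def] by (auto simp: Collect_equivclp_eq)
    then show ?thesis
      unfolding bij_betw_def classes_def image_image K_def by simp
  qed
  ultimately show ?thesis
    using bij_betw_same_card by metis
qed

section \<open>Closed curves with finitely many double points\<close>

definition crossing_params :: "(real \<Rightarrow> real^3) \<Rightarrow> real set" where
  "crossing_params f = {x. f x \<in> double_points f}"

text \<open>For two crossing parameters this says that the edges starting there have the same tail or
  the same head. It is stated for all parameters, standing for the edges that contain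
  them, so that a curve without crossings needs no special treatment.\<close>

definition linked :: "(real \<Rightarrow> real^3) \<Rightarrow> real \<Rightarrow> real \<Rightarrow> bool" where
  "linked f x y \<longleftrightarrow> f x = f y \<or>
     (\<exists>c>x. \<exists>d>y. {x<..<c} \<inter> crossing_params f = {} \<and> {y<..<d} \<inter> crossing_params f = {} \<and> f c = f d)"

definition circuits :: "(real \<Rightarrow> real^3) \<Rightarrow> nat" where
  "circuits f = card (classes (linked f))"

text \<open>The topological content of a generic immersion: it survives composition with a
  homeomorphism of the sphere, unlike smoothness.\<close>

locale closed_curve =
  fixes f :: "real \<Rightarrow> real^3"
  assumes continuous: "continuous_on UNIV f"
    and periodic: "f (x + 1) = f x"
    and finite_double_points: "finite (double_points f)"
    and no_triple: "f x = f y \<Longrightarrow> f y = f z \<Longrightarrow> x - y \<in> \<int> \<or> y - z \<in> \<int> \<or> x - z \<in> \<int>"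
begin

abbreviation "D \<equiv> double_points f"
abbreviation "C \<equiv> crossing_params f"

lemma periodic_of_int: "f (x + of_int n) = f x"
proof (induction n rule: int_induct[where k = 0])
  case (step1 i)
  then show ?case using periodic[of "x + of_int i"] by (simp add: algebra_simps)
next
  case (step2 i)
  then show ?case using periodic[of "x + of_int (i - 1)"] by (simp add: algebra_simps)
qed simp

lemma crossing_add_of_int: "x + of_int n \<in> C \<longleftrightarrow> x \<in> C"
  by (simp add: crossing_params_def periodic_of_int)

lemma crossingI: "f x = f y \<Longrightarrow> x - y \<notin> \<int> \<Longrightarrow> x \<in> C"
  unfolding crossing_params_def double_points_def by auto

lemma Ints_of_eq: "f x = f y \<Longrightarrow> x \<notin> C \<Longrightarrow> x - y \<in> \<int>"
  using crossingI by blast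

lemma isCont: "isCont f x"
  using continuous by (simp add: continuous_on_eq_continuous_at)

text \<open>By \<open>no_triple\<close> the parameters over \<open>p\<close> lie in at most two
  classes modulo 1, and each class meets a bounded interval finitely often.\<close>

lemma finite_fibre: "finite (f -` {p} \<inter> {u..v})"
proof -
  have shift: "finite {x \<in> {u..v}. x - s \<in> \<int>}" for s
  proof -
    have "{x \<in> {u..v}. x - s \<in> \<int>} \<subseteq> (\<lambda>n. s + of_int n) ` {\<lfloor>u - s\<rfloor>..\<lceil>v - s\<rceil>}"
    proof
      fix x assume "x \<in> {x \<in> {u..v}. x - s \<in> \<int>}"
      then obtain n where "x - s = of_int n" "u \<le> x" "x \<le> v"
        by (auto elim: Ints_cases)
      then have "x = s + of_int n" "n \<in> {\<lfloor>u - s\<rfloor>..\<lceil>v - s\<rceil>}"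
        by (auto simp: floor_le_iff le_ceiling_iff)
      then show "x \<in> (\<lambda>n. s + of_int n) ` {\<lfloor>u - s\<rfloor>..\<lceil>v - s\<rceil>}" by blast
    qed
    then show ?thesis by (rule finite_subset) auto
  qed
  have "\<exists>s t. \<forall>x. f x = p \<longrightarrow> x - s \<in> \<int> \<or> x - t \<in> \<int>"
  proof (cases "\<exists>s t. f s = p \<and> f t = p \<and> s - t \<notin> \<int>")
    case True
    then show ?thesis using no_triple by metis
  next
    case False
    then show ?thesis by metis
  qed
  then obtain s t where st: "\<And>x. f x = p \<Longrightarrow> x - s \<in> \<int> \<or> x - t \<in> \<int>" by blast
  have "f -` {p} \<inter> {u..v} \<subseteq> {x \<in> {u..v}. x - s \<in> \<int>} \<union> {x \<in> {u..v}. x - t \<in> \<int>}"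
    using st by auto
  then show ?thesis
    using shift finite_subset by blast
qed

text \<open>The marked points form an arbitrary finite set because edges are later cut at the double
  points of two curves at once.\<close>

lemma finite_marked: "finite M \<Longrightarrow> finite (f -` M \<inter> {u..v})"
proof -
  assume "finite M"
  then have "finite (\<Union>p\<in>M. f -` {p} \<inter> {u..v})"
    by (intro finite_UN_I finite_fibre)
  then show ?thesis
    by (rule finite_subset[rotated]) auto
qed

lemma eventually_unmarked:
  assumes "finite M"
  shows "\<forall>\<^sub>F y in at x. f y \<notin> M"
proof -
  have "\<not> x islimpt (f -` M \<inter> {x - 1..x + 1})"
    using finite_marked[OF assms] by (rule islimpt_finite)
  then have "\<forall>\<^sub>F y in at x. y \<notin> f -` M \<inter> {x - 1..x + 1}"
    by (simp add: islimpt_iff_eventually)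
  moreover have "\<forall>\<^sub>F y in at x. y \<in> {x - 1..x + 1}"
    by (rule eventually_at_in_open'[of "{x - 1<..<x + 1}", THEN eventually_mono]) auto
  ultimately show ?thesis
    by eventually_elim auto
qed

lemma eventually_not_crossing: "\<forall>\<^sub>F y in at x. y \<notin> C"
  using eventually_unmarked[OF finite_double_points] by (simp add: crossing_params_def)

lemma exists_next_marked:
  assumes M: "finite M" and "f c \<in> M"
  shows "\<exists>d>x. f d \<in> M \<and> (\<forall>z. x < z \<and> z < d \<longrightarrow> f z \<notin> M)"
proof -
  \<comment> \<open>This gives the first translate of \<open>c\<close> strictly to the right of
    \<open>x\<close>.\<close>
  define n where "n = \<lfloor>x - c\<rfloor> + 1"
  have n: "c + of_int n > x" "f (c + of_int n) \<in> M"
    unfolding n_def using assms(2) periodic_of_int[of c "\<lfloor>x - c\<rfloor> + 1"]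
    by (auto, linarith)
  define S where "S = f -` M \<inter> {x<..c + of_int n}"
  have "finite S"
    unfolding S_def by (rule finite_subset[OF _ finite_marked[OF M, of x "c + of_int n"]]) auto
  moreover have "c + of_int n \<in> S" unfolding S_def using n by auto
  ultimately have m: "Min S \<in> S" "\<And>z. z \<in> S \<Longrightarrow> Min S \<le> z" by (auto intro: Min_in)
  have "f z \<notin> M" if "x < z" "z < Min S" for z
    using m(2)[of z] that m(1) S_def by force
  then show ?thesis using m(1) S_def by (intro exI[of _ "Min S"]) auto
qed

lemma exists_prev_marked:
  assumes M: "finite M" and "f c \<in> M"
  shows "\<exists>d<x. f d \<in> M \<and> (\<forall>z. d < z \<and> z < x \<longrightarrow> f z \<notin> M)"
proof -
  define n where "n = \<lceil>x - c\<rceil> - 1"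
  have n: "c + of_int n < x" "f (c + of_int n) \<in> M"
    unfolding n_def using assms(2) periodic_of_int[of c "\<lceil>x - c\<rceil> - 1"]
    by (auto, linarith)
  define S where "S = f -` M \<inter> {c + of_int n..<x}"
  have "finite S"
    unfolding S_def by (rule finite_subset[OF _ finite_marked[OF M, of "c + of_int n" x]]) auto
  moreover have "c + of_int n \<in> S" unfolding S_def using n by auto
  ultimately have m: "Max S \<in> S" "\<And>z. z \<in> S \<Longrightarrow> z \<le> Max S" by (auto intro: Max_in)
  have "f z \<notin> M" if "z < x" "Max S < z" for z
    using m(2)[of z] that m(1) S_def by force
  then show ?thesis using m(1) S_def by (intro exI[of _ "Max S"]) auto
qed

lemma linked_sym: "linked f x y \<Longrightarrow> linked f y x"
  unfolding linked_def by (elim disjE exE conjE) (simp, metis)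

text \<open>Continue past \<open>y\<close> to some \<open>b\<close> before the next crossing: both
  arcs then end at the same parameter. The left end \<open>x\<close> may be a crossing, as a
  parameter stands for the edge that starts there.\<close>

lemma linked_arc:
  assumes "x \<le> y" "{x<..y} \<inter> C = {}"
  shows "linked f x y"
proof -
  obtain b where b: "b > y" "\<And>z. y < z \<Longrightarrow> z < b \<Longrightarrow> z \<notin> C"
    using eventually_not_crossing[of y] unfolding eventually_at_split eventually_at_right_field by blast
  have "{x<..<b} \<inter> C = {}"
  proof -
    have "z \<notin> C" if "x < z" "z < b" for z
      using assms(2) b(2)[of z] that by (cases "z \<le> y") auto
    then show ?thesis by auto
  qed
  moreover have "{y<..<b} \<inter> C = {}"
    using b by auto
  ultimately show ?thesis
    unfolding linked_def using b(1) assms(1) by (intro disjI2 exI[of _ b]) auto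
qed

text \<open>Local conditions for \<open>\<kappa>\<close> to respect \<open>linked\<close>. By
  \<open>h2\<close> and \<open>h3\<close> its class is locally constant along an edge, so by
  connectedness constant on it; \<open>h4\<close> compares two edges with a common head, where
  \<open>\<kappa>\<close> may jump, through the values just before the head.\<close>

lemma linked_transfer:
  assumes E: "equivp E"
    and h1: "\<And>x y. f x = f y \<Longrightarrow> E (\<kappa> x) (\<kappa> y)"
    and h2: "\<And>x. x \<notin> C \<Longrightarrow> \<forall>\<^sub>F z in at_left x. E (\<kappa> z) (\<kappa> x)"
    and h3: "\<And>x. \<forall>\<^sub>F z in at_right x. E (\<kappa> z) (\<kappa> x)"
    and h4: "\<And>c d. c \<in> C \<Longrightarrow> f c = f d \<Longrightarrow>
       \<exists>e. (\<forall>\<^sub>F z in at_left c. E (\<kappa> z) e) \<and> (\<forall>\<^sub>F z in at_left d. E (\<kappa> z) e)"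
    and "linked f x y"
  shows "E (\<kappa> x) (\<kappa> y)"
proof -
  have refl: "E a a" and sym: "E a b \<Longrightarrow> E b a" and trans: "E a b \<Longrightarrow> E b c \<Longrightarrow> E a c" for a b c
    using E by (auto elim: equivpE dest: reflpD sympD transpD)
  have arc: "E (\<kappa> x) (\<kappa> y)" if "x \<le> y" "{x<..y} \<inter> C = {}" for x y
  proof (rule connected_equivalence_relation[where S = "{x..y}" and R = "\<lambda>x y. E (\<kappa> x) (\<kappa> y)"])
    fix a assume a: "a \<in> {x..y}"
    obtain b where b: "b > a" "\<And>z. a < z \<Longrightarrow> z < b \<Longrightarrow> E (\<kappa> z) (\<kappa> a)"
      using h3[of a] unfolding eventually_at_right_field by blast
    have "\<exists>l<a. \<forall>z\<in>{x..y}. l < z \<and> z < a \<longrightarrow> E (\<kappa> z) (\<kappa> a)"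
    \<comment> \<open>To the left of the starting point \<open>x\<close>, which may be a crossing,
      nothing has to be checked.\<close>
    proof (cases "a = x")
      case True
      then show ?thesis by (intro exI[of _ "a - 1"]) auto
    next
      case False
      then have "a \<in> {x<..y}" using a by auto
      then have "a \<notin> C" using that by blast
      then show ?thesis using h2[of a] unfolding eventually_at_left_field by blast
    qed
    then obtain l where l: "l < a" "\<And>z. z \<in> {x..y} \<Longrightarrow> l < z \<Longrightarrow> z < a \<Longrightarrow> E (\<kappa> z) (\<kappa> a)" by blast
    have "E (\<kappa> a) (\<kappa> z)" if "z \<in> {x..y} \<inter> {l<..<b}" for z
      using that l(2)[of z] b(2)[of z] refl[of "\<kappa> a"] sym[of "\<kappa> z" "\<kappa> a"]
      by (cases z a rule: linorder_cases) auto
    moreover have "openin (top_of_set {x..y}) ({x..y} \<inter> {l<..<b})"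
      by (simp add: openin_open_Int)
    ultimately show "\<exists>T. openin (top_of_set {x..y}) T \<and> a \<in> T \<and> (\<forall>z\<in>T. E (\<kappa> a) (\<kappa> z))"
      using a b l by (intro exI[of _ "{x..y} \<inter> {l<..<b}"]) auto
  qed (simp, use that in simp, use that in simp, erule sym, erule (1) trans)
  from \<open>linked f x y\<close> show ?thesis
    unfolding linked_def
  proof (elim disjE exE conjE)
    assume "f x = f y"
    then show ?thesis by (rule h1)
  next
    fix c d
    assume cd: "x < c" "y < d" "{x<..<c} \<inter> C = {}" "{y<..<d} \<inter> C = {}" "f c = f d"
    show ?thesis
    proof (cases "c \<in> C")
      case True
      obtain e where e: "\<forall>\<^sub>F z in at_left c. E (\<kappa> z) e" "\<forall>\<^sub>F z in at_left d. E (\<kappa> z) e"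
        using h4[OF True cd(5)] by blast
      have near: "E (\<kappa> x) e" if "x < c" "{x<..<c} \<inter> C = {}" "\<forall>\<^sub>F z in at_left c. E (\<kappa> z) e" for x c
      proof -
        have "\<forall>\<^sub>F z in at_left c. z \<in> {x<..<c}"
          using that(1) by (rule eventually_at_left_real)
        with that(3) have "\<forall>\<^sub>F z in at_left c. E (\<kappa> z) e \<and> z \<in> {x<..<c}"
          by eventually_elim auto
        then obtain z where z: "E (\<kappa> z) e" "z \<in> {x<..<c}"
          using eventually_happens[of _ "at_left c"] by force
        have "{x<..z} \<subseteq> {x<..<c}" using z by auto
        then have "{x<..z} \<inter> C = {}" using that(2) by blast
        then show ?thesis using arc[of x z] z trans by auto
      qed
      show ?thesis
        using trans[OF near[OF cd(1,3) e(1)] sym[OF near[OF cd(2,4) e(2)]]] .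
    next
      case False
      then have "d \<notin> C" using cd(5) by (simp add: crossing_params_def)
      \<comment> \<open>A common end that is no crossing is an ordinary point, so both arcs may be
        closed up at it and \<open>h1\<close> joins them there.\<close>
      have "{x<..c} \<inter> C = {}" "{y<..d} \<inter> C = {}"
        using cd False \<open>d \<notin> C\<close> by (auto simp: disjoint_iff order_le_less)
      then have "E (\<kappa> x) (\<kappa> c)" "E (\<kappa> y) (\<kappa> d)" using arc cd by auto
      then show ?thesis using trans[OF _ trans[OF h1[OF cd(5)] sym]] by simp
    qed
  qed
qed

end

section \<open>Invariance under the two moves\<close>

lemma eventually_at_leftI':
  fixes x :: real
  assumes "l < x" "\<And>z. l < z \<Longrightarrow> z < x \<Longrightarrow> P z"
  shows "\<forall>\<^sub>F z in at_left x. P z"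
  using assms unfolding eventually_at_left_field by blast

lemma eventually_at_rightI':
  fixes x :: real
  assumes "x < r" "\<And>z. x < z \<Longrightarrow> z < r \<Longrightarrow> P z"
  shows "\<forall>\<^sub>F z in at_right x. P z"
  using assms unfolding eventually_at_right_field by blast

lemma eventually_at_left_shift:
  fixes x n :: real
  assumes "\<forall>\<^sub>F z in at_left x. P z"
  shows "\<forall>\<^sub>F z in at_left (x + n). P (z - n)"
proof -
  obtain l where "l < x" "\<And>z. l < z \<Longrightarrow> z < x \<Longrightarrow> P z"
    using assms unfolding eventually_at_left_field by blast
  then show ?thesis by (intro eventually_at_leftI'[of "l + n"]) auto
qed

lemma eventually_at_right_shift:
  fixes x n :: real
  assumes "\<forall>\<^sub>F z in at_right x. P z"
  shows "\<forall>\<^sub>F z in at_right (x + n). P (z - n)"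
proof -
  obtain l where "x < l" "\<And>z. x < z \<Longrightarrow> z < l \<Longrightarrow> P z"
    using assms unfolding eventually_at_right_field by blast
  then show ?thesis by (intro eventually_at_rightI'[of _ "l + n"]) auto
qed

lemma exists_translate:
  fixes x a :: real
  obtains n :: int where "x + of_int n \<in> {a..<a + 1}"
proof
  show "x + of_int (- \<lfloor>x - a\<rfloor>) \<in> {a..<a + 1}"
    by simp linarith
qed

text \<open>The map that agrees with \<open>k\<close> on \<open>{a..<a + 1}\<close> and commutes
  with integer translations.\<close>

definition periodic_ext :: "real \<Rightarrow> (real \<Rightarrow> real) \<Rightarrow> real \<Rightarrow> real" where
  "periodic_ext a k x = k (x - of_int \<lfloor>x - a\<rfloor>) + of_int \<lfloor>x - a\<rfloor>"

lemma periodic_ext_add: "periodic_ext a k (x + of_int n) = periodic_ext a k x + of_int n"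
proof -
  have "\<lfloor>x + of_int n - a\<rfloor> = \<lfloor>x - a\<rfloor> + n"
    by (metis add.commute add_diff_eq floor_add_int)
  then show ?thesis
    unfolding periodic_ext_def by simp
qed

text \<open>The window reaches to the left of \<open>a\<close>, where the translated
  \<open>k\<close> is the identity as well; so left-hand neighbourhoods of \<open>a\<close> can be
  treated with \<open>k\<close> itself.\<close>

lemma periodic_ext_eq:
  assumes "a \<le> d" "d < a + 1" "\<And>z. z \<notin> {a..<d} \<Longrightarrow> k z = z" "d - 1 < z" "z < a + 1"
  shows "periodic_ext a k z = k z"
proof (cases "a \<le> z")
  case True
  then have "\<lfloor>z - a\<rfloor> = 0" using assms by linarith
  then show ?thesis by (simp add: periodic_ext_def)
next
  case False
  then have "\<lfloor>z - a\<rfloor> = -1" using assms by linarith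
  then show ?thesis using assms False by (simp add: periodic_ext_def)
qed

context closed_curve
begin

lemma crossingE:
  assumes "x \<in> C"
  obtains y where "x - y \<notin> \<int>" "f y = f x"
proof -
  obtain u v where uv: "u - v \<notin> \<int>" "f u = f x" "f v = f x"
    using assms unfolding crossing_params_def double_points_def by auto
  show ?thesis
  proof (cases "x - u \<in> \<int>")
    case True
    then have "x - v \<notin> \<int>"
      using uv(1) Ints_diff[of "x - v" "x - u"] by auto
    then show ?thesis using that uv by blast
  qed (use that uv in blast)
qed

text \<open>The class of a parameter is constant just to the right of every parameter, but to the
  left only away from crossings, because a crossing parameter stands for the edge leaving
  it.\<close>

lemma linked_at_left: "x \<notin> C \<Longrightarrow> \<forall>\<^sub>F z in at_left x. linked f z x"
proof -
  assume x: "x \<notin> C"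
  obtain l where l: "l < x" "\<And>z. l < z \<Longrightarrow> z < x \<Longrightarrow> z \<notin> C"
    using eventually_not_crossing[of x] unfolding eventually_at_split eventually_at_left_field by blast
  have "linked f z x" if "l < z" "z < x" for z
  proof (rule linked_arc)
    have "w \<notin> C" if "z < w" "w \<le> x" for w
      using that l(2)[of w] x \<open>l < z\<close> by (cases "w = x") auto
    then show "{z<..x} \<inter> C = {}" by auto
  qed (use that in simp)
  then show ?thesis
    using eventually_at_leftI'[OF l(1)] by metis
qed

lemma linked_at_right: "\<forall>\<^sub>F z in at_right x. linked f z x"
proof -
  obtain l where l: "x < l" "\<And>z. x < z \<Longrightarrow> z < l \<Longrightarrow> z \<notin> C"
    using eventually_not_crossing[of x] unfolding eventually_at_split eventually_at_right_field by blast
  have "linked f z x" if "x < z" "z < l" for z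
  proof (rule linked_sym, rule linked_arc)
    have "w \<notin> C" if "x < w" "w \<le> z" for w
      using that l(2)[of w] \<open>z < l\<close> by auto
    then show "{x<..z} \<inter> C = {}" by auto
  qed (use that in simp)
  then show ?thesis
    using eventually_at_rightI'[OF l(1)] by metis
qed

text \<open>The common value \<open>e\<close> is a parameter on the edge that arrives at
  \<open>c\<close>; the edge arriving at \<open>d\<close> has the same head.\<close>

lemma linked_heads:
  assumes "f c = f d"
  shows "\<exists>e. (\<forall>\<^sub>F z in at_left c. equivclp (linked f) z e) \<and> (\<forall>\<^sub>F z in at_left d. equivclp (linked f) z e)"
proof -
  have free: "\<exists>l<c. {l<..<c} \<inter> C = {}" for c
  proof -
    obtain l where "l < c" "\<And>z. l < z \<Longrightarrow> z < c \<Longrightarrow> z \<notin> C"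
      using eventually_not_crossing[of c] unfolding eventually_at_split eventually_at_left_field by blast
    then show ?thesis by (intro exI[of _ l]) auto
  qed
  obtain l m where l: "l < c" "{l<..<c} \<inter> C = {}" and m: "m < d" "{m<..<d} \<inter> C = {}"
    using free by metis
  have lc: "{z<..<c} \<inter> C = {}" if "l \<le> z" for z using l(2) that by (auto simp: disjoint_iff)
  have md: "{z<..<d} \<inter> C = {}" if "m \<le> z" for z using m(2) that by (auto simp: disjoint_iff)
  have "linked f z l" if "l < z" "z < c" for z
    unfolding linked_def using that l lc[of z] by (intro disjI2 exI[of _ c] conjI) auto
  moreover have "linked f z l" if "m < z" "z < d" for z
    unfolding linked_def using that l m md[of z] assms
    by (intro disjI2 exI[of _ d] exI[of _ c] conjI) auto
  ultimately show ?thesis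
    by (intro exI[of _ l]) (auto intro!: eventually_at_leftI'[OF l(1)] eventually_at_leftI'[OF m(1)])
qed

end

text \<open>\<open>I\<close> consists of the parameters in \<open>{a..d}\<close> at which the curves are inside the disk of a
  move.\<close>

locale curve_pair = f: closed_curve f + g: closed_curve g
  for f g :: "real \<Rightarrow> real^3" +
  fixes I :: "real set" and a d :: real
  assumes I: "I \<subseteq> {a..d}" "closed I" and ad: "a \<le> d" and da: "d < a + 1"
    and agree: "(\<And>n::int. x + of_int n \<notin> I) \<Longrightarrow> f x = g x"
    and apart: "(\<And>n::int. x + of_int n \<notin> I) \<Longrightarrow> y \<in> I \<Longrightarrow> f x \<noteq> f y \<and> g x \<noteq> g y"
begin

text \<open>Translates of \<open>{a..d}\<close> by non-zero integers stay outside the open window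
  from \<open>d - 1\<close> to \<open>a + 1\<close>.\<close>

lemma outside: "x \<in> {d - 1<..<a + 1} \<Longrightarrow> x \<notin> I \<Longrightarrow> x + of_int n \<notin> I"
proof
  assume x: "x \<in> {d - 1<..<a + 1}" "x \<notin> I" "x + of_int n \<in> I"
  then have "a \<le> x + of_int n" "x + of_int n \<le> d" using I by auto
  then have "n > -1" "n < 1" using x(1) by auto
  then have "n = 0" by simp
  then show False using x by simp
qed

lemma outside_eq: "x \<in> {d - 1<..<a + 1} \<Longrightarrow> x \<notin> I \<Longrightarrow> f x = g x"
  using outside agree by blast

text \<open>\<open>apart\<close> keeps the partner of a crossing in \<open>I\<close> within the
  translates of \<open>I\<close>, and a translation brings it into \<open>I\<close> itself.\<close>

lemma crossing_cases:
  assumes "x \<in> I" "x \<in> g.C"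
  obtains y where "y \<in> I" "y \<noteq> x" "g y = g x"
proof -
  obtain y0 where y: "x - y0 \<notin> \<int>" "g y0 = g x"
    using g.crossingE[OF assms(2)] by blast
  have "\<exists>n::int. y0 + of_int n \<in> I"
    using apart[of y0 x] assms(1) y(2) by metis
  then obtain n :: int where "y0 + of_int n \<in> I" by blast
  moreover have "y0 + of_int n \<noteq> x"
    using y(1) by auto
  ultimately show ?thesis
    using that y(2) g.periodic_of_int by metis
qed

lemma crossing_outside:
  assumes "x \<in> {d - 1<..<a + 1}" "x \<notin> I" "x \<in> g.C"
  shows "x \<in> f.C"
proof -
  have out: "\<And>n. x + of_int n \<notin> I" using outside assms by blast
  obtain y where y: "x - y \<notin> \<int>" "g y = g x"
    using g.crossingE[OF assms(3)] by blast
  have "y + of_int n \<notin> I" for n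
    using apart[OF out, of "y + of_int n"] y(2) g.periodic_of_int by metis
  then have "f y = f x" using agree y(2) out by metis
  then show ?thesis using f.crossingI y(1) by metis
qed

text \<open>This is \<open>linked_transfer\<close> for the periodic extension of \<open>k\<close>.
  Away from the translates of \<open>I\<close> the curves agree, \<open>k\<close> is the identity
  and the behaviour of \<open>linked g\<close> is known, so only parameters of \<open>I\<close> are
  left to the individual moves. At the ends of \<open>I\<close>, where \<open>k\<close> may jump,
  both one-sided neighbourhoods still have to be checked.\<close>

lemma move_transfer:
  assumes k: "\<And>z. z \<notin> I \<Longrightarrow> k z = z" "\<And>z. z \<notin> {a..<d} \<Longrightarrow> k z = z"
    and h1: "\<And>x y. x \<in> I \<Longrightarrow> y \<in> I \<Longrightarrow> f x = f y \<Longrightarrow> x \<noteq> y \<Longrightarrow> equivclp (linked g) (k x) (k y)"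
    and h2: "\<And>x. x \<in> I \<Longrightarrow> x \<notin> f.C \<Longrightarrow> \<forall>\<^sub>F z in at_left x. equivclp (linked g) (k z) (k x)"
    and h3: "\<And>x. x \<in> I \<Longrightarrow> \<forall>\<^sub>F z in at_right x. equivclp (linked g) (k z) (k x)"
    and h4: "\<And>c d. c \<in> I \<Longrightarrow> d \<in> I \<Longrightarrow> c \<in> f.C \<Longrightarrow> f c = f d \<Longrightarrow>
       \<exists>e. (\<forall>\<^sub>F z in at_left c. equivclp (linked g) (k z) e) \<and> (\<forall>\<^sub>F z in at_left d. equivclp (linked g) (k z) e)"
    and "linked f x y"
  shows "equivclp (linked g) (periodic_ext a k x) (periodic_ext a k y)"
proof -
  let ?E = "equivclp (linked g)" and ?\<kappa> = "periodic_ext a k"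
  have \<kappa>: "?\<kappa> z = k z" if "z \<in> {d - 1<..<a + 1}" for z
    using periodic_ext_eq[OF ad da k(2)] that by simp
  have evl: "\<forall>\<^sub>F z in at_left x. z \<in> {d - 1<..<a + 1}"
    and evr: "\<forall>\<^sub>F z in at_right x. z \<in> {d - 1<..<a + 1}" if "x \<in> {d - 1<..<a + 1}" for x
    using that by (auto intro: eventually_at_leftI'[of "d - 1"] eventually_at_rightI'[of _ "a + 1"])
  have outl: "\<forall>\<^sub>F z in at_left x. z \<notin> I" and outr: "\<forall>\<^sub>F z in at_right x. z \<notin> I" if "x \<notin> I" for x
  proof -
    have "\<forall>\<^sub>F z in nhds x. z \<in> - I"
      using I(2) that by (intro eventually_nhds_in_open) auto
    then show "\<forall>\<^sub>F z in at_left x. z \<notin> I" "\<forall>\<^sub>F z in at_right x. z \<notin> I"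
      by (auto simp: eventually_at_filter elim: eventually_mono)
  qed
  have shift: "?E (?\<kappa> (x + of_int n)) (?\<kappa> x)" for x n
  proof -
    have "linked g (?\<kappa> x + of_int n) (?\<kappa> x)"
      unfolding linked_def by (simp add: g.periodic_of_int)
    then show ?thesis unfolding periodic_ext_add by blast
  qed
  have left_eq: "\<forall>\<^sub>F z in at_left x. ?\<kappa> z = z" if "x \<in> {d - 1<..<a + 1}" "x \<notin> I" for x
    using evl[OF that(1)] outl[OF that(2)] by eventually_elim (simp add: \<kappa> k)
  have right_eq: "\<forall>\<^sub>F z in at_right x. ?\<kappa> z = z" if "x \<in> {d - 1<..<a + 1}" "x \<notin> I" for x
    using evr[OF that(1)] outr[OF that(2)] by eventually_elim (simp add: \<kappa> k)
  have dom: "x \<in> {d - 1<..<a + 1}" if "x \<in> {a..<a + 1}" for x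
    using that da by auto
  \<comment> \<open>The four conditions are checked on the fundamental interval starting at
    \<open>a\<close> and transported to all parameters at the end.\<close>
  have H1: "?E (?\<kappa> x) (?\<kappa> y)" if xy: "x \<in> {a..<a + 1}" "y \<in> {a..<a + 1}" "f x = f y" for x y
  proof (cases "x = y")
    case False
    show ?thesis
    proof (cases "x \<in> I")
      case True
      then have "y \<in> I"
        using apart[of y x] outside[of y] xy dom by metis
      then show ?thesis using True h1 False xy \<kappa> dom by auto
    next
      case xI: False
      then have "y \<notin> I"
        using apart[of x y] outside[of x] xy dom by metis
      then have "g x = g y" using outside_eq xI xy dom by metis
      then have "linked g x y" unfolding linked_def by simp
      then show ?thesis using xI \<open>y \<notin> I\<close> k \<kappa> xy dom by (simp add: r_into_equivclp)
    qed
  qed simp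
  have H2: "\<forall>\<^sub>F z in at_left x. ?E (?\<kappa> z) (?\<kappa> x)" if x: "x \<in> {a..<a + 1}" "x \<notin> f.C" for x
  proof (cases "x \<in> I")
    case True
    show ?thesis
      using h2[OF True x(2)] evl[OF dom[OF x(1)]]
      by eventually_elim (use \<kappa> dom x in simp)
  next
    case False
    then have "x \<notin> g.C" using crossing_outside dom x by blast
    then have "\<forall>\<^sub>F z in at_left x. linked g z x" by (rule g.linked_at_left)
    then show ?thesis
      using left_eq[OF dom[OF x(1)] False]
      by eventually_elim (use False k \<kappa>[of x] dom x in \<open>simp add: r_into_equivclp\<close>)
  qed
  have H3: "\<forall>\<^sub>F z in at_right x. ?E (?\<kappa> z) (?\<kappa> x)" if x: "x \<in> {a..<a + 1}" for x
  proof (cases "x \<in> I")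
    case True
    show ?thesis
      using h3[OF True] evr[OF dom[OF x]]
      by eventually_elim (use \<kappa> dom x in simp)
  next
    case False
    show ?thesis
      using g.linked_at_right[of x] right_eq[OF dom[OF x] False]
      by eventually_elim (use False k \<kappa>[of x] dom x in \<open>simp add: r_into_equivclp\<close>)
  qed
  have H4: "\<exists>e. (\<forall>\<^sub>F z in at_left c. ?E (?\<kappa> z) e) \<and> (\<forall>\<^sub>F z in at_left c'. ?E (?\<kappa> z) e)"
    if c: "c \<in> {a..<a + 1}" "c' \<in> {a..<a + 1}" "c \<in> f.C" "f c = f c'" for c c'
  proof (cases "c \<in> I")
    case True
    then have c': "c' \<in> I"
      using apart[of c' c] outside[of c'] c dom by metis
    obtain e where e: "\<forall>\<^sub>F z in at_left c. ?E (k z) e" "\<forall>\<^sub>F z in at_left c'. ?E (k z) e"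
      using h4[OF True c' c(3,4)] by blast
    have "\<forall>\<^sub>F z in at_left c. ?E (?\<kappa> z) e"
      using e(1) evl[OF dom[OF c(1)]] by eventually_elim (simp add: \<kappa>)
    moreover have "\<forall>\<^sub>F z in at_left c'. ?E (?\<kappa> z) e"
      using e(2) evl[OF dom[OF c(2)]] by eventually_elim (simp add: \<kappa>)
    ultimately show ?thesis by blast
  next
    case False
    then have c': "c' \<notin> I"
      using apart[of c c'] outside[of c] c dom by metis
    then have "g c = g c'" using outside_eq False c dom by metis
    then obtain e where e: "\<forall>\<^sub>F z in at_left c. ?E z e" "\<forall>\<^sub>F z in at_left c'. ?E z e"
      using g.linked_heads by blast
    have "\<forall>\<^sub>F z in at_left c. ?E (?\<kappa> z) e"
      using e(1) left_eq[OF dom[OF c(1)] False] by eventually_elim simp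
    moreover have "\<forall>\<^sub>F z in at_left c'. ?E (?\<kappa> z) e"
      using e(2) left_eq[OF dom[OF c(2)] c'] by eventually_elim simp
    ultimately show ?thesis by blast
  qed
  show ?thesis
  proof (rule f.linked_transfer[where E = ?E and \<kappa> = ?\<kappa>])
    fix x y assume "f x = f y"
    obtain n m where "x + of_int n \<in> {a..<a + 1}" "y + of_int m \<in> {a..<a + 1}"
      using exists_translate by metis
    then have "?E (?\<kappa> (x + of_int n)) (?\<kappa> (y + of_int m))"
      using H1 \<open>f x = f y\<close> by (simp add: f.periodic_of_int)
    then show "?E (?\<kappa> x) (?\<kappa> y)"
      using shift equivclp_sym equivclp_trans by metis
  next
    fix x assume "x \<notin> f.C"
    obtain n where n: "x + of_int n \<in> {a..<a + 1}"
      using exists_translate by metis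
    then have "\<forall>\<^sub>F z in at_left (x + of_int n). ?E (?\<kappa> z) (?\<kappa> (x + of_int n))"
      using H2 \<open>x \<notin> f.C\<close> f.crossing_add_of_int by blast
    from eventually_at_left_shift[OF this, of "- of_int n"]
    have "\<forall>\<^sub>F z in at_left x. ?E (?\<kappa> (z + of_int n)) (?\<kappa> (x + of_int n))" by simp
    then show "\<forall>\<^sub>F z in at_left x. ?E (?\<kappa> z) (?\<kappa> x)"
      by (rule eventually_mono) (meson shift equivclp_sym equivclp_trans)
  next
    fix x
    obtain n where n: "x + of_int n \<in> {a..<a + 1}"
      using exists_translate by metis
    then have "\<forall>\<^sub>F z in at_right (x + of_int n). ?E (?\<kappa> z) (?\<kappa> (x + of_int n))"
      using H3 by blast
    from eventually_at_right_shift[OF this, of "- of_int n"]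
    have "\<forall>\<^sub>F z in at_right x. ?E (?\<kappa> (z + of_int n)) (?\<kappa> (x + of_int n))" by simp
    then show "\<forall>\<^sub>F z in at_right x. ?E (?\<kappa> z) (?\<kappa> x)"
      by (rule eventually_mono) (meson shift equivclp_sym equivclp_trans)
  next
    fix c c' assume c: "c \<in> f.C" "f c = f c'"
    obtain n m where n: "c + of_int n \<in> {a..<a + 1}" and m: "c' + of_int m \<in> {a..<a + 1}"
      using exists_translate by metis
    obtain e where e: "\<forall>\<^sub>F z in at_left (c + of_int n). ?E (?\<kappa> z) e"
        "\<forall>\<^sub>F z in at_left (c' + of_int m). ?E (?\<kappa> z) e"
      using H4[OF n m] c by (auto simp: f.periodic_of_int f.crossing_add_of_int)
    have "\<forall>\<^sub>F z in at_left c. ?E (?\<kappa> (z + of_int n)) e"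
      "\<forall>\<^sub>F z in at_left c'. ?E (?\<kappa> (z + of_int m)) e"
      using eventually_at_left_shift[OF e(1), of "- of_int n"]
        eventually_at_left_shift[OF e(2), of "- of_int m"] by simp_all
    then have "\<forall>\<^sub>F z in at_left c. ?E (?\<kappa> z) e" "\<forall>\<^sub>F z in at_left c'. ?E (?\<kappa> z) e"
      by (auto elim!: eventually_mono intro: equivclp_trans[OF equivclp_sym[OF shift]])
    then show "\<exists>e. (\<forall>\<^sub>F z in at_left c. ?E (?\<kappa> z) e) \<and> (\<forall>\<^sub>F z in at_left c'. ?E (?\<kappa> z) e)"
      by blast
  qed (use assms in auto)
qed

lemma linked_periodic_ext:
  assumes "\<And>z. z \<in> {a..<a + 1} \<Longrightarrow> equivclp (linked g) (k z) z"
  shows "equivclp (linked g) (periodic_ext a k x) x"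
proof -
  have "x - of_int \<lfloor>x - a\<rfloor> \<in> {a..<a + 1}" by simp linarith
  note assms[OF this]
  moreover have "linked g (z + of_int n) z" for z n
    unfolding linked_def by (simp add: g.periodic_of_int)
  moreover have "linked g (x - of_int n) x" for n
    unfolding linked_def using g.periodic_of_int[of "x - of_int n" n] by simp
  ultimately show ?thesis
    unfolding periodic_ext_def by (meson equivclp_trans r_into_equivclp)
qed

lemma curve_pair_swap: "curve_pair g f I a d"
  using I ad da agree apart by unfold_locales (metis | blast)+

end

section \<open>Local changes of generic immersions\<close>

lemma smooth_differentiable: "smooth f \<Longrightarrow> f differentiable (at x)"
  unfolding smooth_def by (metis funpow_0)

lemma generic_immersion_closed_curve:
  assumes "generic_immersion f"
  shows "closed_curve f"
proof
  have "smooth f"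
    using assms unfolding generic_immersion_def immersion_def by blast
  then show "continuous_on UNIV f"
    by (simp add: continuous_at_imp_continuous_on differentiable_imp_continuous_within smooth_differentiable)
qed (use assms in \<open>auto simp: generic_immersion_def immersion_def\<close>)

lemma disk_closed:
  assumes "disk D"
  shows "closed D"
proof -
  have "D homeomorphic cball (0::complex) 1"
    using assms unfolding disk_def by simp
  then have "compact D"
    using homeomorphic_compactness compact_cball by fast
  then show ?thesis by (rule compact_imp_closed)
qed

text \<open>Only the interior of \<open>I\<close> is known to be sent into the disk. As the disk is
  closed and \<open>I\<close> is the closure of its interior, continuity puts all of
  \<open>I\<close> there, while parameters off the translates of \<open>I\<close> are sent outside;
  this gives \<open>apart\<close>.\<close>

lemma local_change_curve_pair:
  assumes lc: "local_change D I f g" and I: "I \<subseteq> {a..d}" "closed I" "I \<subseteq> closure (interior I)"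
    and ad: "a \<le> d" "d < a + 1"
  shows "curve_pair f g I a d"
proof -
  interpret f: closed_curve f
    using lc generic_immersion_closed_curve unfolding local_change_def by blast
  interpret g: closed_curve g
    using lc generic_immersion_closed_curve unfolding local_change_def by blast
  have D: "closed D" using lc disk_closed unfolding local_change_def by blast
  have off: "f x = g x" "f x \<notin> D" if "\<And>n::int. x + of_int n \<notin> I" for x
    using lc that unfolding local_change_def by blast+
  have "\<forall>x\<in>interior I. f x \<in> S2_top interior_of D \<and> g x \<in> S2_top interior_of D"
    using lc unfolding local_change_def by simp
  then have "interior I \<subseteq> f -` D \<inter> g -` D"
    using interior_of_subset[of S2_top D] by auto
  moreover have "closed (f -` D \<inter> g -` D)"
    using closed_vimage[OF D f.continuous] closed_vimage[OF D g.continuous] by (rule closed_Int)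
  ultimately have "closure (interior I) \<subseteq> f -` D \<inter> g -` D"
    by (rule closure_minimal)
  then have inside: "f x \<in> D" "g x \<in> D" if "x \<in> I" for x
    using that I(3) by auto
  show ?thesis
  proof (unfold_locales; (rule I ad)?)
    fix x y
    assume "\<And>n::int. x + of_int n \<notin> I"
    then show "f x = g x" by (rule off)
    assume "y \<in> I"
    then show "f x \<noteq> f y \<and> g x \<noteq> g y"
      using inside[of y] off[OF \<open>\<And>n::int. x + of_int n \<notin> I\<close>] by auto
  qed
qed

section \<open>Collapsing a kink and a coherent 2-gon\<close>

lemma (in closed_curve) linked_via_heads:
  assumes "x < c" "y < d" "{x<..<c} \<inter> C = {}" "{y<..<d} \<inter> C = {}" "f c = f d"
  shows "linked f x y"
  unfolding linked_def using assms by blast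

text \<open>In \<open>g\<close> the edge ending at \<open>s\<close> and the loop have a common head,
  and the loop and the edge starting at \<open>t\<close> have a common tail, so the three arcs
  inside the disk lie in one class. Collapsing \<open>{a..<b}\<close> to \<open>a\<close> therefore
  stays within the classes of both curves and serves in both directions.\<close>

lemma circuits_RI:
  assumes ab: "a < s" "s < t" "t < b" "b < a + 1" and lc: "local_change D {a..b} f g"
    and injf: "inj_on f {a..b}" and injg: "inj_on g ({a..b} - {s})" and st: "g s = g t"
  shows "circuits f = circuits g"
proof -
  have pair: "curve_pair f g {a..b} a b"
    using ab by (intro local_change_curve_pair[OF lc]) auto
  interpret curve_pair f g "{a..b}" a b by (rule pair)
  interpret sw: curve_pair g f "{a..b}" a b by (rule curve_pair_swap)
  \<comment> \<open>\<open>b\<close> stays fixed so that \<open>k\<close> is the identity from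
    \<open>b\<close> on; the jump there is harmless because \<open>a\<close> and \<open>b\<close>
    are equivalent for both curves.\<close>
  define k where "k z = (if a \<le> z \<and> z < b then a else z)" for z :: real
  have fC: "x \<notin> f.C" if "x \<in> {a..b}" for x
    using sw.crossing_cases[OF that] inj_onD[OF injf _ _ that] by metis
  have g_cases: "x = y \<or> {x, y} = {s, t}" if "x \<in> {a..b}" "y \<in> {a..b}" "g x = g y" for x y
  proof -
    have "x = t" if "x \<in> {a..b}" "g x = g s" "x \<noteq> s" for x
      using inj_onD[OF injg, of x t] that st ab by auto
    then show ?thesis
      using that inj_onD[OF injg, of x y] by (cases "x = s"; cases "y = s") auto
  qed
  have gC: "x \<in> {s, t}" if "x \<in> {a..b}" "x \<in> g.C" for x
    using crossing_cases[OF that] g_cases[OF that(1)] by (metis insert_iff)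
  have fab: "linked f a z" if "a \<le> z" "z \<le> b" for z
    using fC that by (intro f.linked_arc) auto
  have g_arc: "linked g x y"
    if "x \<le> y" "a \<le> x" "y \<le> b" "s \<le> x \<or> y < s" "t \<le> x \<or> y < t" for x y
  proof (rule g.linked_arc)
    have "{x<..y} \<subseteq> {a..b} - {s, t}" using that by auto
    then show "{x<..y} \<inter> g.C = {}" using gC by blast
  qed (use that in simp)
  have g_free: "{x<..<y} \<inter> g.C = {}" if "{x<..<y} \<subseteq> {a..b} - {s, t}" for x y
    using that gC by blast
  have g_all: "equivclp (linked g) x a" if x: "x \<in> {a..b}" for x
  proof -
    have as: "linked g a s"
      by (rule g.linked_via_heads[OF ab(1,2) g_free g_free st]) (use ab in auto)
    have ts: "linked g t s"
      using st by (simp add: linked_def)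
    consider "x < s" | "s \<le> x" "x < t" | "t \<le> x" by linarith
    then show ?thesis
    proof cases
      case 1
      then show ?thesis using g_arc[of a x] x ab g.linked_sym by auto
    next
      case 2
      then have "linked g s x" using g_arc[of s x] x ab by auto
      then show ?thesis using as by (meson equivclp_sym equivclp_trans r_into_equivclp)
    next
      case 3
      then have "linked g t x" using g_arc[of t x] x ab by auto
      then show ?thesis using as ts by (meson equivclp_sym equivclp_trans r_into_equivclp)
    qed
  qed
  have k_const: "k z = a" if "a \<le> z" "z < b" for z using that by (auto simp: k_def)
  have k_out: "k z = z" if "\<not> (a \<le> z \<and> z < b)" for z using that by (auto simp: k_def)
  have right: "\<forall>\<^sub>F z in at_right x. equivclp (linked h) (k z) (k x)"
    if "x \<in> {a..b}" "closed_curve h" for x h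
  proof (cases "x = b")
    case True
    show ?thesis
      using closed_curve.linked_at_right[OF that(2), of b] eventually_at_right_less[of b] unfolding True
      by eventually_elim (auto simp: k_out)
  next
    case False
    then show ?thesis using that by (intro eventually_at_rightI'[of x b]) (auto simp: k_const)
  qed
  have left: "\<forall>\<^sub>F z in at_left x. equivclp (linked h) (k z) (k x)"
    if "x \<in> {a..b}" "closed_curve h" "a \<notin> crossing_params h" "equivclp (linked h) a b" for x h
  proof (cases "x = a")
    case True
    have "\<forall>\<^sub>F z in at_left a. z < a" by (auto simp: eventually_at_filter)
    with closed_curve.linked_at_left[OF that(2,3)] show ?thesis unfolding True
      by eventually_elim (use ab in \<open>auto simp: k_out k_const\<close>)
  next
    case False
    then show ?thesis using that
      by (intro eventually_at_leftI'[of a x]) (cases "x = b"; auto simp: k_const k_out)+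
  qed
  have aC: "a \<notin> g.C" "b \<notin> g.C" using gC[of a] gC[of b] ab by auto
  have fg: "equivclp (linked g) (periodic_ext a k x) (periodic_ext a k y)" if "linked f x y" for x y
  proof (rule move_transfer[OF _ _ _ _ _ _ that])
    show "\<forall>\<^sub>F z in at_left x. equivclp (linked g) (k z) (k x)" if "x \<in> {a..b}" for x
      using left[OF that g.closed_curve_axioms aC(1) equivclp_sym[OF g_all]] ab by auto
  qed (use inj_onD[OF injf] fC right[OF _ g.closed_curve_axioms] in \<open>auto simp: k_out\<close>)
  have gf: "equivclp (linked f) (periodic_ext a k x) (periodic_ext a k y)" if "linked g x y" for x y
  proof (rule sw.move_transfer[OF _ _ _ _ _ _ that])
    show "equivclp (linked f) (k x) (k y)" if "x \<in> {a..b}" "y \<in> {a..b}" "g x = g y" "x \<noteq> y" for x y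
      using g_cases[OF that(1-3)] that(4) ab by (auto simp: k_const doubleton_eq_iff)
    show "\<forall>\<^sub>F z in at_left x. equivclp (linked f) (k z) (k x)" if "x \<in> {a..b}" for x
      using left[OF that f.closed_curve_axioms fC r_into_equivclp[of "linked f" a b, OF fab]] ab by auto
    show "\<exists>e. (\<forall>\<^sub>F z in at_left c. equivclp (linked f) (k z) e) \<and>
              (\<forall>\<^sub>F z in at_left d. equivclp (linked f) (k z) e)"
      if "c \<in> {a..b}" "d \<in> {a..b}" "c \<in> g.C" "g c = g d" for c d
    proof -
      have "c \<in> {s, t}" "d \<in> {s, t}"
        using that gC g_cases[OF that(1,2,4)] by auto
      then show ?thesis using ab
        by (intro exI[of _ a] conjI eventually_at_leftI'[of a]) (auto simp: k_const)
    qed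
  qed (use right[OF _ f.closed_curve_axioms] in \<open>auto simp: k_out\<close>)
  have kf: "equivclp (linked f) (k z) z" for z
    using fab[of z] by (cases "a \<le> z \<and> z < b") (auto simp: k_const k_out)
  have kg: "equivclp (linked g) (k z) z" for z
    using g_all[of z] equivclp_sym by (cases "a \<le> z \<and> z < b") (auto simp: k_const k_out)
  have "equivclp (linked f) (periodic_ext a k x) x" "equivclp (linked g) (periodic_ext a k x) x" for x
    using kf kg sw.linked_periodic_ext linked_periodic_ext by blast+
  then show ?thesis
    unfolding circuits_def
    by (intro card_classes_eq[where \<kappa> = "periodic_ext a k" and \<kappa>' = "periodic_ext a k"] fg gf)
      (meson equivclp_trans)+
qed

text \<open>The edges of \<open>g\<close> ending at \<open>s\<close> and at \<open>v\<close> share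
  their head, those starting at \<open>u\<close> and at \<open>t\<close> their tail; this chains
  \<open>a\<close>, \<open>u\<close> and \<open>t\<close>. Likewise \<open>c\<close>,
  \<open>s\<close> and \<open>v\<close> are chained, by the common head at \<open>t\<close> and
  \<open>u\<close> and the common tail at \<open>s\<close> and \<open>v\<close>. So the two inner
  edges change strands while each strand stays in one class.\<close>

lemma circuits_strong_RII:
  assumes ord: "a < s" "s < t" "t < b" "b < c" "c < u" "u < v" "v < d" "d < a + 1"
    and lc: "local_change D ({a..b} \<union> {c..d}) f g"
    and injf: "inj_on f ({a..b} \<union> {c..d})"
    and injg: "inj_on g {a..b}" "inj_on g {c..d}" and int: "g ` {a..b} \<inter> g ` {c..d} = {g s, g t}"
    and coh: "g t = g u" "g v = g s"
  shows "circuits f = circuits g"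
proof -
  let ?I = "{a..b} \<union> {c..d}"
  have pair: "curve_pair f g ?I a d"
  proof (rule local_change_curve_pair[OF lc])
    have "{a..b} \<subseteq> closure (interior ?I)" "{c..d} \<subseteq> closure (interior ?I)"
      using ord closure_mono[OF interior_mono[of "{a..b}" ?I]] closure_mono[OF interior_mono[of "{c..d}" ?I]]
      by auto
    then show "?I \<subseteq> closure (interior ?I)" by blast
  qed (use ord in auto)
  interpret curve_pair f g ?I a d by (rule pair)
  interpret sw: curve_pair g f ?I a d by (rule curve_pair_swap)
  \<comment> \<open>\<open>k\<close> collapses each strand to its start. \<open>l\<close> does the
    same for \<open>g\<close>, with the two inner edges exchanged between the strands.\<close>
  define k where "k z = (if a \<le> z \<and> z < b then a else if c \<le> z \<and> z < d then c else z)" for z :: real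
  define l where "l z = (if a \<le> z \<and> z < s \<or> t \<le> z \<and> z < b \<or> u \<le> z \<and> z < v then a
     else if s \<le> z \<and> z < t \<or> c \<le> z \<and> z < u \<or> v \<le> z \<and> z < d then c else z)" for z :: real
  have fC: "x \<notin> f.C" if "x \<in> ?I" for x
    using sw.crossing_cases[OF that] inj_onD[OF injf _ _ that] by metis
  have g_cross: "x = s \<and> y = v \<or> x = t \<and> y = u" if "x \<in> {a..b}" "y \<in> {c..d}" "g x = g y" for x y
  proof -
    have "g x \<in> {g s, g t}"
      using int that by blast
    then consider "g x = g s" | "g x = g t" by blast
    then show ?thesis
    proof cases
      case 1
      moreover from this have "g y = g v" using that(3) coh by metis
      ultimately have "x = s" "y = v"
        using inj_onD[OF injg(1) _ that(1), of s] inj_onD[OF injg(2) _ that(2), of v] ord by simp_all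
      then show ?thesis by simp
    next
      case 2
      moreover from this have "g y = g u" using that(3) coh by metis
      ultimately have "x = t" "y = u"
        using inj_onD[OF injg(1) _ that(1), of t] inj_onD[OF injg(2) _ that(2), of u] ord by simp_all
      then show ?thesis by simp
    qed
  qed
  have g_cases: "x = y \<or> {x, y} = {s, v} \<or> {x, y} = {t, u}" if xy: "x \<in> ?I" "y \<in> ?I" "g x = g y" for x y
  proof -
    consider "x \<in> {a..b}" "y \<in> {a..b}" | "x \<in> {c..d}" "y \<in> {c..d}"
      | "x \<in> {a..b}" "y \<in> {c..d}" | "y \<in> {a..b}" "x \<in> {c..d}"
      using xy by blast
    then show ?thesis
    proof cases
      case 1
      then show ?thesis using inj_onD[OF injg(1) xy(3)] by blast
    next
      case 2
      then show ?thesis using inj_onD[OF injg(2) xy(3)] by blast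
    next
      case 3
      then show ?thesis using g_cross[OF 3 xy(3)] by blast
    next
      case 4
      then show ?thesis using g_cross[OF 4 xy(3)[symmetric]] by blast
    qed
  qed
  have gC: "x \<in> {s, t, u, v}" if "x \<in> ?I" "x \<in> g.C" for x
    using crossing_cases[OF that] g_cases[OF that(1)] by (metis insert_iff singletonD)
  have fab: "linked f a z" if "a \<le> z" "z \<le> b" for z
    using fC that by (intro f.linked_arc) auto
  have fcd: "linked f c z" if "c \<le> z" "z \<le> d" for z
    using fC that by (intro f.linked_arc) auto
  have g_arc: "linked g x y"
    if "x \<le> y" "a \<le> x \<and> y \<le> b \<or> c \<le> x \<and> y \<le> d" "s \<le> x \<or> y < s" "t \<le> x \<or> y < t"
      "u \<le> x \<or> y < u" "v \<le> x \<or> y < v" for x y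
  proof (rule g.linked_arc)
    have "{x<..y} \<subseteq> ?I - {s, t, u, v}" using that by auto
    then show "{x<..y} \<inter> g.C = {}" using gC by blast
  qed (use that in simp)
  have g_free: "{x<..<y} \<inter> g.C = {}" if "{x<..<y} \<subseteq> ?I - {s, t, u, v}" for x y
    using that gC by blast
  note tr = equivclp_trans[of "linked g"] and sy = equivclp_sym[of "linked g"]
  have au: "equivclp (linked g) a u"
    by (intro r_into_equivclp g.linked_via_heads[of a s u v] g_free) (use ord coh in auto)
  have cs: "equivclp (linked g) c s"
    by (intro r_into_equivclp g.linked_via_heads[of c u s t] g_free) (use ord coh in auto)
  have tu: "equivclp (linked g) t u" and sv: "equivclp (linked g) s v"
    using coh by (auto simp: linked_def)
  have at: "equivclp (linked g) a t" and cv: "equivclp (linked g) c v"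
    using tr[OF au sy[OF tu]] tr[OF cs sv] by auto
  have g_a: "equivclp (linked g) a z" if "a \<le> z \<and> z < s \<or> t \<le> z \<and> z \<le> b \<or> u \<le> z \<and> z < v" for z
    using that
  proof (elim disjE)
    assume "a \<le> z \<and> z < s"
    then show ?thesis using g_arc[of a z] ord by auto
  next
    assume "t \<le> z \<and> z \<le> b"
    then show ?thesis using g_arc[of t z] ord tr[OF at] by auto
  next
    assume "u \<le> z \<and> z < v"
    then show ?thesis using g_arc[of u z] ord tr[OF au] by auto
  qed
  have g_c: "equivclp (linked g) c z" if "s \<le> z \<and> z < t \<or> c \<le> z \<and> z < u \<or> v \<le> z \<and> z \<le> d" for z
    using that
  proof (elim disjE)
    assume "s \<le> z \<and> z < t"
    then show ?thesis using g_arc[of s z] ord tr[OF cs] by auto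
  next
    assume "c \<le> z \<and> z < u"
    then show ?thesis using g_arc[of c z] ord by auto
  next
    assume "v \<le> z \<and> z \<le> d"
    then show ?thesis using g_arc[of v z] ord tr[OF cv] by auto
  qed
  have left_end: "\<forall>\<^sub>F z in at_left x. equivclp (linked h) (m z) (m x)"
    if "closed_curve h" "x \<notin> crossing_params h" "y < x" "\<And>z. y < z \<Longrightarrow> z \<le> x \<Longrightarrow> m z = z" for x y :: real and h and m :: "real \<Rightarrow> real"
  proof -
    have "\<forall>\<^sub>F z in at_left x. y < z \<and> z < x"
      using that(3) by (intro eventually_at_leftI'[of y]) auto
    with closed_curve.linked_at_left[OF that(1,2)] show ?thesis
      by eventually_elim (use that(3,4) in auto)
  qed
  have right_end: "\<forall>\<^sub>F z in at_right x. equivclp (linked h) (m z) (m x)"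
    if "closed_curve h" "x < y" "\<And>z. x \<le> z \<Longrightarrow> z < y \<Longrightarrow> m z = z" for x y :: real and h and m :: "real \<Rightarrow> real"
  proof -
    have "\<forall>\<^sub>F z in at_right x. x < z \<and> z < y"
      using that(2) by (intro eventually_at_rightI'[of _ y]) auto
    with closed_curve.linked_at_right[OF that(1)] show ?thesis
      by eventually_elim (use that(2,3) in auto)
  qed
  have const_left: "\<forall>\<^sub>F z in at_left x. equivclp (linked h) (m z) e"
    if "y < x" "\<And>z. y < z \<Longrightarrow> z < x \<Longrightarrow> m z = w" "equivclp (linked h) w e" for x y w e :: real and h and m :: "real \<Rightarrow> real"
    using that by (intro eventually_at_leftI'[of y]) auto
  have const_right: "\<forall>\<^sub>F z in at_right x. equivclp (linked h) (m z) (m x)"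
    if "x < y" "\<And>z. x \<le> z \<Longrightarrow> z < y \<Longrightarrow> m z = m x" for x y :: real and h and m :: "real \<Rightarrow> real"
  proof (rule eventually_at_rightI'[OF that(1)])
    fix z assume "x < z" "z < y"
    then have "m z = m x" by (intro that(2)) simp_all
    then show "equivclp (linked h) (m z) (m x)" by (simp only: equivclp_refl)
  qed
  have aC: "a \<notin> g.C" "c \<notin> g.C" using gC[of a] gC[of c] ord by auto
  have fg: "equivclp (linked g) (periodic_ext a k x) (periodic_ext a k y)" if "linked f x y" for x y
  proof (rule move_transfer[OF _ _ _ _ _ _ that])
    fix x assume x: "x \<in> ?I"
    then consider "x = a" | "x = c" | "a < x" "x < b" | "c < x" "x < d" | "x = b" | "x = d"
      by fastforce
    then show "\<forall>\<^sub>F z in at_left x. equivclp (linked g) (k z) (k x)"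
    proof cases
      case 1
      show ?thesis unfolding 1
        by (rule left_end[OF g.closed_curve_axioms aC(1), of "a - 1"]) (use ord in \<open>auto simp: k_def\<close>)
    next
      case 2
      show ?thesis unfolding 2
        by (rule left_end[OF g.closed_curve_axioms aC(2), of b]) (use ord in \<open>auto simp: k_def\<close>)
    next
      case 3
      show ?thesis
        by (rule const_left[of a _ _ a]) (use 3 ord in \<open>auto simp: k_def\<close>)
    next
      case 4
      show ?thesis
        by (rule const_left[of c _ _ c]) (use 4 ord in \<open>auto simp: k_def\<close>)
    next
      case 5
      show ?thesis
        by (rule const_left[of a _ _ a]) (use 5 ord g_a[of b] in \<open>auto simp: k_def\<close>)
    next
      case 6
      show ?thesis
        by (rule const_left[of c _ _ c]) (use 6 ord g_c[of d] in \<open>auto simp: k_def\<close>)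
    qed
    consider "a \<le> x" "x < b" | "c \<le> x" "x < d" | "x = b" | "x = d"
      using x by fastforce
    then show "\<forall>\<^sub>F z in at_right x. equivclp (linked g) (k z) (k x)"
    proof cases
      case 1
      show ?thesis by (rule const_right[of _ b]) (use 1 ord in \<open>auto simp: k_def\<close>)
    next
      case 2
      show ?thesis by (rule const_right[of _ d]) (use 2 ord in \<open>auto simp: k_def\<close>)
    next
      case 3
      show ?thesis unfolding 3
        by (rule right_end[OF g.closed_curve_axioms, of _ c]) (use ord in \<open>auto simp: k_def\<close>)
    next
      case 4
      show ?thesis unfolding 4
        by (rule right_end[OF g.closed_curve_axioms, of _ "d + 1"]) (use ord in \<open>auto simp: k_def\<close>)
    qed
  qed (use inj_onD[OF injf] fC ord in \<open>auto simp: k_def\<close>)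
  have gf: "equivclp (linked f) (periodic_ext a l x) (periodic_ext a l y)" if "linked g x y" for x y
  proof (rule sw.move_transfer[OF _ _ _ _ _ _ that])
    show "equivclp (linked f) (l x) (l y)" if "x \<in> ?I" "y \<in> ?I" "g x = g y" "x \<noteq> y" for x y
    proof -
      have "l s = l v" "l t = l u"
        using ord by (auto simp: l_def)
      then show ?thesis
        using g_cases[OF that(1-3)] that(4) by (auto simp: doubleton_eq_iff)
    qed
    fix x assume x: "x \<in> ?I"
    {
      assume "x \<notin> g.C"
      \<comment> \<open>At these four parameters \<open>l\<close> jumps from the left, so they have
        to be recognised as crossings: \<open>s\<close> and \<open>v\<close>, and likewise
        \<open>t\<close> and \<open>u\<close>, have the same image and are less than 1
        apart.\<close>
      moreover have "s \<in> g.C" "t \<in> g.C" "u \<in> g.C" "v \<in> g.C"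
      proof -
        have "s - v \<notin> \<int>" "t - u \<notin> \<int>" "v - s \<notin> \<int>" "u - t \<notin> \<int>"
          using Ints_nonzero_abs_less1[of "s - v"] Ints_nonzero_abs_less1[of "t - u"]
            Ints_nonzero_abs_less1[of "v - s"] Ints_nonzero_abs_less1[of "u - t"] ord by auto
        then show "s \<in> g.C" "t \<in> g.C" "u \<in> g.C" "v \<in> g.C"
          using g.crossingI coh by metis+
      qed
      ultimately consider "x = a" | "x = c" | "a < x" "x < s" | "s < x" "x < t" | "t < x" "x < b"
        | "c < x" "x < u" | "u < x" "x < v" | "v < x" "x < d" | "x = b" | "x = d"
        using x by (metis Un_iff atLeastAtMost_iff order_le_less not_less_iff_gr_or_eq)
      then show "\<forall>\<^sub>F z in at_left x. equivclp (linked f) (l z) (l x)"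
      proof cases
        case 1
        show ?thesis unfolding 1
          by (rule left_end[OF f.closed_curve_axioms fC, of _ "a - 1"]) (use ord in \<open>auto simp: l_def\<close>)
      next
        case 2
        show ?thesis unfolding 2
          by (rule left_end[OF f.closed_curve_axioms fC, of _ b]) (use ord in \<open>auto simp: l_def\<close>)
      next
        case 3
        show ?thesis by (rule const_left[of a _ _ a]) (use 3 ord in \<open>auto simp: l_def\<close>)
      next
        case 4
        show ?thesis by (rule const_left[of s _ _ c]) (use 4 ord in \<open>auto simp: l_def\<close>)
      next
        case 5
        show ?thesis by (rule const_left[of t _ _ a]) (use 5 ord in \<open>auto simp: l_def\<close>)
      next
        case 6
        show ?thesis by (rule const_left[of c _ _ c]) (use 6 ord in \<open>auto simp: l_def\<close>)
      next
        case 7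
        show ?thesis by (rule const_left[of u _ _ a]) (use 7 ord in \<open>auto simp: l_def\<close>)
      next
        case 8
        show ?thesis by (rule const_left[of v _ _ c]) (use 8 ord in \<open>auto simp: l_def\<close>)
      next
        case 9
        show ?thesis by (rule const_left[of t _ _ a]) (use 9 ord fab[of b] in \<open>auto simp: l_def\<close>)
      next
        case 10
        show ?thesis by (rule const_left[of v _ _ c]) (use 10 ord fcd[of d] in \<open>auto simp: l_def\<close>)
      qed
    }
    consider "a \<le> x" "x < s" | "s \<le> x" "x < t" | "t \<le> x" "x < b"
      | "c \<le> x" "x < u" | "u \<le> x" "x < v" | "v \<le> x" "x < d" | "x = b" | "x = d"
      using x by fastforce
    then show "\<forall>\<^sub>F z in at_right x. equivclp (linked f) (l z) (l x)"
    proof cases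
      case 1
      show ?thesis by (rule const_right[of _ s]) (use 1 ord in \<open>auto simp: l_def\<close>)
    next
      case 2
      show ?thesis by (rule const_right[of _ t]) (use 2 ord in \<open>auto simp: l_def\<close>)
    next
      case 3
      show ?thesis by (rule const_right[of _ b]) (use 3 ord in \<open>auto simp: l_def\<close>)
    next
      case 4
      show ?thesis by (rule const_right[of _ u]) (use 4 ord in \<open>auto simp: l_def\<close>)
    next
      case 5
      show ?thesis by (rule const_right[of _ v]) (use 5 ord in \<open>auto simp: l_def\<close>)
    next
      case 6
      show ?thesis by (rule const_right[of _ d]) (use 6 ord in \<open>auto simp: l_def\<close>)
    next
      case 7
      show ?thesis unfolding 7
        by (rule right_end[OF f.closed_curve_axioms, of _ c]) (use ord in \<open>auto simp: l_def\<close>)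
    next
      case 8
      show ?thesis unfolding 8
        by (rule right_end[OF f.closed_curve_axioms, of _ "d + 1"]) (use ord in \<open>auto simp: l_def\<close>)
    qed
  next
    fix x y assume xy: "x \<in> ?I" "y \<in> ?I" "x \<in> g.C" "g x = g y"
    \<comment> \<open>Just before \<open>s\<close> and \<open>v\<close> the value is
      \<open>a\<close>, just before \<open>t\<close> and \<open>u\<close> it is \<open>c\<close>;
      this matches the pairs of parameters over the two vertices.\<close>
    have "\<forall>\<^sub>F z in at_left s. equivclp (linked f) (l z) a"
      by (rule const_left[of a _ _ a]) (use ord in \<open>auto simp: l_def\<close>)
    moreover have "\<forall>\<^sub>F z in at_left v. equivclp (linked f) (l z) a"
      by (rule const_left[of u _ _ a]) (use ord in \<open>auto simp: l_def\<close>)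
    moreover have "\<forall>\<^sub>F z in at_left t. equivclp (linked f) (l z) c"
      by (rule const_left[of s _ _ c]) (use ord in \<open>auto simp: l_def\<close>)
    moreover have "\<forall>\<^sub>F z in at_left u. equivclp (linked f) (l z) c"
      by (rule const_left[of c _ _ c]) (use ord in \<open>auto simp: l_def\<close>)
    moreover have "x = y \<and> x \<in> {s, t, u, v} \<or> {x, y} = {s, v} \<or> {x, y} = {t, u}"
      using g_cases[OF xy(1,2,4)] gC[OF xy(1,3)] by blast
    ultimately show "\<exists>e. (\<forall>\<^sub>F z in at_left x. equivclp (linked f) (l z) e) \<and>
              (\<forall>\<^sub>F z in at_left y. equivclp (linked f) (l z) e)"
      by (auto simp: doubleton_eq_iff)
  qed (use ord in \<open>auto simp: l_def\<close>)
  have kf: "equivclp (linked f) (k z) z" for z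
    using fab[of z] fcd[of z] by (auto simp: k_def)
  have lg: "equivclp (linked g) (l z) z" for z
    using g_a[of z] g_c[of z] by (auto simp: l_def)
  \<comment> \<open>Inside the disk both maps take only the values \<open>a\<close> and
    \<open>c\<close>, which they fix. A round trip is thus a single collapse, known to stay in its
    class.\<close>
  have "k (l z) = l z" "l (k z) = k z" for z
    using ord by (auto simp: k_def l_def)
  \<comment> \<open>Extension commutes with composition once the inner map preserves the fundamental
    interval, since then the integer part does not change.\<close>
  moreover have "periodic_ext a p (periodic_ext a q z) = periodic_ext a (\<lambda>z. p (q z)) z"
    if "\<And>z. z \<in> {a..<a + 1} \<Longrightarrow> q z \<in> {a..<a + 1}" for p q z
  proof -
    have "z - of_int \<lfloor>z - a\<rfloor> \<in> {a..<a + 1}" by simp linarith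
    from that[OF this] have "\<lfloor>q (z - of_int \<lfloor>z - a\<rfloor>) - a\<rfloor> = 0" by (simp add: floor_eq_iff)
    then show ?thesis
      using periodic_ext_add[of a p "q (z - of_int \<lfloor>z - a\<rfloor>)" "\<lfloor>z - a\<rfloor>"]
      unfolding periodic_ext_def[of a q] periodic_ext_def[of a "\<lambda>z. p (q z)"]
      by (simp add: periodic_ext_def[of a p "q _"])
  qed
  moreover have "k z \<in> {a..<a + 1}" "l z \<in> {a..<a + 1}" if "z \<in> {a..<a + 1}" for z
    using that ord by (auto simp: k_def l_def)
  ultimately have lk: "periodic_ext a l (periodic_ext a k z) = periodic_ext a k z"
    and kl: "periodic_ext a k (periodic_ext a l z) = periodic_ext a l z" for z
    by simp_all
  show ?thesis
    unfolding circuits_def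
    by (rule card_classes_eq[where \<kappa> = "periodic_ext a k" and \<kappa>' = "periodic_ext a l"])
      (use fg gf lk kl kf lg sw.linked_periodic_ext linked_periodic_ext in auto)
qed

section \<open>Edges\<close>

definition edge :: "(real \<Rightarrow> real^3) \<Rightarrow> (real^3) set \<Rightarrow> real \<Rightarrow> real \<Rightarrow> bool" where
  "edge f M c d \<longleftrightarrow> c < d \<and> f c \<in> M \<and> f d \<in> M \<and> (\<forall>z. c < z \<and> z < d \<longrightarrow> f z \<notin> M)"

context closed_curve
begin

lemma edge_shift:
  assumes "edge f M c d"
  shows "edge f M (c + of_int n) (d + of_int n)"
proof -
  have "f z \<notin> M" if "c + of_int n < z" "z < d + of_int n" for z
  proof -
    have "f (z - of_int n) \<notin> M" using assms that unfolding edge_def by simp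
    then show ?thesis using periodic_of_int[of "z - of_int n" n] by simp
  qed
  then show ?thesis using assms unfolding edge_def by (simp add: periodic_of_int)
qed

lemma edge_next: "edge f M c d \<Longrightarrow> f z \<in> M \<Longrightarrow> c < z \<Longrightarrow> d \<le> z"
  unfolding edge_def by (meson not_le)

lemma edge_prev: "edge f M c d \<Longrightarrow> f z \<in> M \<Longrightarrow> z < d \<Longrightarrow> z \<le> c"
  unfolding edge_def by (meson not_le)

lemma edge_overlap:
  assumes "edge f M c d" "edge f M c' d'" "c \<le> z" "z < d" "c' \<le> z" "z < d'"
  shows "c = c'" "d = d'"
proof -
  have M: "f c \<in> M" "f d \<in> M" "f c' \<in> M" "f d' \<in> M"
    using assms unfolding edge_def by auto
  show "c = c'"
    using edge_prev[OF assms(1) M(3)] edge_prev[OF assms(2) M(1)] assms(3-6) by linarith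
  then show "d = d'"
    using edge_next[OF assms(1) M(4)] edge_next[OF assms(2) M(2)] assms(3-6) by linarith
qed

lemma edge_length: "edge f M c d \<Longrightarrow> d \<le> c + 1"
  using edge_next[of M c d "c + 1"] periodic[of c] by (simp add: edge_def)

lemma edge_inj:
  assumes "edge f M c d" "D \<subseteq> M"
  shows "inj_on f {c<..<d}"
proof (rule inj_onI)
  fix x y assume xy: "x \<in> {c<..<d}" "y \<in> {c<..<d}" "f x = f y"
  have "x \<notin> C"
    using assms xy(1) unfolding edge_def crossing_params_def by auto
  then have "x - y \<in> \<int>"
    using Ints_of_eq xy(3) by blast
  moreover have "\<bar>x - y\<bar> < 1"
    using xy edge_length[OF assms(1)] by auto
  ultimately show "x = y"
    using Ints_nonzero_abs_less1[of "x - y"] by simp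
qed

lemma range_eq: "range f = f ` {a..a + 1}"
proof -
  have "f x \<in> f ` {a..a + 1}" for x
  proof -
    obtain n where "x + of_int n \<in> {a..<a + 1}" using exists_translate by metis
    then show ?thesis using periodic_of_int[of x n] by (metis atLeastAtMost_iff atLeastLessThan_iff imageI less_imp_le)
  qed
  then show ?thesis by auto
qed

lemma closed_image: "closed (f ` {a..b})"
  using compact_continuous_image[of "{a..b}" f] continuous continuous_on_subset
  by (intro compact_imp_closed) blast

text \<open>The curve is the union of the closed images of \<open>{c..d}\<close> and
  \<open>{d..c + 1}\<close>, which have only marked points in common. A connected set without marked
  points lies in one of them.\<close>

lemma connected_in_edge:
  assumes e: "edge f M c d" and DM: "D \<subseteq> M"
    and S: "connected S" "S \<subseteq> range f - M" "S \<inter> f ` {c<..<d} \<noteq> {}"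
  shows "S \<subseteq> f ` {c<..<d}"
proof -
  have ends: "f c \<in> M" "f d \<in> M" "c < d" using e unfolding edge_def by auto
  have "range f \<subseteq> f ` {c..d} \<union> f ` {d..c + 1}"
    unfolding range_eq[of c] using edge_length[OF e] by force
  then have cover: "S \<subseteq> f ` {c..d} \<union> f ` {d..c + 1}"
    using S(2) by blast
  have S_edge: "S \<inter> f ` {c..d} \<subseteq> f ` {c<..<d}"
  proof
    fix p assume "p \<in> S \<inter> f ` {c..d}"
    then obtain x where x: "p = f x" "x \<in> {c..d}" "p \<notin> M" using S(2) by blast
    then have "x \<noteq> c" "x \<noteq> d" using ends by auto
    then show "p \<in> f ` {c<..<d}" using x by auto
  qed
  have "f ` {c..d} \<inter> f ` {d..c + 1} \<inter> S = {}"
  proof (rule ccontr)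
    assume "f ` {c..d} \<inter> f ` {d..c + 1} \<inter> S \<noteq> {}"
    then obtain p where p: "p \<in> S" "p \<in> f ` {c..d}" "p \<in> f ` {d..c + 1}" by blast
    then have "p \<in> f ` {c<..<d}" using S_edge by blast
    then obtain x where x: "x \<in> {c<..<d}" "p = f x" by blast
    obtain y where y: "y \<in> {d..c + 1}" "p = f y" using p by blast
    have "p \<notin> M" using p S(2) by blast
    then have "x \<notin> C" using x DM unfolding crossing_params_def by blast
    then have "x - y \<in> \<int>" using Ints_of_eq x y by metis
    moreover have "y \<noteq> c + 1" using y ends \<open>p \<notin> M\<close> periodic[of c] by auto
    then have "\<bar>x - y\<bar> < 1" "x \<noteq> y" using x y by auto
    ultimately show False
      using Ints_nonzero_abs_less1[of "x - y"] by simp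
  qed
  moreover have "f ` {c..d} \<inter> S \<noteq> {}"
    using S(3) greaterThanLessThan_subseteq_atLeastAtMost_iff[of c d c d] by blast
  ultimately have "f ` {d..c + 1} \<inter> S = {}"
    using connected_closedD[OF S(1) _ cover closed_image closed_image] by blast
  then show ?thesis
    using cover S_edge by blast
qed

text \<open>The ends of an edge are marked and its inner points are not. So the image of a
  relatively closed set of inner parameters is cut out of the open edge by a compact set, and
  \<open>f\<close> is a closed map onto the open edge.\<close>

lemma edge_inverse:
  assumes e: "edge f M c d" and DM: "D \<subseteq> M"
  obtains \<theta> where "continuous_on (f ` {c<..<d}) \<theta>" "\<And>x. x \<in> {c<..<d} \<Longrightarrow> \<theta> (f x) = x"
proof -
  have ends: "f c \<in> M" "f d \<in> M" "\<And>z. z \<in> {c<..<d} \<Longrightarrow> f z \<notin> M"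
    using e unfolding edge_def by auto
  have "\<exists>\<theta>. homeomorphism {c<..<d} (f ` {c<..<d}) f \<theta>"
  proof (rule homeomorphism_injective_closed_map)
    show "continuous_on {c<..<d} f" using continuous continuous_on_subset by blast
    show "inj_on f {c<..<d}" by (rule edge_inj[OF e DM])
    fix U assume "closedin (top_of_set {c<..<d}) U"
    then obtain K where K: "closed K" "U = {c<..<d} \<inter> K"
      by (auto simp: closedin_closed)
    have "compact (f ` (K \<inter> {c..d}))"
      using K continuous continuous_on_subset
      by (intro compact_continuous_image closed_Int_compact) (blast | simp)+
    moreover have "f ` U = f ` {c<..<d} \<inter> f ` (K \<inter> {c..d})"
    proof
      show "f ` U \<subseteq> f ` {c<..<d} \<inter> f ` (K \<inter> {c..d})"
        using K by auto
      show "f ` {c<..<d} \<inter> f ` (K \<inter> {c..d}) \<subseteq> f ` U"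
      proof
        fix p assume "p \<in> f ` {c<..<d} \<inter> f ` (K \<inter> {c..d})"
        then obtain x where x: "p = f x" "x \<in> K" "x \<in> {c..d}" "p \<notin> M" using ends(3) by blast
        then have "x \<in> {c<..<d}" using ends(1,2) by (metis atLeastAtMost_iff greaterThanLessThan_iff less_le)
        then show "p \<in> f ` U" using x K by blast
      qed
    qed
    ultimately show "closedin (top_of_set (f ` {c<..<d})) (f ` U)"
      by (metis closedin_closed_Int compact_imp_closed)
  qed auto
  then obtain \<theta> where "homeomorphism {c<..<d} (f ` {c<..<d}) f \<theta>" by blast
  then show ?thesis
    by (intro that[of \<theta>] homeomorphism_cont2 homeomorphism_apply1)
qed

text \<open>The crossings are listed along the line and not around the circle: the sequence runs
  round for ever, which spares indices modulo their number, and repetitions do not affect a count of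
  classes.\<close>

lemma exists_crossing_sequence:
  assumes "c \<in> C"
  obtains x where "x 0 = c" "\<And>i. edge f D (x i) (x (Suc i))"
proof -
  have "\<exists>x. x 0 = c \<and> (\<forall>i. x i \<in> C \<and> edge f D (x i) (x (Suc i)))"
  proof -
    \<comment> \<open>The starting value is carried along in the invariant of the choice, where it
      binds only index 0.\<close>
    have "\<exists>x. \<forall>i. (x i \<in> C \<and> (i = 0 \<longrightarrow> x i = c)) \<and> edge f D (x i) (x (Suc i))"
    proof (rule dependent_nat_choice)
      show "\<exists>x. x \<in> C \<and> (0 = (0::nat) \<longrightarrow> x = c)" using assms by auto
    next
      fix x :: real and n :: nat assume x: "x \<in> C \<and> (n = 0 \<longrightarrow> x = c)"
      then obtain d where "d > x" "f d \<in> D" "\<forall>z. x < z \<and> z < d \<longrightarrow> f z \<notin> D"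
        using exists_next_marked[OF finite_double_points, of x x] unfolding crossing_params_def by blast
      then show "\<exists>y. (y \<in> C \<and> (Suc n = 0 \<longrightarrow> y = c)) \<and> edge f D x y"
        using x unfolding edge_def crossing_params_def by blast
    qed
    then show ?thesis by blast
  qed
  then show ?thesis using that by blast
qed

end

section \<open>Edges enumerated by a sequence of crossings\<close>

locale crossing_sequence = closed_curve +
  fixes x :: "nat \<Rightarrow> real"
  assumes edge: "edge f D (x i) (x (Suc i))"
begin

lemma strict_mono: "strict_mono x"
  using edge unfolding strict_mono_Suc_iff edge_def by blast

lemma in_crossing: "x i \<in> C"
  using edge[of i] unfolding edge_def crossing_params_def by blast

text \<open>Crossings cannot accumulate, so the sequence is unbounded and passes every translate to
  the right of \<open>x 0\<close>.\<close>

lemma cover: "\<exists>i n. x i \<le> z + of_int n \<and> z + of_int n < x (Suc i)"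
proof -
  define y where "y = z + of_int \<lceil>x 0 - z\<rceil>"
  have y: "x 0 \<le> y" unfolding y_def by linarith
  have "\<exists>i. x i > y"
  proof (rule ccontr)
    assume "\<not> (\<exists>i. x i > y)"
    then have "range x \<subseteq> f -` D \<inter> {x 0..y}"
      using in_crossing strict_mono_less_eq[OF strict_mono, of 0]
      unfolding crossing_params_def by (auto simp: not_less)
    then have "finite (range x)"
      using finite_marked[OF finite_double_points] finite_subset by blast
    then show False
      using strict_mono_imp_inj_on[OF strict_mono] finite_imageD by blast
  qed
  then obtain j where j: "x j > y" "\<And>i. i < j \<Longrightarrow> \<not> x i > y"
    using exists_least_iff[of "\<lambda>i. x i > y"] by blast
  then obtain i where "j = Suc i" using y by (cases j) auto
  then have "x i \<le> y" "y < x (Suc i)" using j(1) j(2)[of i] by auto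
  then show ?thesis unfolding y_def by blast
qed

definition on_edge :: "nat \<Rightarrow> real \<Rightarrow> bool" where
  "on_edge i z \<longleftrightarrow> (\<exists>n. x i \<le> z + of_int n \<and> z + of_int n < x (Suc i))"

text \<open>A crossing on a half-open edge is its tail. Any other point has one parameter modulo 1,
  so the two edges are translates of each other.\<close>

lemma on_edge_tail: "on_edge i z \<Longrightarrow> on_edge j w \<Longrightarrow> f z = f w \<Longrightarrow> f (x i) = f (x j)"
proof -
  assume "on_edge i z" "on_edge j w" and eq: "f z = f w"
  then obtain n m where n: "x i \<le> z + of_int n" "z + of_int n < x (Suc i)"
    and m: "x j \<le> w + of_int m" "w + of_int m < x (Suc j)"
    unfolding on_edge_def by blast
  show ?thesis
  proof (cases "z \<in> C")
    case True
    then have "f (z + of_int n) \<in> D" "f (w + of_int m) \<in> D"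
      using eq periodic_of_int unfolding crossing_params_def by auto
    then have "z + of_int n = x i" "w + of_int m = x j"
      using edge_prev[OF edge] n m by fastforce+
    then show ?thesis using eq periodic_of_int by metis
  next
    case False
    then obtain k where k: "z - w = of_int k"
      using Ints_of_eq[OF eq] Ints_cases by blast
    have "x i = x j + of_int (k + n - m)"
      using n m k by (intro edge_overlap(1)[OF edge[of i] edge_shift[OF edge[of j]], of "z + of_int n"]) auto
    then show ?thesis using periodic_of_int by metis
  qed
qed

text \<open>An arc without crossings that starts on an edge cannot pass the head of this edge. If
  the common end of two such arcs is a crossing, it is the head of both edges; otherwise it is an
  inner point of both.\<close>

lemma on_edge_linked:
  assumes "on_edge i z" "on_edge j w" "linked f z w"
  shows "f (x i) = f (x j) \<or> f (x (Suc i)) = f (x (Suc j))"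
  using assms(3) unfolding linked_def
proof (elim disjE exE conjE)
  assume "f z = f w"
  then show ?thesis using on_edge_tail assms by blast
next
  fix c d
  assume cd: "c > z" "d > w" "{z<..<c} \<inter> C = {}" "{w<..<d} \<inter> C = {}" "f c = f d"
  have head: "\<exists>n. x i < c + of_int n \<and> c + of_int n \<le> x (Suc i)"
    if c: "on_edge i z" "c > z" "{z<..<c} \<inter> C = {}" for i z c
  proof -
    obtain n where n: "x i \<le> z + of_int n" "z + of_int n < x (Suc i)"
      using c(1) unfolding on_edge_def by blast
    have "x (Suc i) + of_int (- n) \<in> C"
      using crossing_add_of_int in_crossing by blast
    then have "x (Suc i) - of_int n \<notin> {z<..<c}"
      using c(3) by auto
    then have "c + of_int n \<le> x (Suc i)"
      using n by auto
    then show ?thesis using n c(2) by (intro exI[of _ n]) auto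
  qed
  obtain n m where n: "x i < c + of_int n" "c + of_int n \<le> x (Suc i)"
    and m: "x j < d + of_int m" "d + of_int m \<le> x (Suc j)"
    using head[OF assms(1) cd(1,3)] head[OF assms(2) cd(2,4)] by blast
  show ?thesis
  proof (cases "c \<in> C")
    case True
    then have "f (c + of_int n) \<in> D" "f (d + of_int m) \<in> D"
      using cd(5) periodic_of_int unfolding crossing_params_def by auto
    then have "c + of_int n = x (Suc i)" "d + of_int m = x (Suc j)"
      using edge_next[OF edge] n m by fastforce+
    then show ?thesis using cd(5) periodic_of_int by metis
  next
    case False
    then have "d \<notin> C" using cd(5) by (simp add: crossing_params_def)
    have "c + of_int n \<noteq> x (Suc i)" "d + of_int m \<noteq> x (Suc j)"
      using False \<open>d \<notin> C\<close> in_crossing crossing_add_of_int by metis+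
    then have "on_edge i c" "on_edge j d"
      unfolding on_edge_def using n m by (force intro: exI[of _ n] exI[of _ m])+
    then show ?thesis using on_edge_tail cd(5) by blast
  qed
qed

text \<open>On the right the curve occurs only through the points \<open>f (x i)\<close>: in this
  form the number visibly depends on the word alone.\<close>

lemma circuits_eq:
  "circuits f = card (classes (\<lambda>i j. f (x i) = f (x j) \<or> f (x (Suc i)) = f (x (Suc j))))"
    (is "_ = card (classes ?W)")
proof -
  have "\<exists>i. on_edge i z" for z
    using cover unfolding on_edge_def by blast
  then obtain \<kappa> where \<kappa>: "\<And>z. on_edge (\<kappa> z) z" by metis
  have W: "?W i j \<Longrightarrow> linked f (x i) (x j)" for i j
  proof (elim disjE)
    assume "f (x i) = f (x j)"
    then show ?thesis unfolding linked_def by simp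
  next
    assume "f (x (Suc i)) = f (x (Suc j))"
    moreover have "x k < x (Suc k) \<and> {x k<..<x (Suc k)} \<inter> C = {}" for k
      using edge[of k] unfolding edge_def crossing_params_def by auto
    ultimately show ?thesis unfolding linked_def by blast
  qed
  show ?thesis
    unfolding circuits_def
  proof (rule card_classes_eq[where \<kappa> = \<kappa> and \<kappa>' = x])
    show "equivclp ?W (\<kappa> z) (\<kappa> w)" if "linked f z w" for z w
      using on_edge_linked[OF \<kappa> \<kappa> that] by (rule r_into_equivclp)
    show "equivclp (linked f) (x i) (x j)" if "?W i j" for i j
      using W[OF that] by (rule r_into_equivclp)
    show "equivclp (linked f) (x (\<kappa> z)) z" for z
    proof -
      obtain n where n: "x (\<kappa> z) \<le> z + of_int n" "z + of_int n < x (Suc (\<kappa> z))"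
        using \<kappa>[of z] unfolding on_edge_def by blast
      then have "{x (\<kappa> z)<..z + of_int n} \<inter> C = {}"
        using edge[of "\<kappa> z"] unfolding edge_def crossing_params_def by auto
      then have "linked f (x (\<kappa> z)) (z + of_int n)"
        using n(1) by (intro linked_arc)
      moreover have "linked f (z + of_int n) z"
        unfolding linked_def by (simp add: periodic_of_int)
      ultimately show ?thesis by (meson equivclp_trans r_into_equivclp)
    qed
    show "equivclp ?W (\<kappa> (x i)) i" for i
    proof -
      have "on_edge i (x i)"
        unfolding on_edge_def using edge[of i] by (intro exI[of _ 0]) (simp add: edge_def)
      then have "f (x (\<kappa> (x i))) = f (x i)"
        using on_edge_tail \<kappa> by blast
      then show ?thesis by (intro r_into_equivclp) simp
    qed
  qed
qed

end

lemma (in closed_curve) circuits_no_crossings: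
  assumes "D = {}"
  shows "circuits f = 1"
proof -
  have "linked f x y" for x y
    using linked_arc[of x y] linked_arc[of y x] linked_sym assms
    by (cases "x \<le> y") (auto simp: crossing_params_def)
  then have "classes (linked f) = {UNIV}"
    unfolding classes_def by auto
  then show ?thesis unfolding circuits_def by simp
qed

section \<open>The circles of a resolution\<close>

text \<open>Such a \<beta> is in effect increasing with limit \<open>c\<close> at 0. The proof does
  without monotonicity: a value above \<open>\<beta> 1\<close> would force a second preimage of
  \<open>\<beta> 1\<close>, because smaller values occur close to \<open>c\<close>.\<close>

lemma initial_arc:
  fixes \<beta> :: "real \<Rightarrow> real"
  assumes cont: "continuous_on {0<..1} \<beta>" and inj: "inj_on \<beta> {0<..1}"
    and sub: "\<beta> ` {0<..1} \<subseteq> {c<..}" and near: "\<forall>\<^sub>F z in at_right c. z \<in> \<beta> ` {0<..1}"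
  shows "\<beta> ` {0<..1} = {c<..\<beta> 1}"
proof -
  obtain b where b: "b > c" "\<And>z. c < z \<Longrightarrow> z < b \<Longrightarrow> z \<in> \<beta> ` {0<..1}"
    using near unfolding eventually_at_right_field by blast
  have conn: "connected (\<beta> ` {0<..1})"
    using cont by (intro connected_continuous_image) auto
  have "c < \<beta> 1" using subsetD[OF sub, of "\<beta> 1"] by simp
  \<comment> \<open>A point below \<open>\<beta> 1\<close> and so close to \<open>c\<close> that it
    is known to be attained.\<close>
  define z where "z = (c + min b (\<beta> 1)) / 2"
  have z: "c < z" "z < b" "z < \<beta> 1" unfolding z_def using b(1) \<open>c < \<beta> 1\<close> by auto
  obtain q where q: "q \<in> {0<..1}" "\<beta> q = z" using b(2)[OF z(1,2)] by blast
  have upper: "\<beta> r \<le> \<beta> 1" if r: "r \<in> {0<..1}" for r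
  proof (rule ccontr)
    assume "\<not> \<beta> r \<le> \<beta> 1"
    then have "\<beta> 1 \<in> {\<beta> q..\<beta> r}" using q z by auto
    moreover have "connected (\<beta> ` {0<..<1})"
      by (rule connected_continuous_image[OF continuous_on_subset[OF cont]]) auto
    moreover have "q \<noteq> 1" "r \<noteq> 1" using q z \<open>\<not> \<beta> r \<le> \<beta> 1\<close> by auto
    then have "q \<in> {0<..<1}" "r \<in> {0<..<1}" using q(1) r by auto
    ultimately have "\<beta> 1 \<in> \<beta> ` {0<..<1}"
      by (meson connected_contains_Icc image_eqI subsetD)
    then obtain s where "s \<in> {0<..<1}" "\<beta> s = \<beta> 1" by auto
    then show False using inj_onD[OF inj, of s 1] by auto
  qed
  have "w \<in> \<beta> ` {0<..1}" if w: "c < w" "w \<le> \<beta> 1" for w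
  proof (cases "w < b")
    case False
    then have "w \<in> {\<beta> q..\<beta> 1}" using q z w by auto
    then show ?thesis
      using connected_contains_Icc[OF conn, of "\<beta> q" "\<beta> 1"] q(1) by auto
  qed (use b w in blast)
  then show ?thesis using upper sub by fastforce
qed

context closed_curve
begin

text \<open>An arc that avoids the marked points and meets an open edge stays in it, so
  \<open>edge_inverse\<close> pulls it back to the parameter line.\<close>

lemma arc_in_edge:
  fixes \<alpha> :: "real \<Rightarrow> real^3"
  assumes e: "edge f M c d" and DM: "D \<subseteq> M" and cont: "continuous_on {0<..1} \<alpha>"
    and inj: "inj_on \<alpha> {0<..1}" and sub: "\<alpha> ` {0<..1} \<subseteq> range f - M"
    and meets: "x \<in> {c<..<d}" "f x \<in> \<alpha> ` {0<..1}"
  obtains \<beta> where "continuous_on {0<..1} \<beta>" "inj_on \<beta> {0<..1}" "\<beta> ` {0<..1} \<subseteq> {c<..<d}"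
    "\<And>r. r \<in> {0<..1} \<Longrightarrow> f (\<beta> r) = \<alpha> r"
    "\<And>x. x \<in> {c<..<d} \<Longrightarrow> f x \<in> \<alpha> ` {0<..1} \<Longrightarrow> x \<in> \<beta> ` {0<..1}"
proof -
  have in_edge: "\<alpha> ` {0<..1} \<subseteq> f ` {c<..<d}"
  proof (rule connected_in_edge[OF e DM _ sub])
    show "connected (\<alpha> ` {0<..1})" using cont by (intro connected_continuous_image) auto
    show "\<alpha> ` {0<..1} \<inter> f ` {c<..<d} \<noteq> {}" using meets by blast
  qed
  obtain \<theta> where \<theta>: "continuous_on (f ` {c<..<d}) \<theta>" "\<And>x. x \<in> {c<..<d} \<Longrightarrow> \<theta> (f x) = x"
    using edge_inverse[OF e DM] by metis
  have f\<theta>: "\<theta> p \<in> {c<..<d} \<and> f (\<theta> p) = p" if "p \<in> f ` {c<..<d}" for p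
    using that \<theta>(2) by auto
  show ?thesis
  proof (rule that[of "\<lambda>r. \<theta> (\<alpha> r)"])
    show "continuous_on {0<..1} (\<lambda>r. \<theta> (\<alpha> r))"
      by (rule continuous_on_compose2[OF \<theta>(1) cont in_edge])
    show "inj_on (\<lambda>r. \<theta> (\<alpha> r)) {0<..1}"
      by (rule inj_onI) (metis f\<theta> image_subset_iff in_edge inj inj_onD)
    show "(\<lambda>r. \<theta> (\<alpha> r)) ` {0<..1} \<subseteq> {c<..<d}"
      using f\<theta> in_edge by blast
    show "f (\<theta> (\<alpha> r)) = \<alpha> r" if "r \<in> {0<..1}" for r
      using f\<theta> in_edge that by blast
    show "x \<in> (\<lambda>r. \<theta> (\<alpha> r)) ` {0<..1}" if "x \<in> {c<..<d}" "f x \<in> \<alpha> ` {0<..1}" for x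
      using that \<theta>(2)[OF that(1)] by (metis imageE image_eqI)
  qed
qed

text \<open>Meant for the arms of a chart: if the edge runs along the arm near its tail, the whole
  arm is an initial part of the edge and ends at \<open>\<alpha> 1\<close>.\<close>

lemma outgoing_arc:
  fixes \<alpha> :: "real \<Rightarrow> real^3"
  assumes e: "edge f M c d" and DM: "D \<subseteq> M" and cont: "continuous_on {0<..1} \<alpha>"
    and inj: "inj_on \<alpha> {0<..1}" and sub: "\<alpha> ` {0<..1} \<subseteq> range f - M"
    and near: "\<forall>\<^sub>F x in at_right c. f x \<in> \<alpha> ` {0<..1}"
  shows "\<exists>u. c < u \<and> u < d \<and> f ` {c<..u} = \<alpha> ` {0<..1} \<and> f u = \<alpha> 1"
proof -
  have "c < d" using e unfolding edge_def by blast
  then have ev: "\<forall>\<^sub>F x in at_right c. f x \<in> \<alpha> ` {0<..1} \<and> x \<in> {c<..<d}"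
    using near eventually_at_right_real by (intro eventually_conj) auto
  then obtain x where x: "x \<in> {c<..<d}" "f x \<in> \<alpha> ` {0<..1}"
    using eventually_happens[OF ev] by force
  obtain \<beta> where \<beta>: "continuous_on {0<..1} \<beta>" "inj_on \<beta> {0<..1}" "\<beta> ` {0<..1} \<subseteq> {c<..<d}"
    "\<And>r. r \<in> {0<..1} \<Longrightarrow> f (\<beta> r) = \<alpha> r"
    "\<And>x. x \<in> {c<..<d} \<Longrightarrow> f x \<in> \<alpha> ` {0<..1} \<Longrightarrow> x \<in> \<beta> ` {0<..1}"
    using arc_in_edge[OF e DM cont inj sub x] by blast
  have "\<forall>\<^sub>F x in at_right c. x \<in> \<beta> ` {0<..1}"
    using ev by (rule eventually_mono) (use \<beta>(5) in blast)
  then have img: "\<beta> ` {0<..1} = {c<..\<beta> 1}"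
    using \<beta>(1-3) by (intro initial_arc) auto
  have \<beta>1: "\<beta> 1 \<in> {c<..<d}" using \<beta>(3) by (rule subsetD) simp
  have "\<alpha> ` {0<..1} = f ` (\<beta> ` {0<..1})"
    using \<beta>(4) by (simp add: image_image)
  then show ?thesis
    using img \<beta>(4)[of 1] \<beta>1 by (intro exI[of _ "\<beta> 1"]) auto
qed

lemma incoming_arc:
  fixes \<alpha> :: "real \<Rightarrow> real^3"
  assumes e: "edge f M c d" and DM: "D \<subseteq> M" and cont: "continuous_on {0<..1} \<alpha>"
    and inj: "inj_on \<alpha> {0<..1}" and sub: "\<alpha> ` {0<..1} \<subseteq> range f - M"
    and near: "\<forall>\<^sub>F x in at_left d. f x \<in> \<alpha> ` {0<..1}"
  shows "\<exists>v. c < v \<and> v < d \<and> f ` {v..<d} = \<alpha> ` {0<..1} \<and> f v = \<alpha> 1"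
proof -
  have "c < d" using e unfolding edge_def by blast
  then have ev: "\<forall>\<^sub>F x in at_left d. f x \<in> \<alpha> ` {0<..1} \<and> x \<in> {c<..<d}"
    using near eventually_at_left_real by (intro eventually_conj) auto
  then obtain x where x: "x \<in> {c<..<d}" "f x \<in> \<alpha> ` {0<..1}"
    using eventually_happens[OF ev] by force
  obtain \<beta> where \<beta>: "continuous_on {0<..1} \<beta>" "inj_on \<beta> {0<..1}" "\<beta> ` {0<..1} \<subseteq> {c<..<d}"
    "\<And>r. r \<in> {0<..1} \<Longrightarrow> f (\<beta> r) = \<alpha> r"
    "\<And>x. x \<in> {c<..<d} \<Longrightarrow> f x \<in> \<alpha> ` {0<..1} \<Longrightarrow> x \<in> \<beta> ` {0<..1}"
    using arc_in_edge[OF e DM cont inj sub x] by blast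
  have "\<forall>\<^sub>F x in at_left d. x \<in> \<beta> ` {0<..1}"
    using ev by (rule eventually_mono) (use \<beta>(5) in blast)
  \<comment> \<open>Reflecting the line turns the end of the edge into a beginning, where
    \<open>initial_arc\<close> applies.\<close>
  then have "\<forall>\<^sub>F x in at_right (- d). x \<in> (\<lambda>r. - \<beta> r) ` {0<..1}"
    unfolding at_left_minus[of d] eventually_filtermap
    by (rule eventually_mono) (auto simp: image_iff Bex_def eq_commute[of "- _"] minus_equation_iff)
  then have "(\<lambda>r. - \<beta> r) ` {0<..1} = {- d<..- \<beta> 1}"
    using \<beta>(1-3) by (intro initial_arc continuous_intros) (auto simp: inj_on_def)
  then have "uminus ` ((\<lambda>r. - \<beta> r) ` {0<..1}) = uminus ` {- d<..- \<beta> 1}" by simp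
  then have img: "\<beta> ` {0<..1} = {\<beta> 1..<d}"
    by (simp add: image_image)
  have \<beta>1: "\<beta> 1 \<in> {c<..<d}" using \<beta>(3) by (rule subsetD) simp
  have "\<alpha> ` {0<..1} = f ` (\<beta> ` {0<..1})"
    using \<beta>(4) by (simp add: image_image)
  then show ?thesis
    using img \<beta>(4)[of 1] \<beta>1 by (intro exI[of _ "\<beta> 1"]) auto
qed

end

section \<open>The coordinate cross and the strands through a chart\<close>

definition cross :: "complex set" where
  "cross = closed_segment (-1) 1 \<union> closed_segment (-\<i>) \<i>"

lemma cross_iff: "z \<in> cross \<longleftrightarrow> z \<in> cball 0 1 \<and> (Re z = 0 \<or> Im z = 0)"
proof
  assume "z \<in> cross"
  then have "z \<in> closed_segment (-1) 1 \<or> z \<in> closed_segment (-\<i>) \<i>"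
    unfolding cross_def by blast
  then obtain r where r: "0 \<le> r" "r \<le> 1" "z = of_real (2 * r - 1) \<or> z = of_real (2 * r - 1) * \<i>"
    by (auto simp: in_segment scaleR_conv_of_real algebra_simps)
  then show "z \<in> cball 0 1 \<and> (Re z = 0 \<or> Im z = 0)"
    by (auto simp: norm_mult simp del: of_real_diff of_real_mult)
next
  assume z: "z \<in> cball 0 1 \<and> (Re z = 0 \<or> Im z = 0)"
  then consider "Re z = 0" "\<bar>Im z\<bar> \<le> 1" | "Im z = 0" "\<bar>Re z\<bar> \<le> 1"
    by (auto simp: cmod_def abs_square_le_1)
  then show "z \<in> cross"
  proof cases
    case 1
    then have "z \<in> closed_segment (-\<i>) \<i>"
      unfolding in_segment by (intro exI[of _ "(1 + Im z) / 2"]) (auto simp: complex_eq_iff field_simps)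
    then show ?thesis unfolding cross_def by blast
  next
    case 2
    then have "z \<in> closed_segment (-1) 1"
      unfolding in_segment by (intro exI[of _ "(1 + Re z) / 2"]) (auto simp: complex_eq_iff field_simps)
    then show ?thesis unfolding cross_def by blast
  qed
qed

lemma cross_arm:
  assumes "z \<in> cross" "z \<noteq> 0"
  obtains r e where "0 < r" "r \<le> 1" "e \<in> {1, \<i>}" "z = r *\<^sub>R e \<or> z = r *\<^sub>R - e"
proof -
  have z: "cmod z \<le> 1" "Re z = 0 \<or> Im z = 0" using assms(1) unfolding cross_iff by auto
  define e where "e = (if Im z = 0 then 1 else \<i>)"
  define r where "r = \<bar>Re z + Im z\<bar>"
  have "0 < r" unfolding r_def using assms(2) z(2) by (auto simp: complex_eq_iff)
  moreover have "r \<le> 1" unfolding r_def using z by (auto simp: cmod_def abs_square_le_1)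
  moreover have "e \<in> {1, \<i>}" unfolding e_def by auto
  moreover have "z = r *\<^sub>R e \<or> z = r *\<^sub>R - e"
    unfolding r_def e_def using z(2) by (auto simp: complex_eq_iff abs_if)
  ultimately show ?thesis using that by blast
qed

lemma arm_in_cross: "e \<in> {1, \<i>, -1, -\<i>} \<Longrightarrow> 0 \<le> r \<Longrightarrow> r \<le> 1 \<Longrightarrow> r *\<^sub>R e \<in> cross"
  unfolding cross_iff by (auto simp: norm_mult)

lemma arm_cball: "e \<in> {1, \<i>, -1, -\<i>} \<Longrightarrow> 0 \<le> r \<Longrightarrow> r \<le> 1 \<Longrightarrow> r *\<^sub>R e \<in> cball 0 1"
  using arm_in_cross cross_iff by blast

lemma arm_inj:
  "e \<in> {1, \<i>, -1, -\<i>} \<Longrightarrow> e' \<in> {1, \<i>, -1, -\<i>} \<Longrightarrow> 0 < r \<Longrightarrow> 0 < r' \<Longrightarrow>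
     r *\<^sub>R e = r' *\<^sub>R e' \<Longrightarrow> e = e' \<and> r = r'"
  by (auto simp: complex_eq_iff)

lemma open_segment_arm:
  fixes e :: complex
  assumes "e \<noteq> 0"
  shows "open_segment 0 e = (\<lambda>r. r *\<^sub>R e) ` {0<..<1}"
    and "open_segment (- e) 0 = (\<lambda>r. r *\<^sub>R - e) ` {0<..<1}"
proof -
  have *: "open_segment 0 e = (\<lambda>r. r *\<^sub>R e) ` {0<..<1}" if "e \<noteq> 0" for e :: complex
    using that by (auto simp: open_segment_image_interval)
  show "open_segment 0 e = (\<lambda>r. r *\<^sub>R e) ` {0<..<1}" using *[OF assms] .
  show "open_segment (- e) 0 = (\<lambda>r. r *\<^sub>R - e) ` {0<..<1}"
    using *[of "- e"] assms by (simp add: open_segment_commute)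
qed

text \<open>\<open>e\<close> is 1 or \<open>\<i>\<close> according to the axis that the strand at
  \<open>c\<close> follows, from \<open>- e\<close> to \<open>e\<close>. One formula for both axes
  avoids doubling the arguments about arms.\<close>

definition branch :: "(real \<Rightarrow> real^3) \<Rightarrow> (complex \<Rightarrow> real^3) \<Rightarrow> real \<Rightarrow> complex \<Rightarrow> bool" where
  "branch f \<phi> c e \<longleftrightarrow> (\<forall>\<^sub>F x in at_left c. f x \<in> \<phi> ` (\<lambda>r. r *\<^sub>R - e) ` {0<..<1}) \<and>
     (\<forall>\<^sub>F x in at_right c. f x \<in> \<phi> ` (\<lambda>r. r *\<^sub>R e) ` {0<..<1})"

lemma crossing_chart_iff:
  "crossing_chart f p \<phi> \<longleftrightarrow>
     continuous_on (cball 0 1) \<phi> \<and> inj_on \<phi> (cball 0 1) \<and> \<phi> ` cball 0 1 \<subseteq> S2 \<and> \<phi> 0 = p \<and>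
     range f \<inter> \<phi> ` cball 0 1 = \<phi> ` cross \<and>
     (\<exists>s t. f s = p \<and> f t = p \<and> branch f \<phi> s 1 \<and> branch f \<phi> t \<i>)"
  unfolding crossing_chart_def branch_def cross_def
  using open_segment_arm[of 1] open_segment_arm[of \<i>] by simp

lemma branch_unique:
  assumes "inj_on \<phi> (cball 0 1)" "e \<in> {1, \<i>}" "e' \<in> {1, \<i>}" "branch f \<phi> c e" "branch f \<phi> c e'"
  shows "e = e'"
proof -
  have "\<forall>\<^sub>F x in at_right c. f x \<in> \<phi> ` (\<lambda>r. r *\<^sub>R e) ` {0<..<1} \<and> f x \<in> \<phi> ` (\<lambda>r. r *\<^sub>R e') ` {0<..<1}"
    using assms(4,5) unfolding branch_def by (auto intro: eventually_conj)
  from eventually_happens[OF this] obtain r r' where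
    r: "r \<in> {0<..<1}" "r' \<in> {0<..<1}" "\<phi> (r *\<^sub>R e) = \<phi> (r' *\<^sub>R e')"
    by auto
  then have "r *\<^sub>R e = r' *\<^sub>R e'"
    using inj_onD[OF assms(1) r(3)] arm_cball[of e r] arm_cball[of e' r'] assms(2,3) by auto
  then show ?thesis
    using arm_inj[of e e' r r'] assms(2,3) r by auto
qed

context closed_curve
begin

lemma branch_shift: "branch f \<phi> (c + of_int n) e \<longleftrightarrow> branch f \<phi> c e"
proof -
  have *: "branch f \<phi> (c + of_int n) e" if "branch f \<phi> c e" for c n
  proof -
    have "f (z - of_int n) = f z" for z
      using periodic_of_int[of "z - of_int n" n] by simp
    then show ?thesis
      using that eventually_at_left_shift[of _ c "of_int n"] eventually_at_right_shift[of _ c "of_int n"]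
      unfolding branch_def by fastforce
  qed
  then show ?thesis
    using *[of "c + of_int n" "- n"] by auto
qed

text \<open>If \<open>s\<close> and \<open>t\<close> were equal modulo 1, one strand would follow
  both axes. So they represent two different classes, and \<open>no_triple\<close> leaves no third
  one over \<open>p\<close>.\<close>

lemma chart_strands:
  assumes ch: "crossing_chart f p \<phi>"
  obtains s t where "f s = p" "f t = p" "branch f \<phi> s 1" "branch f \<phi> t \<i>" "s - t \<notin> \<int>"
    "\<And>c. f c = p \<Longrightarrow> c - s \<in> \<int> \<and> branch f \<phi> c 1 \<or> c - t \<in> \<int> \<and> branch f \<phi> c \<i>"
proof -
  obtain s t where st: "f s = p" "f t = p" "branch f \<phi> s 1" "branch f \<phi> t \<i>"
    and inj: "inj_on \<phi> (cball 0 1)"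
    using ch unfolding crossing_chart_iff by blast
  have nst: "s - t \<notin> \<int>"
  proof
    assume "s - t \<in> \<int>"
    then obtain n where "s - t = of_int n" by (elim Ints_cases)
    then have "s = t + of_int n" by simp
    then have "branch f \<phi> s \<i>" using st(4) branch_shift by simp
    then show False
      using branch_unique[OF inj _ _ st(3), of \<i>] by (auto simp: complex_eq_iff)
  qed
  have "c - s \<in> \<int> \<and> branch f \<phi> c 1 \<or> c - t \<in> \<int> \<and> branch f \<phi> c \<i>" if "f c = p" for c
  proof -
    have "c - s \<in> \<int> \<or> c - t \<in> \<int>"
      using no_triple[of c s t] st that nst by auto
    then show ?thesis
      using st(3,4) branch_shift by (metis Ints_cases add.commute diff_add_cancel)
  qed
  with st nst show ?thesis using that by blast
qed

lemma chart_branch: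
  assumes ch: "crossing_chart f p \<phi>"
  shows "p \<in> D" and "f c = p \<Longrightarrow> \<exists>e\<in>{1, \<i>}. branch f \<phi> c e"
    and "e \<in> {1, \<i>} \<Longrightarrow> \<exists>c. f c = p \<and> branch f \<phi> c e"
proof -
  obtain s t where st: "f s = p" "f t = p" "branch f \<phi> s 1" "branch f \<phi> t \<i>" "s - t \<notin> \<int>"
    "\<And>c. f c = p \<Longrightarrow> c - s \<in> \<int> \<and> branch f \<phi> c 1 \<or> c - t \<in> \<int> \<and> branch f \<phi> c \<i>"
    using chart_strands[OF ch] by metis
  show "p \<in> D" unfolding double_points_def using st by blast
  show "\<exists>e\<in>{1, \<i>}. branch f \<phi> c e" if "f c = p" using st(6)[OF that] by auto
  show "\<exists>c. f c = p \<and> branch f \<phi> c e" if "e \<in> {1, \<i>}" using st(1-4) that by auto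
qed

end

lemma circuits_of_components_no_crossings:
  assumes "closed_curve f" "double_points f = {}" "non_Seifert_resolution f T"
  shows "card (components T) = circuits f"
proof -
  interpret closed_curve f by fact
  have "T = range f"
    using assms(2,3) unfolding non_Seifert_resolution_def by auto
  moreover have "connected (range f)" "range f \<noteq> {}"
    using continuous by (auto intro: connected_continuous_image)
  ultimately have "components T = {range f}"
    by (simp add: components_eq_sing_iff)
  then show ?thesis using circuits_no_crossings assms(2) by simp
qed

section \<open>The pieces that make up the circles of a resolution\<close>

locale resolved_curve = crossing_sequence +
  fixes \<phi> :: "real^3 \<Rightarrow> complex \<Rightarrow> real^3"
  assumes chart: "p \<in> D \<Longrightarrow> crossing_chart f p (\<phi> p)"
    and disjoint: "disjoint_family_on (\<lambda>p. \<phi> p ` cball 0 1) D"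
begin

abbreviation "B \<equiv> \<Union>p\<in>D. \<phi> p ` cball 0 1"
abbreviation "Out p \<equiv> \<phi> p ` closed_segment 1 \<i>"
abbreviation "In p \<equiv> \<phi> p ` closed_segment (-1) (-\<i>)"

text \<open>An edge with its ends inside the charts replaced by the whole chord at its tail and the
  whole chord at its head. Each chord is thereby shared by the edges joined there, and joining
  becomes intersection of sets.\<close>

definition piece :: "nat \<Rightarrow> (real^3) set" where
  "piece i = Out (f (x i)) \<union> (f ` {x i<..<x (Suc i)} - B) \<union> In (f (x (Suc i)))"

lemma chart_facts:
  assumes "p \<in> D"
  shows "continuous_on (cball 0 1) (\<phi> p)" "inj_on (\<phi> p) (cball 0 1)" "\<phi> p 0 = p"
    "range f \<inter> \<phi> p ` cball 0 1 = \<phi> p ` cross"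
  using chart[OF assms] unfolding crossing_chart_iff by auto

lemma same_chart:
  assumes "p \<in> D" "q \<in> D" "z \<in> cball 0 1" "w \<in> cball 0 1" "\<phi> p z = \<phi> q w"
  shows "p = q \<and> z = w"
proof -
  have "p = q"
    using disjoint assms unfolding disjoint_family_on_def by (metis IntI empty_iff image_eqI)
  then show ?thesis
    using inj_onD[OF chart_facts(2)[OF assms(1)]] assms by auto
qed

lemma crossing_D: "f (x i) \<in> D"
  using in_crossing unfolding crossing_params_def by simp

lemma segments_cball: "closed_segment 1 \<i> \<subseteq> cball 0 1" "closed_segment (-1) (-\<i>) \<subseteq> cball 0 1"
  by (rule closed_segment_subset; simp)+

lemma segments_disjoint: "closed_segment 1 \<i> \<inter> closed_segment (-1) (-\<i>) = {}"
proof -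
  \<comment> \<open>The two chords lie on parallel lines.\<close>
  have "Re z + Im z = 1" if "z \<in> closed_segment 1 \<i>" for z
    using that by (auto simp: in_segment)
  moreover have "Re z + Im z = -1" if "z \<in> closed_segment (-1) (-\<i>)" for z
    using that by (auto simp: in_segment)
  ultimately show ?thesis by fastforce
qed

lemma in_B: "p \<in> D \<Longrightarrow> Out p \<subseteq> B" "p \<in> D \<Longrightarrow> In p \<subseteq> B"
  using segments_cball by blast+

lemma arm_properties:
  assumes p: "p \<in> D" and e: "e \<in> {1, \<i>, -1, -\<i>}"
  shows "continuous_on {0<..1} (\<lambda>r. \<phi> p (r *\<^sub>R e))" "inj_on (\<lambda>r. \<phi> p (r *\<^sub>R e)) {0<..1}"
    "(\<lambda>r. \<phi> p (r *\<^sub>R e)) ` {0<..1} \<subseteq> range f - D"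
proof -
  show "continuous_on {0<..1} (\<lambda>r. \<phi> p (r *\<^sub>R e))"
  proof (rule continuous_on_compose2[OF chart_facts(1)[OF p]])
    show "continuous_on {0<..1} (\<lambda>r. r *\<^sub>R e)" by (intro continuous_intros)
    show "(\<lambda>r. r *\<^sub>R e) ` {0<..1} \<subseteq> cball 0 1"
      using arm_cball[OF e] by (auto simp del: mem_cball)
  qed
  show "inj_on (\<lambda>r. \<phi> p (r *\<^sub>R e)) {0<..1}"
  proof (rule inj_onI)
    fix r r' :: real assume r: "r \<in> {0<..1}" "r' \<in> {0<..1}" "\<phi> p (r *\<^sub>R e) = \<phi> p (r' *\<^sub>R e)"
    then have "r *\<^sub>R e = r' *\<^sub>R e"
      using same_chart[OF p p _ _ r(3)] arm_cball[OF e] by simp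
    then show "r = r'" using arm_inj[OF e e] r by auto
  qed
  show "(\<lambda>r. \<phi> p (r *\<^sub>R e)) ` {0<..1} \<subseteq> range f - D"
  proof
    fix y assume "y \<in> (\<lambda>r. \<phi> p (r *\<^sub>R e)) ` {0<..1}"
    then obtain r where r: "r \<in> {0<..1}" "y = \<phi> p (r *\<^sub>R e)" by blast
    then have "y \<in> range f"
      using chart_facts(4)[OF p] arm_in_cross[OF e, of r] by auto
    moreover have "y \<notin> D"
    proof
      assume y: "y \<in> D"
      have eq: "\<phi> p (r *\<^sub>R e) = \<phi> y 0" using chart_facts(3)[OF y] r by simp
      then have "r *\<^sub>R e = 0"
        using same_chart[OF p y _ _ eq] arm_cball[OF e, of r] r(1) by simp
      then show False using r e by auto
    qed
    ultimately show "y \<in> range f - D" by blast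
  qed
qed

lemma out_arm:
  assumes "edge f D c d" "f c = p" "branch f (\<phi> p) c e" "e \<in> {1, \<i>}"
  shows "\<exists>u. c < u \<and> u < d \<and> f ` {c<..u} = (\<lambda>r. \<phi> p (r *\<^sub>R e)) ` {0<..1} \<and> f u = \<phi> p e"
proof -
  have p: "p \<in> D" using assms(1,2) unfolding edge_def by blast
  have e: "e \<in> {1, \<i>, -1, -\<i>}" using assms(4) by blast
  have "\<forall>\<^sub>F z in at_right c. f z \<in> (\<lambda>r. \<phi> p (r *\<^sub>R e)) ` {0<..1}"
    using assms(3) unfolding branch_def by (auto elim!: eventually_mono)
  from outgoing_arc[OF assms(1) order_refl arm_properties[OF p e] this] show ?thesis by simp
qed

lemma in_arm:
  assumes "edge f D c d" "f d = p" "branch f (\<phi> p) d e" "e \<in> {1, \<i>}"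
  shows "\<exists>v. c < v \<and> v < d \<and> f ` {v..<d} = (\<lambda>r. \<phi> p (r *\<^sub>R - e)) ` {0<..1} \<and> f v = \<phi> p (- e)"
proof -
  have p: "p \<in> D" using assms(1,2) unfolding edge_def by blast
  have e: "- e \<in> {1, \<i>, -1, -\<i>}" using assms(4) by auto
  have "\<forall>\<^sub>F z in at_left d. f z \<in> (\<lambda>r. \<phi> p (r *\<^sub>R - e)) ` {0<..1}"
    using assms(3) unfolding branch_def by (auto elim!: eventually_mono)
  from incoming_arc[OF assms(1) order_refl arm_properties[OF p e] this] show ?thesis by simp
qed

lemma translate_of_edge:
  assumes "edge f D c d" "w \<in> {c<..<d}" "z \<in> {x i<..<x (Suc i)}" "f z = f w"
  obtains n where "x i = c + of_int n" "x (Suc i) = d + of_int n" "z = w + of_int n"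
proof -
  have "z \<notin> C" using assms(3) edge[of i] unfolding edge_def crossing_params_def by auto
  then obtain n where n: "z - w = of_int n"
    using Ints_of_eq[OF assms(4)] by (auto elim: Ints_cases)
  have "x i = c + of_int n" "x (Suc i) = d + of_int n"
    using edge_overlap[OF edge[of i] edge_shift[OF assms(1), of n], of z] assms(2,3) n by auto
  moreover have "z = w + of_int n" using n by (simp add: algebra_simps)
  ultimately show ?thesis by (rule that)
qed

text \<open>The part of an edge outside the charts is a single arc: every arm of every chart is
  traversed at one of the two ends of an edge.\<close>

lemma middle_arc:
  obtains u v where "x i < u" "u < v" "v < x (Suc i)" "f u \<in> Out (f (x i))" "f v \<in> In (f (x (Suc i)))"
    "f ` {x i<..<x (Suc i)} - B = f ` {u<..<v}"
proof -
  let ?p = "f (x i)" and ?q = "f (x (Suc i))"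
  obtain e where e: "e \<in> {1, \<i>}" "branch f (\<phi> ?p) (x i) e"
    using chart_branch(2)[OF chart[OF crossing_D]] by blast
  obtain e' where e': "e' \<in> {1, \<i>}" "branch f (\<phi> ?q) (x (Suc i)) e'"
    using chart_branch(2)[OF chart[OF crossing_D]] by blast
  obtain u where u: "x i < u" "u < x (Suc i)"
    "f ` {x i<..u} = (\<lambda>r. \<phi> ?p (r *\<^sub>R e)) ` {0<..1}" "f u = \<phi> ?p e"
    using out_arm[OF edge refl e(2,1)] by blast
  obtain v where v: "x i < v" "v < x (Suc i)"
    "f ` {v..<x (Suc i)} = (\<lambda>r. \<phi> ?q (r *\<^sub>R - e')) ` {0<..1}" "f v = \<phi> ?q (- e')"
    using in_arm[OF edge refl e'(2,1)] by blast
  \<comment> \<open>The arms at the two ends cannot overlap: different charts are disjoint, and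
    within one chart an outgoing arm differs from every incoming one.\<close>
  have "u < v"
  proof (rule ccontr)
    assume "\<not> u < v"
    then have "f u \<in> f ` {v..<x (Suc i)}" using u(2) by (intro imageI) simp
    then obtain r where r: "r \<in> {0<..1}" "\<phi> ?p e = \<phi> ?q (r *\<^sub>R - e')"
      using u(4) v(3) by auto
    have "1 *\<^sub>R e = r *\<^sub>R - e'"
      using same_chart[OF crossing_D crossing_D _ _ r(2)] arm_cball[of e 1] arm_cball[of "- e'" r] e e' r
      by auto
    then have "e = - e'"
      using arm_inj[of e "- e'" 1 r] e e' r by auto
    then show False using e e' by (auto simp: complex_eq_iff)
  qed
  have inj: "inj_on f {x i<..<x (Suc i)}"
    using edge_inj[OF edge order_refl] .
  have outside: "f z \<notin> B" if z: "u < z" "z < v" for z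
  proof
    assume "f z \<in> B"
    then obtain q where q: "q \<in> D" "f z \<in> \<phi> q ` cball 0 1" by blast
    have zi: "z \<in> {x i<..<x (Suc i)}" using z u v by auto
    then have fz: "f z \<notin> D" using edge[of i] unfolding edge_def by auto
    have "f z \<in> \<phi> q ` cross" using q chart_facts(4)[OF q(1)] by blast
    then obtain y where y: "y \<in> cross" "f z = \<phi> q y" by blast
    have "y \<noteq> 0" using chart_facts(3)[OF q(1)] y q fz by auto
    then obtain r g where g: "0 < r" "r \<le> 1" "g \<in> {1, \<i>}" "y = r *\<^sub>R g \<or> y = r *\<^sub>R - g"
      using cross_arm[OF y(1)] by blast
    obtain c where c: "f c = q" "branch f (\<phi> q) c g"
      using chart_branch(3)[OF chart[OF q(1)] g(3)] by blast
    from g(4) show False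
    proof
      assume yr: "y = r *\<^sub>R g"
      obtain d where d: "edge f D c d"
        using exists_next_marked[OF finite_double_points, of c c] c(1) q(1) unfolding edge_def by auto
      obtain t where t: "c < t" "t < d" "f ` {c<..t} = (\<lambda>r. \<phi> q (r *\<^sub>R g)) ` {0<..1}"
        using out_arm[OF d c g(3)] by blast
      have "f z \<in> f ` {c<..t}" unfolding t(3) using y(2) yr g by auto
      then obtain w where w: "w \<in> {c<..t}" "f z = f w" by blast
      \<comment> \<open>The edge running along this arm shares a point with edge \<open>i\<close>,
        so the two are translates of each other and the arm is the initial part already cut
        off.\<close>
      then obtain n where n: "x i = c + of_int n"
        using translate_of_edge[OF d _ zi w(2)] t by auto
      then have "?p = q" "branch f (\<phi> q) (x i) g"
        using c by (auto simp: periodic_of_int branch_shift)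
      then have "g = e"
        using branch_unique[OF chart_facts(2)[OF q(1)] g(3) e(1)] e(2) by simp
      then have "f z \<in> f ` {x i<..u}"
        unfolding u(3) using y(2) yr g \<open>?p = q\<close> by auto
      then obtain z' where z': "z' \<in> {x i<..u}" "f z = f z'" by blast
      then have "z = z'" using inj_onD[OF inj z'(2) zi] u by auto
      then show False using z' z by auto
    next
      assume yr: "y = r *\<^sub>R - g"
      obtain b where d: "edge f D b c"
        using exists_prev_marked[OF finite_double_points, of c c] c(1) q(1) unfolding edge_def by auto
      obtain t where t: "b < t" "t < c" "f ` {t..<c} = (\<lambda>r. \<phi> q (r *\<^sub>R - g)) ` {0<..1}"
        using in_arm[OF d c g(3)] by blast
      have "f z \<in> f ` {t..<c}" unfolding t(3) using y(2) yr g by auto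
      then obtain w where w: "w \<in> {t..<c}" "f z = f w" by blast
      then obtain n where n: "x (Suc i) = c + of_int n"
        using translate_of_edge[OF d _ zi w(2)] t by auto
      then have "?q = q" "branch f (\<phi> q) (x (Suc i)) g"
        using c by (auto simp: periodic_of_int branch_shift)
      then have "g = e'"
        using branch_unique[OF chart_facts(2)[OF q(1)] g(3) e'(1)] e'(2) by simp
      then have "f z \<in> f ` {v..<x (Suc i)}"
        unfolding v(3) using y(2) yr g \<open>?q = q\<close> by auto
      then obtain z' where z': "z' \<in> {v..<x (Suc i)}" "f z = f z'" by blast
      then have "z = z'" using inj_onD[OF inj z'(2) zi] v by auto
      then show False using z' z by auto
    qed
  qed
  have first: "f z \<in> B" if "z \<in> {x i<..u}" for z
  proof -
    have "f z \<in> (\<lambda>r. \<phi> ?p (r *\<^sub>R e)) ` {0<..1}" using that u(3) by blast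
    then obtain r where "r \<in> {0<..1}" "f z = \<phi> ?p (r *\<^sub>R e)" by blast
    then show ?thesis using crossing_D[of i] arm_cball[of e r] e(1) by (intro UN_I[of ?p]) auto
  qed
  have last: "f z \<in> B" if "z \<in> {v..<x (Suc i)}" for z
  proof -
    have "f z \<in> (\<lambda>r. \<phi> ?q (r *\<^sub>R - e')) ` {0<..1}" using that v(3) by blast
    then obtain r where "r \<in> {0<..1}" "f z = \<phi> ?q (r *\<^sub>R - e')" by blast
    then show ?thesis using crossing_D[of "Suc i"] arm_cball[of "- e'" r] e'(1) by (intro UN_I[of ?q]) auto
  qed
  have "f ` {x i<..<x (Suc i)} - B = f ` {u<..<v}"
  proof (intro equalityI subsetI)
    fix y assume "y \<in> f ` {x i<..<x (Suc i)} - B"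
    then obtain z where z: "y = f z" "z \<in> {x i<..<x (Suc i)}" "f z \<notin> B" by blast
    then have "z \<notin> {x i<..u}" "z \<notin> {v..<x (Suc i)}" using first last by blast+
    then have "z \<in> {u<..<v}" using z(2) by auto
    then show "y \<in> f ` {u<..<v}" using z(1) by blast
  next
    fix y assume "y \<in> f ` {u<..<v}"
    then obtain z where z: "y = f z" "u < z" "z < v" by auto
    then have "z \<in> {x i<..<x (Suc i)}" using u v by auto
    then show "y \<in> f ` {x i<..<x (Suc i)} - B"
      unfolding z(1) using outside[OF z(2,3)] by (intro DiffI imageI)
  qed
  moreover have "f u \<in> Out ?p" using u(4) e(1) by auto
  moreover have "f v \<in> In ?q" using v(4) e'(1) by auto
  ultimately show ?thesis using that u v \<open>u < v\<close> by blast
qed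

lemma compact_segments: "p \<in> D \<Longrightarrow> compact (Out p)" "p \<in> D \<Longrightarrow> compact (In p)"
  using chart_facts(1) segments_cball by (auto intro!: compact_continuous_image intro: continuous_on_subset)

lemma connected_segments: "p \<in> D \<Longrightarrow> connected (Out p)" "p \<in> D \<Longrightarrow> connected (In p)"
  using chart_facts(1) segments_cball by (auto intro!: connected_continuous_image intro: continuous_on_subset)

lemma piece_connected_closed: "connected (piece i) \<and> closed (piece i)"
proof -
  obtain u v where uv: "x i < u" "u < v" "v < x (Suc i)" "f u \<in> Out (f (x i))" "f v \<in> In (f (x (Suc i)))"
    "f ` {x i<..<x (Suc i)} - B = f ` {u<..<v}"
    by (rule middle_arc)
  have "{u..v} = {u<..<v} \<union> {u, v}" using uv(2) by auto
  then have img: "f ` {u..v} = f ` {u<..<v} \<union> {f u, f v}" by auto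
  \<comment> \<open>The ends of the middle arc lie on the chords, so adding them makes the arc
    compact without changing the piece.\<close>
  have absorb: "X \<union> Y \<union> Z = (X \<union> (Y \<union> {a, b})) \<union> Z" if "a \<in> X" "b \<in> Z"
    for X Y Z :: "(real^3) set" and a b
    using that by auto
  have eq: "piece i = (Out (f (x i)) \<union> f ` {u..v}) \<union> In (f (x (Suc i)))"
    unfolding piece_def uv(6) img by (rule absorb[OF uv(4,5)])
  have "connected (f ` {u..v})"
    using continuous by (intro connected_continuous_image) (auto intro: continuous_on_subset)
  moreover have "f u \<in> f ` {u..v}" "f v \<in> f ` {u..v}" using uv(2) by auto
  ultimately have "Out (f (x i)) \<inter> f ` {u..v} \<noteq> {}" "(Out (f (x i)) \<union> f ` {u..v}) \<inter> In (f (x (Suc i))) \<noteq> {}"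
    and "connected (f ` {u..v})"
    using uv(4,5) by blast+
  then have "connected (piece i)"
    unfolding eq using connected_segments[OF crossing_D] by (intro connected_Un)
  moreover have "closed (piece i)"
    unfolding eq by (intro closed_Un closed_image compact_imp_closed compact_segments crossing_D)
  ultimately show ?thesis by blast
qed

text \<open>Inside the charts a piece consists of chords only, and chords of different charts or of
  different kinds are disjoint; outside the charts a point of the curve lies on one edge up to
  translation.\<close>

lemma pieces_meet: "piece i \<inter> piece j \<noteq> {} \<longleftrightarrow> f (x i) = f (x j) \<or> f (x (Suc i)) = f (x (Suc j))"
proof
  have Out_ne: "Out p \<noteq> {}" "In p \<noteq> {}" for p by auto
  assume "f (x i) = f (x j) \<or> f (x (Suc i)) = f (x (Suc j))"
  moreover have "Out (f (x k)) \<subseteq> piece k" "In (f (x (Suc k))) \<subseteq> piece k" for k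
    unfolding piece_def by blast+
  ultimately show "piece i \<inter> piece j \<noteq> {}"
    using Out_ne by (metis Int_greatest subset_empty)
next
  assume "piece i \<inter> piece j \<noteq> {}"
  then obtain y where y: "y \<in> piece i" "y \<in> piece j" by blast
  have Out_Out: "p = q" if "y \<in> Out p" "y \<in> Out q" "p \<in> D" "q \<in> D" for p q
    using that same_chart[of p q] segments_cball by blast
  have In_In: "p = q" if "y \<in> In p" "y \<in> In q" "p \<in> D" "q \<in> D" for p q
    using that same_chart[of p q] segments_cball by blast
  have Out_In: False if pq: "y \<in> Out p" "y \<in> In q" "p \<in> D" "q \<in> D" for p q
  proof -
    obtain z where z: "y = \<phi> p z" "z \<in> closed_segment 1 \<i>" using pq(1) by (rule imageE)
    obtain w where w: "y = \<phi> q w" "w \<in> closed_segment (-1) (-\<i>)" using pq(2) by (rule imageE)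
    have "z = w"
      using same_chart[OF pq(3,4), of z w] z w segments_cball[THEN subsetD] by simp
    then show False using z(2) w(2) segments_disjoint by blast
  qed
  show "f (x i) = f (x j) \<or> f (x (Suc i)) = f (x (Suc j))"
  proof (cases "y \<in> B")
    case True
    have "y \<in> Out (f (x k)) \<or> y \<in> In (f (x (Suc k)))" if "y \<in> piece k" for k
      using that True unfolding piece_def Un_iff Diff_iff by blast
    from this[OF y(1)] this[OF y(2)] show ?thesis
      using Out_Out[OF _ _ crossing_D crossing_D] In_In[OF _ _ crossing_D crossing_D]
        Out_In[OF _ _ crossing_D crossing_D] by (elim disjE) metis+
  next
    case False
    have "y \<in> f ` {x k<..<x (Suc k)}" if "y \<in> piece k" for k
      using that False in_B[OF crossing_D, THEN subsetD] unfolding piece_def Un_iff Diff_iff by metis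
    then have "y \<in> f ` {x i<..<x (Suc i)}" "y \<in> f ` {x j<..<x (Suc j)}"
      using y by blast+
    then obtain z w where "z \<in> {x i<..<x (Suc i)}" "w \<in> {x j<..<x (Suc j)}" "f z = f w" by auto
    moreover from this have "on_edge i z" "on_edge j w"
      unfolding on_edge_def by (auto intro!: exI[of _ "0::int"])
    ultimately show ?thesis using on_edge_tail by blast
  qed
qed

text \<open>The edges repeat: \<open>x i\<close> modulo 1 determines the piece, and there are
  finitely many crossings in \<open>{0..1}\<close>.\<close>

lemma finite_pieces: "finite (range piece)"
proof -
  define y where "y i = x i - of_int \<lfloor>x i\<rfloor>" for i
  have yC: "f (y i) = f (x i)" for i
    unfolding y_def using periodic_of_int[of "x i" "- \<lfloor>x i\<rfloor>"] by simp
  have "range y \<subseteq> f -` D \<inter> {0..1}"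
    using yC crossing_D unfolding y_def by auto linarith
  then have fin: "finite (range y)"
    using finite_marked[OF finite_double_points] finite_subset by blast
  have "piece i = piece j" if "y i = y j" for i j
  proof -
    define n where "n = \<lfloor>x i\<rfloor> - \<lfloor>x j\<rfloor>"
    have n: "x i = x j + of_int n" using that unfolding y_def n_def by simp
    have "edge f D (x i) (x (Suc j) + of_int n)"
      using edge_shift[OF edge[of j], of n] n by simp
    then have m: "x (Suc i) = x (Suc j) + of_int n"
      using edge_overlap(2)[OF edge[of i], of "x i" "x (Suc j) + of_int n" "x i"] edge[of i]
      unfolding edge_def by simp
    have "z \<in> (\<lambda>z. z + of_int n) ` {x j<..<x (Suc j)}" if "z \<in> {x i<..<x (Suc i)}" for z
      using that n m by (intro image_eqI[of _ _ "z - of_int n"]) auto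
    then have "{x i<..<x (Suc i)} = (\<lambda>z. z + of_int n) ` {x j<..<x (Suc j)}"
      using n m by auto
    then have "f ` {x i<..<x (Suc i)} = f ` {x j<..<x (Suc j)}"
      by (simp add: image_image periodic_of_int)
    then show ?thesis unfolding piece_def n m by (simp add: periodic_of_int)
  qed
  \<comment> \<open>\<open>piece\<close> factors through the finitely many values of
    \<open>y\<close>.\<close>
  then have "range piece = (\<lambda>s. piece (SOME i. y i = s)) ` range y"
    unfolding image_image by (intro image_cong refl) (metis (mono_tags, lifting) someI)
  then show ?thesis using fin by simp
qed

text \<open>Each double point is the tail of some edge of the sequence and the head of some edge, so
  both chords of its chart occur.\<close>

lemma union_of_pieces:
  "(\<Union>i. piece i) = (range f - B) \<union> (\<Union>p\<in>D. \<phi> p ` (closed_segment (-1) (-\<i>) \<union> closed_segment 1 \<i>))"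
    (is "_ = ?T")
proof
  show "(\<Union>i. piece i) \<subseteq> ?T"
    unfolding piece_def using crossing_D by fast
  have tail: "\<exists>i. f (x i) = p" if p: "p \<in> D" for p
  proof -
    obtain c where c: "f c = p" using p unfolding double_points_def by auto
    obtain i n where n: "x i \<le> c + of_int n" "c + of_int n < x (Suc i)" using cover by blast
    have "f (c + of_int n) \<in> D" using c p periodic_of_int by simp
    then have "c + of_int n \<le> x i" using edge_prev[OF edge] n by blast
    then have "c + of_int n = x i" using n by simp
    then show ?thesis using c periodic_of_int by metis
  qed
  have head: "\<exists>i. f (x (Suc i)) = p" if p: "p \<in> D" for p
  proof -
    obtain c where c: "f c = p" using p unfolding double_points_def by auto
    obtain b where b: "edge f D b c"
      using exists_prev_marked[OF finite_double_points, of c c] c p unfolding edge_def by auto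
    obtain i n where n: "x i \<le> b + of_int n" "b + of_int n < x (Suc i)" using cover by blast
    have "x (Suc i) = c + of_int n"
      using edge_overlap(2)[OF edge[of i] edge_shift[OF b, of n], of "b + of_int n"] n b
      unfolding edge_def by auto
    then show ?thesis using c periodic_of_int by metis
  qed
  have outside: "y \<in> (\<Union>i. piece i)" if y: "y \<in> range f - B" for y
  proof -
    obtain z where z: "y = f z" using y by blast
    obtain i n where n: "x i \<le> z + of_int n" "z + of_int n < x (Suc i)" using cover by blast
    have fz: "f (z + of_int n) = y" using z periodic_of_int by simp
    have "\<phi> (f (x i)) 0 \<in> \<phi> (f (x i)) ` cball 0 1" by (intro imageI) simp
    then have "f (x i) \<in> B" using chart_facts(3)[OF crossing_D[of i]] crossing_D[of i] by auto
    then have "x i \<noteq> z + of_int n" using y fz by auto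
    then have "y \<in> f ` {x i<..<x (Suc i)}" using fz n by force
    then show ?thesis using y unfolding piece_def by blast
  qed
  have "Out p \<subseteq> (\<Union>i. piece i)" if "p \<in> D" for p
    using tail[OF that] unfolding piece_def by blast
  moreover have "In p \<subseteq> (\<Union>i. piece i)" if "p \<in> D" for p
    using head[OF that] unfolding piece_def by blast
  ultimately have "(\<Union>p\<in>D. \<phi> p ` (closed_segment (-1) (-\<i>) \<union> closed_segment 1 \<i>)) \<subseteq> (\<Union>i. piece i)"
    unfolding image_Un by (intro UN_least Un_least)
  then show "?T \<subseteq> (\<Union>i. piece i)"
    using outside by (intro Un_least subsetI) (assumption, erule subsetD)
qed

lemma card_components: "card (components (\<Union>i. piece i)) = circuits f"
  unfolding circuits_eq
proof (rule card_components_eq_classes[OF finite_pieces])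
  show "piece i \<noteq> {}" for i unfolding piece_def by auto
qed (use piece_connected_closed pieces_meet in auto)

end

text \<open>The right-hand side does not mention the charts, so all resolutions of one
  parametrisation have equally many circles.\<close>

theorem card_components_resolution:
  assumes "closed_curve f" and T: "non_Seifert_resolution f T"
  shows "card (components T) = circuits f"
proof (cases "double_points f = {}")
  case True
  then show ?thesis using circuits_of_components_no_crossings assms by blast
next
  case False
  interpret closed_curve f by fact
  obtain c where "c \<in> C"
    using False unfolding crossing_params_def double_points_def by auto
  obtain x where x: "x 0 = c" "\<And>i. edge f D (x i) (x (Suc i))"
    using exists_crossing_sequence[OF \<open>c \<in> C\<close>] by blast
  obtain \<phi> where \<phi>: "\<forall>p\<in>D. crossing_chart f p (\<phi> p)" "disjoint_family_on (\<lambda>p. \<phi> p ` cball 0 1) D"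
    "T = (range f - (\<Union>p\<in>D. \<phi> p ` cball 0 1)) \<union>
            (\<Union>p\<in>D. \<phi> p ` (closed_segment (-1) (-\<i>) \<union> closed_segment 1 \<i>))"
    using T unfolding non_Seifert_resolution_def by blast
  interpret resolved_curve f x \<phi>
    by unfold_locales (use x \<phi> in auto)
  show ?thesis
    using card_components union_of_pieces \<phi>(3) by simp
qed

section \<open>Dependence on the image only\<close>

definition ray :: "(real \<Rightarrow> real^3) \<Rightarrow> real \<Rightarrow> real \<Rightarrow> real \<Rightarrow> (real^3) set" where
  "ray f x \<sigma> \<epsilon> = (\<lambda>u. f (x + \<sigma> * u)) ` {0<..<\<epsilon>}"

text \<open>The filter order on initial arcs: each initial arc of the second half-branch contains
  one of the first. The signs are 1 and -1, for the half-branches after and before a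
  parameter.\<close>

definition germ_sub :: "(real \<Rightarrow> real^3) \<Rightarrow> real \<Rightarrow> real \<Rightarrow> (real \<Rightarrow> real^3) \<Rightarrow> real \<Rightarrow> real \<Rightarrow> bool" where
  "germ_sub f x \<sigma> g y \<rho> \<longleftrightarrow> (\<forall>\<delta>>0. \<exists>\<epsilon>>0. ray f x \<sigma> \<epsilon> \<subseteq> ray g y \<rho> \<delta>)"

definition germ_eq :: "(real \<Rightarrow> real^3) \<Rightarrow> real \<Rightarrow> real \<Rightarrow> (real \<Rightarrow> real^3) \<Rightarrow> real \<Rightarrow> real \<Rightarrow> bool" where
  "germ_eq f x \<sigma> g y \<rho> \<longleftrightarrow> germ_sub f x \<sigma> g y \<rho> \<and> germ_sub g y \<rho> f x \<sigma>"

lemma germ_eq_sym: "germ_eq f x \<sigma> g y \<rho> \<Longrightarrow> germ_eq g y \<rho> f x \<sigma>"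
  unfolding germ_eq_def by blast

lemma germ_sub_trans: "germ_sub f x \<sigma> g y \<rho> \<Longrightarrow> germ_sub g y \<rho> h z \<upsilon> \<Longrightarrow> germ_sub f x \<sigma> h z \<upsilon>"
  unfolding germ_sub_def by (meson subset_trans)

lemma germ_eq_trans: "germ_eq f x \<sigma> g y \<rho> \<Longrightarrow> germ_eq g y \<rho> h z \<upsilon> \<Longrightarrow> germ_eq f x \<sigma> h z \<upsilon>"
  unfolding germ_eq_def using germ_sub_trans by blast

lemma ray_shift: "closed_curve g \<Longrightarrow> ray g (y + of_int n) \<rho> \<epsilon> = ray g y \<rho> \<epsilon>"
  unfolding ray_def using closed_curve.periodic_of_int[of g "y + \<rho> * _" n]
  by (intro image_cong refl) (simp add: algebra_simps)

lemma germ_eq_shift: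
  "closed_curve g \<Longrightarrow> y - y' \<in> \<int> \<Longrightarrow> germ_eq f x \<sigma> g y \<rho> \<Longrightarrow> germ_eq f x \<sigma> g y' \<rho>"
proof -
  assume g: "closed_curve g" "y - y' \<in> \<int>" "germ_eq f x \<sigma> g y \<rho>"
  then obtain n where "y - y' = of_int n" by (elim Ints_cases)
  then have "y = y' + of_int n" by simp
  then show ?thesis using g(3) ray_shift[OF g(1)] unfolding germ_eq_def germ_sub_def by simp
qed

lemma ray_reverse: "ray (\<lambda>x. g (- x)) (- y) \<rho> \<epsilon> = ray g y (- \<rho>) \<epsilon>"
  unfolding ray_def by simp

lemma eventually_ray:
  assumes "isCont f x" "open U" "f x \<in> U" "\<sigma> \<in> {1, -1}"
  shows "\<exists>\<epsilon>>0. ray f x \<sigma> \<epsilon> \<subseteq> U"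
proof -
  have "\<forall>\<^sub>F z in nhds x. f z \<in> U"
    using topological_tendstoD[OF assms(1)[unfolded isCont_def] assms(2,3)] assms(3)
    by (simp add: eventually_nhds_conv_at)
  then obtain \<epsilon> where \<epsilon>: "\<epsilon> > 0" "\<And>z. dist z x < \<epsilon> \<Longrightarrow> f z \<in> U"
    unfolding eventually_nhds_metric by blast
  then show ?thesis
    using assms(4) unfolding ray_def by (intro exI[of _ \<epsilon>]) (auto simp: dist_real_def)
qed

text \<open>Rays shrink to their starting points, and different points have disjoint
  neighbourhoods.\<close>

lemma germ_value:
  assumes "closed_curve f" "closed_curve g" "\<sigma> \<in> {1, -1}" "\<rho> \<in> {1, -1}" "germ_sub f x \<sigma> g y \<rho>"
  shows "f x = g y"
proof (rule ccontr)
  assume "f x \<noteq> g y"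
  then obtain U V where UV: "open U" "open V" "f x \<in> U" "g y \<in> V" "U \<inter> V = {}"
    by (meson hausdorff)
  obtain \<epsilon> \<delta> where \<epsilon>: "\<epsilon> > 0" "ray f x \<sigma> \<epsilon> \<subseteq> U" and \<delta>: "\<delta> > 0" "ray g y \<rho> \<delta> \<subseteq> V"
    using eventually_ray[OF closed_curve.isCont[OF assms(1)] UV(1,3) assms(3)]
      eventually_ray[OF closed_curve.isCont[OF assms(2)] UV(2,4) assms(4)] by blast
  obtain \<epsilon>' where \<epsilon>': "\<epsilon>' > 0" "ray f x \<sigma> \<epsilon>' \<subseteq> ray g y \<rho> \<delta>"
    using assms(5) \<delta> unfolding germ_sub_def by blast
  define u where "u = min \<epsilon> \<epsilon>' / 2"
  have "u \<in> {0<..<\<epsilon>}" "u \<in> {0<..<\<epsilon>'}" unfolding u_def using \<epsilon>(1) \<epsilon>'(1) by auto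
  then have "f (x + \<sigma> * u) \<in> ray f x \<sigma> \<epsilon>" "f (x + \<sigma> * u) \<in> ray f x \<sigma> \<epsilon>'"
    unfolding ray_def by blast+
  then show False using \<epsilon>(2) \<delta>(2) \<epsilon>'(2) UV(5) by blast
qed

text \<open>Near \<open>x\<close>, except perhaps at \<open>x\<close>, the curve passes through
  simple points only. Sharing such points means that the two parameters agree modulo 1 after
  arbitrarily small steps in the directions \<sigma> and \<rho>. In the limit \<open>x\<close> and
  \<open>y\<close> agree, and then so do the directions.\<close>

lemma (in closed_curve) germ_unique:
  assumes \<sigma>: "\<sigma> \<in> {1, -1}" "\<rho> \<in> {1, -1}" and sub: "germ_sub f x \<sigma> f y \<rho>"
  shows "x - y \<in> \<int> \<and> \<sigma> = \<rho>"
proof -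
  obtain \<epsilon>0 where \<epsilon>0: "\<epsilon>0 > 0" "\<And>z. z \<noteq> x \<Longrightarrow> dist z x < \<epsilon>0 \<Longrightarrow> z \<notin> C"
    using eventually_not_crossing[of x] unfolding eventually_at by auto
  have close: "\<exists>u v. 0 < u \<and> u < \<delta> \<and> 0 < v \<and> v < \<delta> \<and> x + \<sigma> * u - (y + \<rho> * v) \<in> \<int>" if \<delta>: "\<delta> > 0" for \<delta>
  proof -
    obtain \<epsilon> where \<epsilon>: "\<epsilon> > 0" "ray f x \<sigma> \<epsilon> \<subseteq> ray f y \<rho> \<delta>"
      using sub \<delta> unfolding germ_sub_def by blast
    define u where "u = min (min \<epsilon> \<epsilon>0) \<delta> / 2"
    have u: "0 < u" "u < \<epsilon>" "u < \<epsilon>0" "u < \<delta>" unfolding u_def using \<epsilon> \<epsilon>0 \<delta> by auto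
    then have "f (x + \<sigma> * u) \<in> ray f y \<rho> \<delta>"
      using \<epsilon>(2) unfolding ray_def by auto
    then obtain v where v: "0 < v" "v < \<delta>" "f (x + \<sigma> * u) = f (y + \<rho> * v)"
      unfolding ray_def by auto
    have "x + \<sigma> * u \<notin> C"
      using u \<sigma>(1) by (intro \<epsilon>0(2)) (auto simp: dist_real_def)
    then show ?thesis using Ints_of_eq[OF v(3)] u v by blast
  qed
  have "x - y \<in> \<int>"
  proof (rule ccontr)
    assume "x - y \<notin> \<int>"
    moreover have "open (- \<int> :: real set)" using closed_Ints by (simp add: open_closed)
    ultimately obtain \<eta> where \<eta>: "\<eta> > 0" "ball (x - y) \<eta> \<subseteq> - \<int>"
      by (meson ComplI open_contains_ball)
    \<comment> \<open>Halving \<open>\<eta>\<close> keeps the sum of both displacements below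
      it.\<close>
    obtain u v where uv: "0 < u" "u < \<eta> / 2" "0 < v" "v < \<eta> / 2" "x + \<sigma> * u - (y + \<rho> * v) \<in> \<int>"
      using close[of "\<eta> / 2"] \<eta>(1) by auto
    have "x + \<sigma> * u - (y + \<rho> * v) \<in> ball (x - y) \<eta>"
      using uv \<sigma> by (auto simp: dist_real_def)
    then show False using \<eta>(2) uv(5) by blast
  qed
  moreover have "\<sigma> = \<rho>"
  proof -
    \<comment> \<open>With displacements below one half, their integer difference is less than 1 in
      size and hence 0.\<close>
    obtain u v where uv: "0 < u" "u < 1 / 2" "0 < v" "v < 1 / 2" "x + \<sigma> * u - (y + \<rho> * v) \<in> \<int>"
      using close[of "1 / 2"] by auto
    then have "\<sigma> * u - \<rho> * v \<in> \<int>"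
      using Ints_diff[OF uv(5) \<open>x - y \<in> \<int>\<close>] by (simp add: algebra_simps)
    then have "\<sigma> * u = \<rho> * v"
      using Ints_nonzero_abs_less1[of "\<sigma> * u - \<rho> * v"] uv \<sigma> by auto
    then show ?thesis using uv \<sigma> by auto
  qed
  ultimately show ?thesis by blast
qed

lemma strict_mono_germ_sub:
  assumes h: "strict_mono_on {c<..<d} h" "h ` {c<..<d} = {c'<..<d'}" "c < d"
    and eq: "\<And>z. z \<in> {c<..<d} \<Longrightarrow> f z = g (h z)"
  shows "germ_sub f c 1 g c' 1" "germ_sub f d (-1) g d' (-1)"
proof -
  have "{c'<..<d'} \<noteq> {}" using h(2,3) by (metis greaterThanLessThan_empty_iff image_is_empty not_le)
  then have cd': "c' < d'" by simp
  have img: "h z \<in> {c'<..<d'}" if "z \<in> {c<..<d}" for z using h(2) that by blast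
  show "germ_sub f c 1 g c' 1"
    unfolding germ_sub_def
  proof (intro allI impI)
    fix \<delta> :: real assume "\<delta> > 0"
    \<comment> \<open>A value within \<delta> of the end \<open>c'\<close>; by monotonicity
      everything between \<open>c\<close> and its preimage \<open>t\<close> goes at least as close
      to that end.\<close>
    define w where "w = c' + min \<delta> (d' - c') / 2"
    have w: "w \<in> {c'<..<d'}" "w < c' + \<delta>" unfolding w_def using \<open>\<delta> > 0\<close> cd' by (auto simp: min_def field_simps)
    then obtain t where t: "t \<in> {c<..<d}" "h t = w" using h(2) by (metis imageE)
    have "f (c + u) \<in> ray g c' 1 \<delta>" if "0 < u" "u < t - c" for u
    proof -
      have cu: "c + u \<in> {c<..<d}" "c + u < t" using that t by auto
      then have "h (c + u) < w" using strict_mono_onD[OF h(1) cu(1) t(1)] t(2) by simp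
      then have "h (c + u) - c' \<in> {0<..<\<delta>}" using img[OF cu(1)] w by auto
      moreover have "f (c + u) = g (c' + 1 * (h (c + u) - c'))" using eq[OF cu(1)] by simp
      ultimately show ?thesis unfolding ray_def by blast
    qed
    then show "\<exists>\<epsilon>>0. ray f c 1 \<epsilon> \<subseteq> ray g c' 1 \<delta>"
      using t(1) by (intro exI[of _ "t - c"]) (auto simp: ray_def[of f])
  qed
  show "germ_sub f d (-1) g d' (-1)"
    unfolding germ_sub_def
  proof (intro allI impI)
    fix \<delta> :: real assume "\<delta> > 0"
    define w where "w = d' - min \<delta> (d' - c') / 2"
    have w: "w \<in> {c'<..<d'}" "w > d' - \<delta>" unfolding w_def using \<open>\<delta> > 0\<close> cd' by (auto simp: min_def field_simps)
    then obtain t where t: "t \<in> {c<..<d}" "h t = w" using h(2) by (metis imageE)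
    have "f (d - u) \<in> ray g d' (-1) \<delta>" if "0 < u" "u < d - t" for u
    proof -
      have cu: "d - u \<in> {c<..<d}" "t < d - u" using that t by auto
      then have "w < h (d - u)" using strict_mono_onD[OF h(1) t(1) cu(1)] t(2) by simp
      then have "d' - h (d - u) \<in> {0<..<\<delta>}" using img[OF cu(1)] w by auto
      moreover have "f (d - u) = g (d' + -1 * (d' - h (d - u)))" using eq[OF cu(1)] by simp
      ultimately show ?thesis unfolding ray_def by blast
    qed
    then show "\<exists>\<epsilon>>0. ray f d (-1) \<epsilon> \<subseteq> ray g d' (-1) \<delta>"
      using t(1) by (intro exI[of _ "d - t"]) (auto simp: ray_def[of f])
  qed
qed

lemma strict_mono_germ_eq:
  assumes h: "strict_mono_on {c<..<d} h" "h ` {c<..<d} = {c'<..<d'}" "c < d" "c' < d'"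
    and eq: "\<And>z. z \<in> {c<..<d} \<Longrightarrow> f z = g (h z)"
  shows "germ_eq f c 1 g c' 1" "germ_eq f d (-1) g d' (-1)"
proof -
  let ?k = "inv_into {c<..<d} h"
  have k: "?k w \<in> {c<..<d}" "h (?k w) = w" if "w \<in> {c'<..<d'}" for w
    using that h(2) inv_into_into[of w h "{c<..<d}"] f_inv_into_f[of w h "{c<..<d}"] by auto
  have inj: "inj_on h {c<..<d}" using h(1) by (rule strict_mono_on_imp_inj_on)
  have "?k ` {c'<..<d'} = {c<..<d}"
    using inv_into_image_cancel[OF inj order_refl] h(2) by metis
  moreover have "strict_mono_on {c'<..<d'} ?k"
  proof (rule strict_mono_onI)
    fix v w assume vw: "v \<in> {c'<..<d'}" "w \<in> {c'<..<d'}" "v < w"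
    show "?k v < ?k w"
    proof (rule ccontr)
      assume "\<not> ?k v < ?k w"
      then have "h (?k w) \<le> h (?k v)"
        using strict_mono_on_leD[OF h(1) k(1)[OF vw(2)] k(1)[OF vw(1)]] by simp
      then show False using k vw by simp
    qed
  qed
  moreover have "g w = f (?k w)" if "w \<in> {c'<..<d'}" for w
    using eq[OF k(1)[OF that]] k(2)[OF that] by simp
  ultimately show "germ_eq f c 1 g c' 1" "germ_eq f d (-1) g d' (-1)"
    unfolding germ_eq_def
    using strict_mono_germ_sub[OF h(1-3), of f g] eq strict_mono_germ_sub[of c' d' ?k c d g f] h(4) by blast+
qed

section \<open>Two parametrisations of the same set\<close>

locale same_image = f: closed_curve f + g: closed_curve g for f g :: "real \<Rightarrow> real^3" +
  assumes range_eq: "range f = range g"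
begin

lemma same_image_swap: "same_image g f"
  by unfold_locales (simp add: range_eq)

text \<open>Both open edges are connected and avoid \<open>M\<close>, so each contains the other;
  the change of parameter is continuous and injective, hence monotone. The two alternatives are its
  two directions.\<close>

lemma edge_match:
  assumes M: "finite M" "f.D \<subseteq> M" "g.D \<subseteq> M" and e: "edge f M c d"
  shows "\<exists>c' d'. edge g M c' d' \<and>
    (germ_eq f c 1 g c' 1 \<and> germ_eq f d (-1) g d' (-1) \<or> germ_eq f c 1 g d' (-1) \<and> germ_eq f d (-1) g c' 1)"
proof -
  have cd: "c < d" "f c \<in> M" "\<And>z. z \<in> {c<..<d} \<Longrightarrow> f z \<notin> M" using e unfolding edge_def by auto
  obtain m where m: "m \<in> {c<..<d}" using dense[OF cd(1)] by auto
  obtain w where w: "f m = g w" using range_eq by (metis rangeE rangeI)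
  obtain b where b: "g b \<in> M" using range_eq cd(2) by (metis rangeE rangeI)
  have "g w \<notin> M" using cd(3)[OF m] w by simp
  obtain c' where c': "c' < w" "g c' \<in> M" "\<And>z. c' < z \<Longrightarrow> z < w \<Longrightarrow> g z \<notin> M"
    using g.exists_prev_marked[OF M(1) b, of w] by blast
  obtain d' where d': "w < d'" "g d' \<in> M" "\<And>z. w < z \<Longrightarrow> z < d' \<Longrightarrow> g z \<notin> M"
    using g.exists_next_marked[OF M(1) b, of w] by blast
  have e': "edge g M c' d'"
    unfolding edge_def using c' d' \<open>g w \<notin> M\<close> by (metis less_trans linorder_neqE)
  have w': "w \<in> {c'<..<d'}" using c' d' by simp
  have g': "g z \<notin> M" if "z \<in> {c'<..<d'}" for z using e' that unfolding edge_def by auto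
  have conn: "connected (f ` {c<..<d})" "connected (g ` {c'<..<d'})"
    using f.continuous g.continuous by (auto intro!: connected_continuous_image intro: continuous_on_subset)
  have sub1: "f ` {c<..<d} \<subseteq> g ` {c'<..<d'}"
  proof (rule g.connected_in_edge[OF e' M(3) conn(1)])
    show "f ` {c<..<d} \<subseteq> range g - M" using cd(3) range_eq by blast
    show "f ` {c<..<d} \<inter> g ` {c'<..<d'} \<noteq> {}" using m w w' by (metis IntI empty_iff imageI)
  qed
  have sub2: "g ` {c'<..<d'} \<subseteq> f ` {c<..<d}"
  proof (rule f.connected_in_edge[OF e M(2) conn(2)])
    show "g ` {c'<..<d'} \<subseteq> range f - M" using g' range_eq by blast
    show "g ` {c'<..<d'} \<inter> f ` {c<..<d} \<noteq> {}" using m w w' by (metis IntI empty_iff imageI)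
  qed
  obtain \<theta> where \<theta>: "continuous_on (g ` {c'<..<d'}) \<theta>" "\<And>x. x \<in> {c'<..<d'} \<Longrightarrow> \<theta> (g x) = x"
    using g.edge_inverse[OF e' M(3)] by metis
  define h where "h z = \<theta> (f z)" for z
  have h_in: "h z \<in> {c'<..<d'} \<and> f z = g (h z)" if z: "z \<in> {c<..<d}" for z
  proof -
    obtain y where "y \<in> {c'<..<d'}" "f z = g y" using sub1 z by blast
    then show ?thesis unfolding h_def using \<theta>(2) by simp
  qed
  have h_img: "h ` {c<..<d} = {c'<..<d'}"
  proof (intro equalityI subsetI)
    fix y assume y: "y \<in> {c'<..<d'}"
    then obtain z where "z \<in> {c<..<d}" "g y = f z" using sub2 by blast
    then have "h z = y" unfolding h_def using \<theta>(2)[OF y] by simp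
    then show "y \<in> h ` {c<..<d}" using \<open>z \<in> {c<..<d}\<close> by blast
  qed (use h_in in blast)
  have "inj_on h {c<..<d}"
    using h_in f.edge_inj[OF e M(2)] by (metis (mono_tags, lifting) inj_on_def)
  moreover have "continuous_on {c<..<d} h"
    unfolding h_def using sub1 f.continuous
    by (intro continuous_on_compose2[OF \<theta>(1)]) (auto intro: continuous_on_subset)
  ultimately consider "strict_mono_on {c<..<d} h" | "strict_antimono_on {c<..<d} h"
    using injective_eq_monotone_map[of "{c<..<d}" h] by (auto simp: is_interval_oo)
  then show ?thesis
  proof cases
    case 1
    then show ?thesis
      using strict_mono_germ_eq[OF 1 h_img cd(1), of f g] e' h_in unfolding edge_def by blast
  next
    case 2
    \<comment> \<open>Reversing \<open>g\<close> makes the change of parameter increasing.\<close>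
    have "strict_mono_on {c<..<d} (\<lambda>z. - h z)"
      using 2 by (simp add: monotone_on_def)
    moreover have "(\<lambda>z. - h z) ` {c<..<d} = {- d'<..<- c'}"
      using h_img image_image[of uminus h "{c<..<d}"] by simp
    moreover have "- d' < - c'" using e' unfolding edge_def by simp
    ultimately have "germ_eq f c 1 (\<lambda>x. g (- x)) (- d') 1" "germ_eq f d (-1) (\<lambda>x. g (- x)) (- c') (-1)"
      using strict_mono_germ_eq[of c d "\<lambda>z. - h z" "- d'" "- c'" f "\<lambda>x. g (- x)"] cd(1) h_in by auto
    then have "germ_eq f c 1 g d' (-1)" "germ_eq f d (-1) g c' 1"
      unfolding germ_eq_def germ_sub_def ray_reverse by simp_all
    then show ?thesis using e' by blast
  qed
qed

lemma germ_match:
  assumes M: "finite M" "f.D \<subseteq> M" "g.D \<subseteq> M" and x: "f x \<in> M" and \<sigma>: "\<sigma> \<in> {1, -1}"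
  shows "\<exists>y. \<exists>\<rho>\<in>{1, -1}. germ_eq f x \<sigma> g y \<rho> \<and> g y = f x"
proof -
  have "\<exists>y. \<exists>\<rho>\<in>{1, -1}. germ_eq f x \<sigma> g y \<rho>"
  proof (cases "\<sigma> = 1")
    case True
    obtain d where "edge f M x d"
      using f.exists_next_marked[OF M(1) x, of x] x unfolding edge_def by auto
    then show ?thesis using edge_match[OF M] True by blast
  next
    case False
    then have "\<sigma> = -1" using \<sigma> by simp
    obtain c where "edge f M c x"
      using f.exists_prev_marked[OF M(1) x, of x] x unfolding edge_def by auto
    then show ?thesis using edge_match[OF M] \<open>\<sigma> = -1\<close> by blast
  qed
  then show ?thesis
    using germ_value[OF f.closed_curve_axioms g.closed_curve_axioms \<sigma>] unfolding germ_eq_def by metis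
qed

text \<open>Two branches of a curve at a double point have four half-branches, more than a curve has at
  a simple point.\<close>

lemma double_points_subset: "f.D \<subseteq> g.D"
proof
  fix p assume "p \<in> f.D"
  then obtain s t where st: "s - t \<notin> \<int>" "f s = p" "f t = p" unfolding double_points_def by auto
  let ?M = "f.D \<union> g.D"
  have M: "finite ?M" "f.D \<subseteq> ?M" "g.D \<subseteq> ?M" "f s \<in> ?M" "f t \<in> ?M"
    using f.finite_double_points g.finite_double_points \<open>p \<in> f.D\<close> st by auto
  show "p \<in> g.D"
  proof (rule ccontr)
    assume p: "p \<notin> g.D"
    have int: "y - y' \<in> \<int>" if "g y = p" "g y' = p" for y y'
      using p that unfolding double_points_def by blast
    have same: "a - b \<in> \<int> \<and> \<sigma> = \<upsilon>"
      if "germ_eq f a \<sigma> g y \<rho>" "germ_eq f b \<upsilon> g y' \<rho>" "g y = p" "g y' = p" "\<sigma> \<in> {1, -1}" "\<upsilon> \<in> {1, -1}"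
      for a b \<sigma> \<upsilon> y y' \<rho>
    proof -
      have "germ_eq f a \<sigma> g y' \<rho>"
        using germ_eq_shift[OF g.closed_curve_axioms int that(1)] that by blast
      then have "germ_eq f a \<sigma> f b \<upsilon>"
        using germ_eq_trans germ_eq_sym that(2) by metis
      then show ?thesis using f.germ_unique that(5,6) unfolding germ_eq_def by blast
    qed
    obtain y1 \<rho>1 where 1: "\<rho>1 \<in> {1, -1}" "germ_eq f s 1 g y1 \<rho>1" "g y1 = p"
      using germ_match[OF M(1-4), of 1] st by auto
    obtain y2 \<rho>2 where 2: "\<rho>2 \<in> {1, -1}" "germ_eq f s (-1) g y2 \<rho>2" "g y2 = p"
      using germ_match[OF M(1-4), of "-1"] st by auto
    obtain y3 \<rho>3 where 3: "\<rho>3 \<in> {1, -1}" "germ_eq f t 1 g y3 \<rho>3" "g y3 = p"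
      using germ_match[OF M(1-3) M(5), of 1] st by auto
    \<comment> \<open>A simple point of \<open>g\<close> offers only two directions, so two of three
      half-branches of \<open>f\<close> coincide.\<close>
    have "\<rho>1 = \<rho>2 \<or> \<rho>1 = \<rho>3 \<or> \<rho>2 = \<rho>3" using 1(1) 2(1) 3(1) by auto
    then show False
      using same[OF 1(2) _ 1(3), of s "-1" y2] same[OF 1(2) _ 1(3), of t 1 y3]
        same[OF 2(2) _ 2(3), of t 1 y3] 2(2,3) 3(2,3) st(1) by auto
  qed
qed

end

text \<open>A chart is merely a continuous injection. Removing \<open>\<psi> 1\<close>, which comes
  from the boundary circle, turns the sphere into a plane, where invariance of domain makes the
  image of the open disk open.\<close>

lemma chart_ball_open:
  fixes \<psi> :: "complex \<Rightarrow> real^3"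
  assumes "continuous_on (cball 0 1) \<psi>" "inj_on \<psi> (cball 0 1)" "\<psi> ` cball 0 1 \<subseteq> S2"
  shows "\<exists>U. open U \<and> S2 \<inter> U = \<psi> ` ball 0 1"
proof -
  have b: "\<psi> 1 \<in> S2" using assms(3) by (rule subsetD) simp
  have "(S2 - {\<psi> 1}) homeomorphic (UNIV :: complex set)"
    using b by (intro homeomorphic_punctured_sphere_affine) auto
  then obtain h k where hk: "homeomorphism (S2 - {\<psi> 1}) (UNIV :: complex set) h k"
    unfolding homeomorphic_def by blast
  have sub: "\<psi> ` ball 0 1 \<subseteq> S2 - {\<psi> 1}"
  proof
    fix y assume "y \<in> \<psi> ` ball 0 1"
    then obtain z where z: "z \<in> ball 0 1" "y = \<psi> z" by blast
    then have "z \<noteq> 1" "z \<in> cball 0 1" by auto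
    then have "\<psi> z \<noteq> \<psi> 1" using inj_onD[OF assms(2), of z 1] by auto
    then show "y \<in> S2 - {\<psi> 1}" using z subsetD[OF assms(3) imageI[OF \<open>z \<in> cball 0 1\<close>]] by simp
  qed
  have "continuous_on (ball 0 1) (h \<circ> \<psi>)"
    using sub continuous_on_subset[OF assms(1) ball_subset_cball]
      continuous_on_subset[OF homeomorphism_cont1[OF hk]]
    by (intro continuous_on_compose) auto
  moreover have inj_h: "inj_on h (S2 - {\<psi> 1})"
    using homeomorphism_apply1[OF hk] by (metis inj_on_inverseI)
  then have "inj_on (h \<circ> \<psi>) (ball 0 1)"
    using inj_on_subset[OF assms(2) ball_subset_cball] sub
    by (intro comp_inj_on) (auto intro: inj_on_subset)
  ultimately have "open ((h \<circ> \<psi>) ` ball 0 1)"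
    using invariance_of_domain[OF _ open_ball] by blast
  then have "openin (top_of_set (S2 - {\<psi> 1})) ((S2 - {\<psi> 1}) \<inter> h -` ((h \<circ> \<psi>) ` ball 0 1))"
    by (rule continuous_openin_preimage_gen[OF homeomorphism_cont1[OF hk]])
  moreover have "(S2 - {\<psi> 1}) \<inter> h -` ((h \<circ> \<psi>) ` ball 0 1) = \<psi> ` ball 0 1"
    using sub inj_onD[OF inj_h] by fastforce
  moreover have "openin (top_of_set S2) (S2 - {\<psi> 1})"
    by (simp add: openin_delete)
  ultimately have "openin (top_of_set S2) (\<psi> ` ball 0 1)"
    by (metis openin_trans)
  then show ?thesis
    unfolding openin_open by metis
qed

text \<open>Being topological, this tells neighbouring half-branches at a double point from opposite ones
  without reference to a parametrisation.\<close>

definition adjacent :: "(real^3) set \<Rightarrow> real^3 \<Rightarrow> (real^3) set \<Rightarrow> (real^3) set \<Rightarrow> bool" where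
  "adjacent Q p A B \<longleftrightarrow> (\<forall>U. open U \<and> p \<in> U \<longrightarrow>
     (\<exists>W. connected W \<and> W \<subseteq> S2 \<inter> U - Q \<and> closure W \<inter> A \<noteq> {} \<and> closure W \<inter> B \<noteq> {}))"

lemma adjacent_mono: "adjacent Q p A B \<Longrightarrow> A \<subseteq> A' \<Longrightarrow> B \<subseteq> B' \<Longrightarrow> adjacent Q p A' B'"
proof -
  assume adj: "adjacent Q p A B" and sub: "A \<subseteq> A'" "B \<subseteq> B'"
  show ?thesis
    unfolding adjacent_def
  proof (intro allI impI)
    fix U :: "(real^3) set" assume U: "open U \<and> p \<in> U"
    obtain W where W: "connected W \<and> W \<subseteq> S2 \<inter> U - Q \<and> closure W \<inter> A \<noteq> {} \<and> closure W \<inter> B \<noteq> {}"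
      using adj[unfolded adjacent_def, rule_format, OF U] by (rule exE)
    then have "closure W \<inter> A' \<noteq> {}" "closure W \<inter> B' \<noteq> {}" using sub by auto
    with W show "\<exists>W. connected W \<and> W \<subseteq> S2 \<inter> U - Q \<and> closure W \<inter> A' \<noteq> {} \<and> closure W \<inter> B' \<noteq> {}"
      by (intro exI[of _ W]) simp
  qed
qed

lemma adjacent_sym: "adjacent Q p A B \<Longrightarrow> adjacent Q p B A"
  unfolding adjacent_def by (simp add: conj_commute)

lemma branch_ray:
  assumes "branch f \<psi> y e" "\<rho> \<in> {1, -1}"
  shows "\<forall>\<^sub>F u in at_right 0. f (y + \<rho> * u) \<in> \<psi> ` (\<lambda>r. r *\<^sub>R (\<rho> *\<^sub>R e)) ` {0<..<1}"
proof -
  obtain r l where "y < r" "\<And>z. y < z \<Longrightarrow> z < r \<Longrightarrow> f z \<in> \<psi> ` (\<lambda>r. r *\<^sub>R e) ` {0<..<1}"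
    "l < y" "\<And>z. l < z \<Longrightarrow> z < y \<Longrightarrow> f z \<in> \<psi> ` (\<lambda>r. r *\<^sub>R - e) ` {0<..<1}"
    using assms(1) unfolding branch_def eventually_at_right_field eventually_at_left_field by blast
  then show ?thesis
    using assms(2) by (intro eventually_at_rightI'[of 0 "min (r - y) (y - l)"]) auto
qed

context closed_curve
begin

text \<open>The chart disk without a small ball around 0 has a compact image missing
  \<open>p\<close>; an initial part of the ray avoids that image while staying on the arm.\<close>

lemma branch_ray_close:
  assumes ch: "crossing_chart f p \<psi>" and y: "f y = p" "branch f \<psi> y e" "e \<in> {1, \<i>}" and \<rho>: "\<rho> \<in> {1, -1}"
    and "\<eta> > 0" "\<epsilon> > 0"
  shows "\<exists>r. 0 < r \<and> r < \<eta> \<and> \<psi> (r *\<^sub>R (\<rho> *\<^sub>R e)) \<in> ray f y \<rho> \<epsilon>"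
proof -
  have c: "continuous_on (cball 0 1) \<psi>" "inj_on \<psi> (cball 0 1)" "\<psi> 0 = p"
    using ch unfolding crossing_chart_iff by auto
  let ?K = "cball 0 1 - ball 0 \<eta> :: complex set"
  have "compact (\<psi> ` ?K)"
    using c(1) by (intro compact_continuous_image compact_diff) (auto intro: continuous_on_subset)
  then have op: "open (- (\<psi> ` ?K))" by (simp add: compact_imp_closed open_Compl)
  have "p \<notin> \<psi> ` ?K"
  proof
    assume "p \<in> \<psi> ` ?K"
    then obtain z where "z \<in> ?K" "\<psi> 0 = \<psi> z" using c(3) by auto
    then have "z = 0" using inj_onD[OF c(2), of 0 z] by auto
    then show False using \<open>z \<in> ?K\<close> \<open>\<eta> > 0\<close> by auto
  qed
  then have "\<exists>\<epsilon>'>0. ray f y \<rho> \<epsilon>' \<subseteq> - (\<psi> ` ?K)"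
    using y(1) by (intro eventually_ray[OF isCont op _ \<rho>]) auto
  then obtain \<epsilon>' where \<epsilon>': "\<epsilon>' > 0" "ray f y \<rho> \<epsilon>' \<subseteq> - (\<psi> ` ?K)" by blast
  obtain b where b: "b > 0" "\<And>u. 0 < u \<Longrightarrow> u < b \<Longrightarrow> f (y + \<rho> * u) \<in> \<psi> ` (\<lambda>r. r *\<^sub>R (\<rho> *\<^sub>R e)) ` {0<..<1}"
    using branch_ray[OF y(2) \<rho>] unfolding eventually_at_right_field by blast
  define u where "u = min b (min \<epsilon> \<epsilon>') / 2"
  have u: "0 < u" "u < b" "u < \<epsilon>" "u < \<epsilon>'" unfolding u_def using b(1) \<epsilon>'(1) \<open>\<epsilon> > 0\<close> by auto
  obtain r where r: "r \<in> {0<..<1}" "f (y + \<rho> * u) = \<psi> (r *\<^sub>R (\<rho> *\<^sub>R e))"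
    using b(2)[OF u(1,2)] by auto
  have norm: "cmod (r *\<^sub>R (\<rho> *\<^sub>R e)) = r" using r \<rho> y(3) by auto
  have "f (y + \<rho> * u) \<in> ray f y \<rho> \<epsilon>'" unfolding ray_def using u by auto
  then have "f (y + \<rho> * u) \<notin> \<psi> ` ?K" using \<epsilon>'(2) by blast
  then have "r *\<^sub>R (\<rho> *\<^sub>R e) \<notin> ?K" unfolding r(2) by blast
  then have "r < \<eta>" using norm r(1) by auto
  moreover have "f (y + \<rho> * u) \<in> ray f y \<rho> \<epsilon>" unfolding ray_def using u by auto
  ultimately show ?thesis using r by auto
qed

text \<open>The two half-branches bound an open quadrant of the chart. A small square in it is
  connected, misses the cross and hence the curve, and has points of both arms in its
  closure.\<close>

lemma different_branches_adjacent:
  assumes ch: "crossing_chart f p \<psi>" and y: "f y = p" "f y' = p" "y - y' \<notin> \<int>"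
    and \<rho>: "\<rho> \<in> {1, -1}" "\<rho>' \<in> {1, -1}" and \<epsilon>: "\<epsilon> > 0" "\<epsilon>' > 0"
  shows "adjacent (range f) p (ray f y \<rho> \<epsilon>) (ray f y' \<rho>' \<epsilon>')"
proof -
  have c: "continuous_on (cball 0 1) \<psi>" "inj_on \<psi> (cball 0 1)" "\<psi> ` cball 0 1 \<subseteq> S2" "\<psi> 0 = p"
    "range f \<inter> \<psi> ` cball 0 1 = \<psi> ` cross"
    using ch unfolding crossing_chart_iff by auto
  obtain s t where near: "\<And>c. f c = p \<Longrightarrow> c - s \<in> \<int> \<and> branch f \<psi> c 1 \<or> c - t \<in> \<int> \<and> branch f \<psi> c \<i>"
    using chart_strands[OF ch] by metis
  have diff: "z - w \<in> \<int>" if "z - v \<in> \<int>" "w - v \<in> \<int>" for z w v :: real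
    using Ints_diff[OF that] by simp
  obtain e e' where e: "branch f \<psi> y e" "branch f \<psi> y' e'" "e = 1 \<and> e' = \<i> \<or> e = \<i> \<and> e' = 1"
    using near[OF y(1)] near[OF y(2)] diff y(3) by metis
  show ?thesis
    unfolding adjacent_def
  proof (intro allI impI)
    fix U :: "(real^3) set" assume U: "open U \<and> p \<in> U"
    have "continuous (at 0 within cball 0 1) \<psi>"
      using c(1) by (simp add: continuous_on_eq_continuous_within)
    then have "\<forall>\<^sub>F z in at 0 within cball 0 1. \<psi> z \<in> U"
      using U c(4) unfolding continuous_within by (auto dest: topological_tendstoD)
    then obtain \<eta>0 where \<eta>0: "\<eta>0 > 0" "\<And>z. z \<in> cball 0 1 \<Longrightarrow> z \<noteq> 0 \<Longrightarrow> dist z 0 < \<eta>0 \<Longrightarrow> \<psi> z \<in> U"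
      unfolding eventually_at by auto
    \<comment> \<open>The square has side \<eta>, so its points have norm below
      \<open>2 * \<eta>\<close>; this stays within the unit disk and within the radius that \<psi>
      sends into \<open>U\<close>.\<close>
    define \<eta> where "\<eta> = min 1 \<eta>0 / 2"
    have \<eta>: "0 < \<eta>" "2 * \<eta> \<le> 1" "2 * \<eta> \<le> \<eta>0" unfolding \<eta>_def using \<eta>0(1) by auto
    define m where "m = (\<lambda>(a, b). a *\<^sub>R (\<rho> *\<^sub>R e) + b *\<^sub>R (\<rho>' *\<^sub>R e'))"
    have m_norm: "cmod (m (a, b)) \<le> a + b" if "0 \<le> a" "0 \<le> b" for a b
    proof -
      have "cmod (m (a, b)) \<le> cmod (a *\<^sub>R (\<rho> *\<^sub>R e)) + cmod (b *\<^sub>R (\<rho>' *\<^sub>R e'))"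
        unfolding m_def case_prod_conv by (rule norm_triangle_ineq)
      also have "\<dots> = a + b" using that \<rho> e(3) by auto
      finally show ?thesis .
    qed
    have m_parts: "\<bar>Re (m (a, b))\<bar> = a \<and> \<bar>Im (m (a, b))\<bar> = b \<or> \<bar>Re (m (a, b))\<bar> = b \<and> \<bar>Im (m (a, b))\<bar> = a"
      if "0 \<le> a" "0 \<le> b" for a b
      using that \<rho> e(3) unfolding m_def by auto
    let ?S = "{0<..<\<eta>} \<times> {0<..<\<eta>}"
    have clS: "closure ?S = {0..\<eta>} \<times> {0..\<eta>}"
      using \<eta>(1) by (simp add: closure_Times)
    have m_cball: "m ` ({0..\<eta>} \<times> {0..\<eta>}) \<subseteq> cball 0 1"
    proof
      fix z assume "z \<in> m ` ({0..\<eta>} \<times> {0..\<eta>})"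
      then obtain a b where ab: "0 \<le> a" "a \<le> \<eta>" "0 \<le> b" "b \<le> \<eta>" "z = m (a, b)" by auto
      have "cmod z \<le> 2 * \<eta>" using m_norm[OF ab(1,3)] ab by simp
      then show "z \<in> cball 0 1" using \<eta>(2) by simp
    qed
    have cont: "continuous_on (closure ?S) (\<lambda>w. \<psi> (m w))"
      unfolding clS
    proof (rule continuous_on_compose2[OF c(1) _ m_cball])
      show "continuous_on ({0..\<eta>} \<times> {0..\<eta>}) m"
        unfolding m_def case_prod_beta by (intro continuous_intros)
    qed
    let ?W = "(\<lambda>w. \<psi> (m w)) ` ?S"
    have conn: "connected ?W"
      using continuous_on_subset[OF cont closure_subset]
      by (intro connected_continuous_image connected_Times) auto
    have sub: "?W \<subseteq> S2 \<inter> U - range f"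
    proof
      fix q assume "q \<in> ?W"
      then obtain a b where ab: "0 < a" "a < \<eta>" "0 < b" "b < \<eta>" "q = \<psi> (m (a, b))" by auto
      have "cmod (m (a, b)) < 2 * \<eta>" using m_norm[of a b] ab by simp
      then have cb: "m (a, b) \<in> cball 0 1" "dist (m (a, b)) 0 < \<eta>0" using \<eta> by auto
      have parts: "Re (m (a, b)) \<noteq> 0" "Im (m (a, b)) \<noteq> 0" using m_parts[of a b] ab by auto
      then have "m (a, b) \<noteq> 0" by auto
      then have "q \<in> U" using \<eta>0(2)[OF cb(1)] cb(2) ab(5) by simp
      moreover have "q \<in> S2" using c(3) cb(1) ab(5) by blast
      moreover have "q \<notin> range f"
      proof
        assume "q \<in> range f"
        then have "q \<in> range f \<inter> \<psi> ` cball 0 1" using imageI[OF cb(1), of \<psi>] ab(5) by simp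
        then have "q \<in> \<psi> ` cross" unfolding c(5) .
        then obtain z where z: "q = \<psi> z" "z \<in> cross" by (rule imageE)
        then have "z \<in> cball 0 1" "Re z = 0 \<or> Im z = 0" unfolding cross_iff by simp_all
        then show False using inj_onD[OF c(2) _ cb(1), of z] z(1) ab(5) parts by auto
      qed
      ultimately show "q \<in> S2 \<inter> U - range f" by blast
    qed
    have clW: "\<psi> (m w) \<in> closure ?W" if "w \<in> {0..\<eta>} \<times> {0..\<eta>}" for w
      using image_closure_subset[OF cont closed_closure closure_subset, THEN subsetD, OF imageI] that
      unfolding clS .
    have cl1: "closure ?W \<inter> ray f y \<rho> \<epsilon> \<noteq> {}"
    proof -
      have "e \<in> {1, \<i>}" using e(3) by auto
      then obtain r where r: "0 < r" "r < \<eta>" "\<psi> (r *\<^sub>R (\<rho> *\<^sub>R e)) \<in> ray f y \<rho> \<epsilon>"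
        using branch_ray_close[OF ch y(1) e(1) _ \<rho>(1) \<eta>(1) \<epsilon>(1)] by blast
      then show ?thesis using clW[of "(r, 0)"] unfolding m_def by auto
    qed
    have cl2: "closure ?W \<inter> ray f y' \<rho>' \<epsilon>' \<noteq> {}"
    proof -
      have "e' \<in> {1, \<i>}" using e(3) by auto
      then obtain r where r: "0 < r" "r < \<eta>" "\<psi> (r *\<^sub>R (\<rho>' *\<^sub>R e')) \<in> ray f y' \<rho>' \<epsilon>'"
        using branch_ray_close[OF ch y(2) e(2) _ \<rho>(2) \<eta>(1) \<epsilon>(2)] by blast
      then show ?thesis using clW[of "(0, r)"] unfolding m_def by auto
    qed
    show "\<exists>W. connected W \<and> W \<subseteq> S2 \<inter> U - range f \<and>
        closure W \<inter> ray f y \<rho> \<epsilon> \<noteq> {} \<and> closure W \<inter> ray f y' \<rho>' \<epsilon>' \<noteq> {}"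
      by (intro exI[of _ ?W] conjI conn sub cl1 cl2)
  qed
qed

text \<open>A region in the chart that touches both halves of one strand has points on both sides of
  the other axis. Being connected it meets that axis, which is part of the curve.\<close>

lemma same_branch_not_adjacent:
  assumes ch: "crossing_chart f p \<psi>" and x: "f x = p"
  shows "\<exists>\<epsilon>>0. \<not> adjacent (range f) p (ray f x 1 \<epsilon>) (ray f x (-1) \<epsilon>)"
proof -
  have c: "continuous_on (cball 0 1) \<psi>" "inj_on \<psi> (cball 0 1)" "\<psi> ` cball 0 1 \<subseteq> S2" "\<psi> 0 = p"
    "range f \<inter> \<psi> ` cball 0 1 = \<psi> ` cross"
    using ch unfolding crossing_chart_iff by auto
  obtain e where e: "e \<in> {1, \<i>}" "branch f \<psi> x e"
    using chart_branch(2)[OF ch x] by blast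
  obtain U where U: "open U" "S2 \<inter> U = \<psi> ` ball 0 1"
    using chart_ball_open[OF c(1-3)] by blast
  have "p \<in> U" using U(2) c(4) by (metis IntE centre_in_ball imageI zero_less_one)
  obtain b where b: "b > 0" "\<And>u. 0 < u \<Longrightarrow> u < b \<Longrightarrow> f (x + 1 * u) \<in> \<psi> ` (\<lambda>r. r *\<^sub>R (1 *\<^sub>R e)) ` {0<..<1}"
    using branch_ray[OF e(2), of 1] unfolding eventually_at_right_field by blast
  obtain b' where b': "b' > 0" "\<And>u. 0 < u \<Longrightarrow> u < b' \<Longrightarrow> f (x + -1 * u) \<in> \<psi> ` (\<lambda>r. r *\<^sub>R (-1 *\<^sub>R e)) ` {0<..<1}"
    using branch_ray[OF e(2), of "-1"] unfolding eventually_at_right_field by blast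
  have "\<not> adjacent (range f) p (ray f x 1 (min b b')) (ray f x (-1) (min b b'))"
  proof
    assume "adjacent (range f) p (ray f x 1 (min b b')) (ray f x (-1) (min b b'))"
    from this[unfolded adjacent_def, rule_format, OF conjI[OF U(1) \<open>p \<in> U\<close>]]
    obtain W where W: "connected W" "W \<subseteq> S2 \<inter> U - range f"
      "closure W \<inter> ray f x 1 (min b b') \<noteq> {}" "closure W \<inter> ray f x (-1) (min b b') \<noteq> {}"
      by (elim exE conjE)
    obtain i where i: "continuous_on (\<psi> ` cball 0 1) i" "\<And>z. z \<in> cball 0 1 \<Longrightarrow> i (\<psi> z) = z"
      using homeomorphism_compact[OF compact_cball c(1) refl c(2)] unfolding homeomorphism_def by metis
    \<comment> \<open>The coordinate along the axis of \<open>e\<close>: the real part for 1, the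
      imaginary part for \<open>\<i>\<close>.\<close>
    define k where "k q = Re (i q * cnj e)" for q
    have contk: "continuous_on (\<psi> ` cball 0 1) k"
      unfolding k_def by (intro continuous_intros i(1))
    have "closed (\<psi> ` cball 0 1)"
      using c(1) by (intro compact_imp_closed compact_continuous_image) auto
    moreover have Wc: "W \<subseteq> \<psi> ` cball 0 1"
    proof -
      have "W \<subseteq> \<psi> ` ball 0 1" using W(2) U(2) by blast
      also have "\<dots> \<subseteq> \<psi> ` cball 0 1" using ball_subset_cball by (rule image_mono)
      finally show ?thesis .
    qed
    ultimately have clW: "closure W \<subseteq> \<psi> ` cball 0 1"
      by (intro closure_minimal)
    have contW: "continuous_on (closure W) k" using contk clW continuous_on_subset by blast
    have pos: "\<exists>q\<in>W. k q > 0"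
    proof (rule ccontr)
      assume "\<not> (\<exists>q\<in>W. k q > 0)"
      then have neg: "k q \<le> 0" if "q \<in> closure W" for q
        using continuous_le_on_closure[OF contW that, of 0] by force
      obtain u where u: "0 < u" "u < b" "f (x + 1 * u) \<in> closure W"
        using W(3) unfolding ray_def by auto
      obtain r where r: "r \<in> {0<..<1}" "f (x + 1 * u) = \<psi> (r *\<^sub>R (1 *\<^sub>R e))"
        using b(2)[OF u(1,2)] by auto
      have "k (f (x + 1 * u)) = r"
        unfolding r(2) k_def using i(2)[of "r *\<^sub>R (1 *\<^sub>R e)"] r(1) e(1) by auto
      then show False using neg[OF u(3)] r(1) by auto
    qed
    have neg: "\<exists>q\<in>W. k q < 0"
    proof (rule ccontr)
      assume "\<not> (\<exists>q\<in>W. k q < 0)"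
      then have pos: "k q \<ge> 0" if "q \<in> closure W" for q
        using continuous_ge_on_closure[OF contW that, of 0] by force
      obtain u where u: "0 < u" "u < b'" "f (x + -1 * u) \<in> closure W"
        using W(4) unfolding ray_def by auto
      obtain r where r: "r \<in> {0<..<1}" "f (x + -1 * u) = \<psi> (r *\<^sub>R (-1 *\<^sub>R e))"
        using b'(2)[OF u(1,2)] by auto
      have "k (f (x + -1 * u)) = - r"
        unfolding r(2) k_def using i(2)[of "r *\<^sub>R (-1 *\<^sub>R e)"] r(1) e(1) by auto
      then show False using pos[OF u(3)] r(1) by auto
    qed
    have conn: "connected (k ` W)"
      by (rule connected_continuous_image[OF continuous_on_subset[OF contk Wc] W(1)])
    obtain q1 q2 where q12: "q1 \<in> W" "k q1 > 0" "q2 \<in> W" "k q2 < 0" using pos neg by blast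
    have "{k q2..k q1} \<subseteq> k ` W"
      using conn q12(3,1) by (intro connected_contains_Icc imageI)
    moreover have "0 \<in> {k q2..k q1}" using q12 by simp
    ultimately have "0 \<in> k ` W" by (rule subsetD)
    then obtain q where q: "0 = k q" "q \<in> W" by (rule imageE)
    obtain z where z: "z \<in> cball 0 1" "q = \<psi> z" using Wc q(2) by blast
    have "Re z = 0 \<or> Im z = 0"
      using q(1) e(1) i(2)[OF z(1)] unfolding z(2) k_def by auto
    then have "z \<in> cross" unfolding cross_iff using z(1) by blast
    then have "q \<in> range f \<inter> \<psi> ` cball 0 1" unfolding c(5) z(2) by (rule imageI)
    then show False using q(2) W(2) by blast
  qed
  then show ?thesis using b(1) b'(1) by (intro exI[of _ "min b b'"]) auto
qed

end

context same_image
begin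

lemma double_points_eq: "f.D = g.D"
  using double_points_subset same_image.double_points_subset[OF same_image_swap] by blast

text \<open>Otherwise the opposite half-branch of \<open>f\<close> would lie on the other strand of
  \<open>g\<close>, where it is adjacent to the half-branch \<rho>; but the halves of one strand of
  \<open>f\<close> are not adjacent. On the same strand it cannot be \<rho> itself, since germs
  determine directions.\<close>

lemma opposite_germs:
  assumes cf: "crossing_chart f p \<phi>" and cg: "crossing_chart g p \<psi>" and x: "f x = p" "g y = p"
    and s: "\<sigma> \<in> {1, -1}" "\<rho> \<in> {1, -1}" and eq: "germ_eq f x \<sigma> g y \<rho>"
  shows "germ_eq f x (- \<sigma>) g y (- \<rho>)"
proof -
  have p: "p \<in> f.D" using f.chart_branch(1)[OF cf] .
  have ms: "- \<sigma> \<in> {1, -1}" using s(1) by auto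
  obtain y' \<rho>' where y': "\<rho>' \<in> {1, -1}" "germ_eq f x (- \<sigma>) g y' \<rho>'" "g y' = p"
    using germ_match[OF f.finite_double_points order_refl, of x "- \<sigma>"] double_points_eq p x ms by auto
  show ?thesis
  proof (cases "y' - y \<in> \<int>")
    case True
    then have eq': "germ_eq f x (- \<sigma>) g y \<rho>'"
      using germ_eq_shift[OF g.closed_curve_axioms True y'(2)] by blast
    have "\<rho>' \<noteq> \<rho>"
    proof
      assume "\<rho>' = \<rho>"
      then have "germ_sub f x \<sigma> f x (- \<sigma>)"
        using germ_eq_trans[OF eq germ_eq_sym] eq' unfolding germ_eq_def by blast
      then show False using f.germ_unique[OF s(1) ms] s(1) by auto
    qed
    then have "\<rho>' = - \<rho>" using s(2) y'(1) by auto
    then show ?thesis using eq' by simp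
  next
    case False
    obtain \<epsilon> where \<epsilon>: "\<epsilon> > 0" "\<not> adjacent (range f) p (ray f x 1 \<epsilon>) (ray f x (-1) \<epsilon>)"
      using f.same_branch_not_adjacent[OF cf x(1)] by blast
    have subs: "germ_sub g y \<rho> f x \<sigma>" "germ_sub g y' \<rho>' f x (- \<sigma>)"
      using eq y'(2) unfolding germ_eq_def by simp_all
    obtain \<delta> where \<delta>: "\<delta> > 0" "ray g y \<rho> \<delta> \<subseteq> ray f x \<sigma> \<epsilon>"
      using subs(1)[unfolded germ_sub_def, rule_format, OF \<epsilon>(1)] by (elim exE conjE)
    obtain \<delta>' where \<delta>': "\<delta>' > 0" "ray g y' \<rho>' \<delta>' \<subseteq> ray f x (- \<sigma>) \<epsilon>"
      using subs(2)[unfolded germ_sub_def, rule_format, OF \<epsilon>(1)] by (elim exE conjE)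
    have "y - y' \<notin> \<int>" using False Ints_minus[of "y - y'"] by auto
    then have "adjacent (range f) p (ray g y \<rho> \<delta>) (ray g y' \<rho>' \<delta>')"
      using g.different_branches_adjacent[OF cg x(2) y'(3) _ s(2) y'(1) \<delta>(1) \<delta>'(1)] range_eq by simp
    then have "adjacent (range f) p (ray f x \<sigma> \<epsilon>) (ray f x (- \<sigma>) \<epsilon>)"
      using \<delta>(2) \<delta>'(2) by (rule adjacent_mono)
    then show ?thesis using \<epsilon>(2) s(1) adjacent_sym by auto
  qed
qed

text \<open>Induction along both sequences: the germ at departure determines the edge, the edge the
  germ at arrival, and \<open>opposite_germs\<close> the next departure. Hence the words of
  crossings agree letter by letter.\<close>

lemma circuits_eq_of_germ:
  assumes cf: "\<And>p. p \<in> f.D \<Longrightarrow> \<exists>\<phi>. crossing_chart f p \<phi>" and cg: "\<And>p. p \<in> g.D \<Longrightarrow> \<exists>\<phi>. crossing_chart g p \<phi>"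
    and c: "c \<in> f.C" "germ_eq f c 1 g b 1"
  shows "circuits f = circuits g"
proof -
  have val: "f z = g w" if "germ_eq f z 1 g w 1" for z w
    using germ_value[OF f.closed_curve_axioms g.closed_curve_axioms, of 1 1] that unfolding germ_eq_def by auto
  have "b \<in> g.C"
    using c val[OF c(2)] double_points_eq unfolding crossing_params_def by auto
  obtain x where x: "x 0 = c" "\<And>i. edge f f.D (x i) (x (Suc i))"
    using f.exists_crossing_sequence[OF c(1)] by blast
  obtain y where y: "y 0 = b" "\<And>i. edge g g.D (y i) (y (Suc i))"
    using g.exists_crossing_sequence[OF \<open>b \<in> g.C\<close>] by blast
  interpret X: crossing_sequence f x by unfold_locales (rule x(2))
  interpret Y: crossing_sequence g y by unfold_locales (rule y(2))
  have germs: "germ_eq f (x i) 1 g (y i) 1" for i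
  proof (induction i)
    case 0
    then show ?case using c(2) x(1) y(1) by simp
  next
    case (Suc i)
    obtain c' d' where e: "edge g f.D c' d'"
      "germ_eq f (x i) 1 g c' 1 \<and> germ_eq f (x (Suc i)) (-1) g d' (-1) \<or> germ_eq f (x i) 1 g d' (-1) \<and> germ_eq f (x (Suc i)) (-1) g c' 1"
      using edge_match[OF f.finite_double_points order_refl _ x(2)[of i]] double_points_eq by auto
    have uniq: "y i - z \<in> \<int> \<and> 1 = \<rho>" if "germ_eq f (x i) 1 g z \<rho>" "\<rho> \<in> {1, -1}" for z \<rho>
      using g.germ_unique[of 1 \<rho> "y i" z] germ_eq_trans[OF germ_eq_sym[OF Suc.IH] that(1)] that(2)
      unfolding germ_eq_def by blast
    \<comment> \<open>Running backwards along the edge is excluded: the germ at departure is already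
      that of \<open>y i\<close> in direction 1.\<close>
    have "\<not> germ_eq f (x i) 1 g d' (-1)"
      using uniq[of d' "-1"] by auto
    then have inc: "germ_eq f (x i) 1 g c' 1" "germ_eq f (x (Suc i)) (-1) g d' (-1)" using e(2) by auto
    obtain n where n: "y i = c' + of_int n"
      using uniq[OF inc(1)] by (metis Ints_cases add.commute diff_add_cancel insertI1)
    have shifted: "edge g g.D (c' + of_int n) (d' + of_int n)"
      using g.edge_shift[OF e(1), of n] unfolding double_points_eq .
    have "y i < y (Suc i)" "c' < d'" using y(2)[of i] e(1) unfolding edge_def by simp_all
    then have "y (Suc i) = d' + of_int n"
      using n by (intro g.edge_overlap(2)[OF y(2)[of i] shifted, of "y i"]) simp_all
    then have "d' - y (Suc i) \<in> \<int>" by simp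
    then have left: "germ_eq f (x (Suc i)) (-1) g (y (Suc i)) (-1)"
      using germ_eq_shift[OF g.closed_curve_axioms _ inc(2)] by blast
    have eq: "f (x (Suc i)) = g (y (Suc i))"
      using germ_value[OF f.closed_curve_axioms g.closed_curve_axioms, of "-1" "-1"] left
      unfolding germ_eq_def by auto
    have "f (x (Suc i)) \<in> f.D" using X.in_crossing unfolding crossing_params_def by blast
    then obtain \<phi> \<psi> where "crossing_chart f (f (x (Suc i))) \<phi>" "crossing_chart g (f (x (Suc i))) \<psi>"
      using cf cg double_points_eq by metis
    from opposite_germs[OF this refl eq[symmetric] _ _ left] show ?case by simp
  qed
  have "f (x i) = g (y i)" for i using val[OF germs] .
  then show ?thesis
    unfolding X.circuits_eq Y.circuits_eq by simp
qed

end

section \<open>Reversal of the direction\<close>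

lemma range_reverse: "range (\<lambda>x. f (- x)) = range f" for f :: "real \<Rightarrow> 'a"
proof (intro equalityI subsetI)
  fix p assume "p \<in> range f"
  then obtain x where "p = f (- (- x))" by auto
  then show "p \<in> range (\<lambda>x. f (- x))" by blast
qed auto

lemma uminus_image_eq: "(\<And>z. z \<in> S \<Longrightarrow> - z \<in> S) \<Longrightarrow> uminus ` S = S" for S :: "'a::ab_group_add set"
  by (auto intro: image_eqI[of _ _ "- _"])

lemma double_points_reverse: "double_points (\<lambda>x. f (- x)) = double_points f"
proof -
  have sub: "double_points (\<lambda>x. f (- x)) \<subseteq> double_points f" for f :: "real \<Rightarrow> real^3"
  proof
    fix p assume "p \<in> double_points (\<lambda>x. f (- x))"
    then obtain x y where xy: "x - y \<notin> \<int>" "f (- x) = p" "f (- y) = p" unfolding double_points_def by auto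
    then have "- x - - y \<notin> \<int>" using Ints_minus[of "- x - - y"] by auto
    then show "p \<in> double_points f" unfolding double_points_def using xy by blast
  qed
  show ?thesis using sub[of f] sub[of "\<lambda>x. f (- x)"] by auto
qed

lemma closed_curve_reverse:
  assumes "closed_curve f"
  shows "closed_curve (\<lambda>x. f (- x))"
proof -
  interpret closed_curve f by fact
  show ?thesis
  proof
    show "continuous_on UNIV (\<lambda>x. f (- x))"
      by (rule continuous_on_compose2[OF continuous, of _ uminus]) (intro continuous_intros, simp)
    show "f (- (x + 1)) = f (- x)" for x using periodic[of "- x - 1"] by simp
    show "finite (double_points (\<lambda>x. f (- x)))" using finite_double_points unfolding double_points_reverse .
    show "x - y \<in> \<int> \<or> y - z \<in> \<int> \<or> x - z \<in> \<int>" if "f (- x) = f (- y)" "f (- y) = f (- z)" for x y z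
      using no_triple[OF that] Ints_minus[of "- x - - y"] Ints_minus[of "- y - - z"] Ints_minus[of "- x - - z"]
      by auto
  qed
qed

text \<open>A half turn of the chart makes the reversed strands run in the positive direction
  again.\<close>

lemma crossing_chart_reverse:
  assumes "crossing_chart f p \<phi>"
  shows "crossing_chart (\<lambda>x. f (- x)) p (\<lambda>z. \<phi> (- z))"
proof -
  obtain s t where st: "f s = p" "f t = p" "branch f \<phi> s 1" "branch f \<phi> t \<i>"
    and c: "continuous_on (cball 0 1) \<phi>" "inj_on \<phi> (cball 0 1)" "\<phi> ` cball 0 1 \<subseteq> S2" "\<phi> 0 = p"
      "range f \<inter> \<phi> ` cball 0 1 = \<phi> ` cross"
    using assms unfolding crossing_chart_iff by blast
  have img: "(\<lambda>z. \<phi> (- z)) ` S = \<phi> ` (uminus ` S)" for S by auto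
  have neg: "uminus ` cball (0::complex) 1 = cball 0 1" "uminus ` cross = cross"
    by (rule uminus_image_eq; simp add: cross_iff)+
  have br: "branch (\<lambda>x. f (- x)) (\<lambda>z. \<phi> (- z)) (- c) e" if br': "branch f \<phi> c e" for c e
  proof -
    obtain r l where "c < r" "\<And>z. c < z \<Longrightarrow> z < r \<Longrightarrow> f z \<in> \<phi> ` (\<lambda>r. r *\<^sub>R e) ` {0<..<1}"
      "l < c" "\<And>z. l < z \<Longrightarrow> z < c \<Longrightarrow> f z \<in> \<phi> ` (\<lambda>r. r *\<^sub>R - e) ` {0<..<1}"
      using br' unfolding branch_def eventually_at_right_field eventually_at_left_field by blast
    then show ?thesis
      unfolding branch_def
      by (intro conjI eventually_at_leftI'[of "- r"] eventually_at_rightI'[of _ "- l"]) (auto simp: image_image)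
  qed
  show ?thesis
    unfolding crossing_chart_iff range_reverse img neg
  proof (intro conjI)
    show "\<exists>s t. f (- s) = p \<and> f (- t) = p \<and> branch (\<lambda>x. f (- x)) (\<lambda>z. \<phi> (- z)) s 1 \<and>
        branch (\<lambda>x. f (- x)) (\<lambda>z. \<phi> (- z)) t \<i>"
      by (rule exI[of _ "- s"], rule exI[of _ "- t"]) (use st br in simp)
    show "continuous_on (cball 0 1) (\<lambda>z. \<phi> (- z))"
      by (rule continuous_on_compose2[OF c(1), of _ uminus]) (intro continuous_intros, auto)
    show "inj_on (\<lambda>z. \<phi> (- z)) (cball 0 1)"
    proof (rule inj_onI)
      fix z w :: complex assume "z \<in> cball 0 1" "w \<in> cball 0 1" "\<phi> (- z) = \<phi> (- w)"
      then have "- z = - w" using inj_onD[OF c(2), of "- z" "- w"] by simp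
      then show "z = w" by simp
    qed
  qed (use c in simp_all)
qed

text \<open>The half turn exchanges the two chords of each chart, so the same set is a resolution of
  the reversed curve.\<close>

lemma non_Seifert_resolution_reverse:
  assumes "non_Seifert_resolution f T"
  shows "non_Seifert_resolution (\<lambda>x. f (- x)) T"
proof -
  obtain \<phi> where \<phi>: "\<forall>p\<in>double_points f. crossing_chart f p (\<phi> p)"
    "disjoint_family_on (\<lambda>p. \<phi> p ` cball 0 1) (double_points f)"
    "T = (range f - (\<Union>p\<in>double_points f. \<phi> p ` cball 0 1)) \<union>
            (\<Union>p\<in>double_points f. \<phi> p ` (closed_segment (-1) (-\<i>) \<union> closed_segment 1 \<i>))"
    using assms unfolding non_Seifert_resolution_def by blast
  have img: "(\<lambda>z. h (- z)) ` S = h ` (uminus ` S)" for S and h :: "complex \<Rightarrow> real^3" by auto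
  have neg: "uminus ` cball (0::complex) 1 = cball 0 1"
    by (rule uminus_image_eq) simp
  have seg: "uminus ` closed_segment a b = closed_segment (- a) (- b)" for a b :: complex
    by (simp add: closed_segment_linear_image linear_uminus)
  show ?thesis
    unfolding non_Seifert_resolution_def double_points_reverse range_reverse
    by (rule exI[of _ "\<lambda>p z. \<phi> p (- z)"])
      (use \<phi> crossing_chart_reverse in \<open>auto simp: img neg seg image_Un Un_commute\<close>)
qed

text \<open>One departing half-branch of \<open>f\<close> is matched with a half-branch of
  \<open>g\<close>. If that one points against the direction of \<open>g\<close>, the reversed curve
  takes the place of \<open>g\<close>.\<close>

theorem circuits_same_image:
  assumes f: "closed_curve f" "\<And>p. p \<in> double_points f \<Longrightarrow> \<exists>\<phi>. crossing_chart f p \<phi>"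
    and g: "closed_curve g" "\<And>p. p \<in> double_points g \<Longrightarrow> \<exists>\<phi>. crossing_chart g p \<phi>"
    and T: "non_Seifert_resolution g T" and rng: "range f = range g"
  shows "circuits f = circuits g"
proof -
  interpret f: closed_curve f by (rule f)
  interpret same_image f g using f(1) g(1) rng by (simp add: same_image_def same_image_axioms_def)
  show ?thesis
  proof (cases "f.D = {}")
    case True
    then show ?thesis using f.circuits_no_crossings g.circuits_no_crossings double_points_eq by simp
  next
    case False
    then obtain c where c: "f c \<in> f.D" "c \<in> f.C" unfolding double_points_def crossing_params_def by auto
    obtain b \<rho> where b: "\<rho> \<in> {1, -1}" "germ_eq f c 1 g b \<rho>"
      using germ_match[OF f.finite_double_points order_refl _ c(1), of 1] double_points_eq by auto
    show ?thesis
    proof (cases "\<rho> = 1")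
      case True
      then show ?thesis using circuits_eq_of_germ[OF f(2) g(2) c(2)] b(2) by blast
    next
      case False
      then have "germ_eq f c 1 g b (-1)" using b by auto
      then have germ: "germ_eq f c 1 (\<lambda>x. g (- x)) (- b) 1"
        unfolding germ_eq_def germ_sub_def ray_reverse by simp
      interpret r: same_image f "\<lambda>x. g (- x)"
        using f(1) closed_curve_reverse[OF g(1)] rng range_reverse[of g] by (simp add: same_image_def same_image_axioms_def)
      have "circuits f = circuits (\<lambda>x. g (- x))"
        using f(2) g(2) crossing_chart_reverse c(2) germ
        by (intro r.circuits_eq_of_germ[of c "- b"]) (auto simp: double_points_reverse, blast)
      \<comment> \<open>Reversal exchanges heads and tails in \<open>linked\<close>; counting the
        components of the common resolution \<open>T\<close> in two ways avoids following
        this.\<close>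
      also have "\<dots> = circuits g"
        using card_components_resolution[OF g(1) T]
          card_components_resolution[OF closed_curve_reverse[OF g(1)] non_Seifert_resolution_reverse[OF T]] by simp
      finally show ?thesis .
    qed
  qed
qed

section \<open>Existence of a resolution\<close>

lemma smooth_derivatives:
  assumes "smooth f"
  shows "(f has_vector_derivative vector_derivative f (at x)) (at x)"
    "isCont (\<lambda>x. vector_derivative f (at x)) x"
proof -
  show "(f has_vector_derivative vector_derivative f (at x)) (at x)"
    using smooth_differentiable[OF assms] vector_derivative_works by blast
  have "((\<lambda>g y. vector_derivative g (at y)) ^^ 1) f differentiable (at x)"
    using assms unfolding smooth_def by blast
  then show "isCont (\<lambda>x. vector_derivative f (at x)) x"
    by (simp add: differentiable_imp_continuous_within)
qed

lemma sphere_curve_orthogonal: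
  assumes "(f has_vector_derivative v) (at x)" "\<And>x. f x \<in> S2"
  shows "f x \<bullet> v = 0"
proof -
  have d: "(f has_derivative (\<lambda>h. h *\<^sub>R v)) (at x)"
    using assms(1) by (simp add: has_vector_derivative_def)
  have one: "f y \<bullet> f y = 1" for y
    using assms(2)[of y] by (simp add: dot_square_norm)
  have "((\<lambda>y. f y \<bullet> f y) has_derivative (\<lambda>h. f x \<bullet> (h *\<^sub>R v) + (h *\<^sub>R v) \<bullet> f x)) (at x)"
    by (rule has_derivative_inner[OF d d])
  moreover have "((\<lambda>y. f y \<bullet> f y) has_derivative (\<lambda>h. 0)) (at x)"
    unfolding one by (rule has_derivative_const)
  ultimately have "(\<lambda>h. f x \<bullet> (h *\<^sub>R v) + (h *\<^sub>R v) \<bullet> f x) = (\<lambda>h. 0)"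
    by (rule has_derivative_unique)
  from fun_cong[OF this, of 1] show ?thesis by (simp add: inner_commute)
qed

lemma independent_combination:
  fixes a b p :: "'a::real_inner"
  assumes "\<not> collinear {0, a, b}" "p \<bullet> a = 0" "p \<bullet> b = 0" "p \<noteq> 0"
    and "x *\<^sub>R a + y *\<^sub>R b + z *\<^sub>R p = 0"
  shows "x = 0 \<and> y = 0 \<and> z = 0"
proof -
  have "p \<bullet> (x *\<^sub>R a + y *\<^sub>R b + z *\<^sub>R p) = z * (p \<bullet> p)"
    using assms(2,3) by (simp add: inner_add_right)
  then have z: "z = 0" using assms(4,5) by simp
  have ab: "a \<noteq> 0" "\<And>c. b \<noteq> c *\<^sub>R a"
    using assms(1) unfolding collinear_lemma by auto
  have eq: "y *\<^sub>R b = - x *\<^sub>R a" using assms(5) z by (simp add: eq_neg_iff_add_eq_0 add.commute)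
  have y: "y = 0"
  proof (rule ccontr)
    assume "y \<noteq> 0"
    then have "b = (1 / y) *\<^sub>R (y *\<^sub>R b)" by simp
    also have "\<dots> = (- x / y) *\<^sub>R a" unfolding eq by simp
    finally show False using ab(2) by blast
  qed
  then have "x *\<^sub>R a = 0" using eq by simp
  then show ?thesis using y z ab(1) by simp
qed

text \<open>Radial projection to the sphere is injective along a surface where the cone map
  \<open>(w, c) \<mapsto> c v(w)\<close> is. The charts below are radial projections of
  \<open>f (s + x) + f (t + y) - f s\<close>, which restricts to the two strands on the axes.\<close>

lemma has_derivative_locally_injective_cone:
  fixes v :: "real \<times> real \<Rightarrow> real^3"
  assumes dv: "\<And>x y. (v has_derivative (\<lambda>(h, k). h *\<^sub>R a x + k *\<^sub>R b y)) (at (x, y))"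
    and cont: "isCont a 0" "isCont b 0"
    and ind: "\<And>x y z. x *\<^sub>R a 0 + y *\<^sub>R b 0 + z *\<^sub>R v (0, 0) = 0 \<Longrightarrow> x = 0 \<and> y = 0 \<and> z = 0"
  obtains r where "r > 0" "inj_on (\<lambda>(w, c). c *\<^sub>R v w) (ball ((0, 0), 1) r)"
proof -
  define G' where "G' = (\<lambda>((x, y), c) ((h, k), l). c *\<^sub>R (h *\<^sub>R a x + k *\<^sub>R b y) + l *\<^sub>R v (x, y))"
  have G'_lin: "linear (G' z)" for z
    unfolding G'_def by (cases z) (auto intro!: linearI simp: algebra_simps split: prod.splits)
  have dG: "((\<lambda>(w, c). c *\<^sub>R v w) has_derivative G' z) (at z)" for z
  proof -
    obtain x y c where z: "z = ((x, y), c)" by (metis prod.collapse)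
    have "(v has_derivative (\<lambda>(h, k). h *\<^sub>R a x + k *\<^sub>R b y)) (at (fst z))"
      using dv[of x y] z by simp
    then have "((\<lambda>z. v (fst z)) has_derivative (\<lambda>u. (\<lambda>(h, k). h *\<^sub>R a x + k *\<^sub>R b y) (fst u))) (at z)"
      by (rule has_derivative_compose[OF has_derivative_fst[OF has_derivative_ident]])
    from has_derivative_scaleR[OF has_derivative_snd[OF has_derivative_ident] this]
    show ?thesis
      unfolding z G'_def case_prod_beta' by (simp add: add.commute)
  qed
  have "inj (G' ((0, 0), 1))"
    unfolding linear_injective_0[OF G'_lin] using ind by (auto simp: G'_def zero_prod_def)
  then obtain g' where g': "linear g'" "g' \<circ> G' ((0, 0), 1) = id"
    using linear_injective_left_inverse[OF G'_lin] by blast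
  \<comment> \<open>A bound for the operator norm of the change of the derivative. It vanishes at
    \<open>((0, 0), 1)\<close> and its continuity there only needs that of \<open>a\<close>,
    \<open>b\<close> and \<open>v\<close>.\<close>
  define \<kappa> where "\<kappa> = (\<lambda>((x, y), c). norm (c *\<^sub>R a x - a 0) + norm (c *\<^sub>R b y - b 0) + norm (v (x, y) - v (0, 0)))"
  have bound: "onorm (\<lambda>u. G' z u - G' ((0, 0), 1) u) \<le> \<kappa> z" for z
  proof (rule onorm_le)
    fix u :: "(real \<times> real) \<times> real"
    obtain x y c where z: "z = ((x, y), c)" by (metis prod.collapse)
    obtain h k l where u: "u = ((h, k), l)" by (metis prod.collapse)
    have "\<bar>h\<bar> \<le> norm (h, k)" "\<bar>k\<bar> \<le> norm (h, k)" "norm (h, k) \<le> norm u" "\<bar>l\<bar> \<le> norm u"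
      unfolding u using norm_fst_le[of h k] norm_snd_le[of k h] norm_fst_le[of "(h, k)" l]
        norm_snd_le[of l "(h, k)"] by simp_all
    then have hkl: "\<bar>h\<bar> \<le> norm u" "\<bar>k\<bar> \<le> norm u" "\<bar>l\<bar> \<le> norm u" by linarith+
    have "G' z u - G' ((0, 0), 1) u
        = h *\<^sub>R (c *\<^sub>R a x - a 0) + k *\<^sub>R (c *\<^sub>R b y - b 0) + l *\<^sub>R (v (x, y) - v (0, 0))"
      unfolding G'_def z u by (simp add: algebra_simps)
    also have "norm \<dots> \<le> norm (h *\<^sub>R (c *\<^sub>R a x - a 0)) + norm (k *\<^sub>R (c *\<^sub>R b y - b 0)) + norm (l *\<^sub>R (v (x, y) - v (0, 0)))"
      by (intro norm_triangle_le add_mono order_refl)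
    also have "\<dots> = \<bar>h\<bar> * norm (c *\<^sub>R a x - a 0) + \<bar>k\<bar> * norm (c *\<^sub>R b y - b 0) + \<bar>l\<bar> * norm (v (x, y) - v (0, 0))"
      by simp
    also have "\<dots> \<le> norm u * norm (c *\<^sub>R a x - a 0) + norm u * norm (c *\<^sub>R b y - b 0) + norm u * norm (v (x, y) - v (0, 0))"
      by (intro add_mono mult_right_mono hkl norm_ge_zero)
    also have "\<dots> = \<kappa> z * norm u"
      unfolding \<kappa>_def z by (simp add: algebra_simps)
    finally show "norm (G' z u - G' ((0, 0), 1) u) \<le> \<kappa> z * norm u" .
  qed
  have "isCont v (0, 0)" using dv has_derivative_continuous by blast
  then have "isCont (\<lambda>z. v (fst z)) ((0::real, 0::real), 1::real)"
    by (intro continuous_at_compose[of _ fst v, unfolded o_def]) (simp_all add: continuous_fst)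
  moreover have "isCont (\<lambda>z. a (fst (fst z))) ((0::real, 0::real), 1::real)"
    using cont(1) by (intro continuous_at_compose[of _ "\<lambda>z. fst (fst z)" a, unfolded o_def]) (simp_all add: continuous_fst)
  moreover have "isCont (\<lambda>z. b (snd (fst z))) ((0::real, 0::real), 1::real)"
    using cont(2) by (intro continuous_at_compose[of _ "\<lambda>z. snd (fst z)" b, unfolded o_def]) (simp_all add: continuous_fst continuous_snd)
  ultimately have "isCont \<kappa> ((0, 0), 1)"
    unfolding \<kappa>_def case_prod_beta prod.collapse by (intro continuous_intros)
  then have \<kappa>: "\<exists>d>0. \<forall>z. dist ((0, 0), 1) z < d \<longrightarrow> \<kappa> z < e" if "e > 0" for e
    using that unfolding continuous_at_eps_delta
    by (auto simp: \<kappa>_def dist_real_def dist_commute)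
  show ?thesis
  proof (rule has_derivative_locally_injective[where f = "\<lambda>(w, c). c *\<^sub>R v w" and S = UNIV and a = "((0, 0), 1)" and f' = G' and g' = g'])
    show "bounded_linear g'" using g'(1) by (simp add: linear_conv_bounded_linear)
    show "\<exists>d>0. \<forall>z. dist ((0, 0), 1) z < d \<longrightarrow> onorm (\<lambda>u. G' z u - G' ((0, 0), 1) u) < e" if "e > 0" for e
      using \<kappa>[OF that] bound order_le_less_trans by blast
  qed (use g' dG that in auto)
qed

text \<open>The parameters in \<open>{0..1}\<close> at distance at least \<epsilon> from all
  translates of \<open>s\<close> and \<open>t\<close> form a compact set whose image misses
  \<open>p\<close>. This keeps the rest of the curve out of a small chart.\<close>

lemma (in closed_curve) near_crossing:
  assumes st: "f s = p" "f t = p" "s - t \<notin> \<int>" and "\<epsilon> > 0"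
  shows "\<exists>\<eta>>0. \<forall>w. dist (f w) p < \<eta> \<longrightarrow> (\<exists>n::int. \<bar>w + of_int n - s\<bar> < \<epsilon> \<or> \<bar>w + of_int n - t\<bar> < \<epsilon>)"
proof -
  define K where "K = {w \<in> {0..1::real}. \<forall>n::int. \<epsilon> \<le> \<bar>w + of_int n - s\<bar> \<and> \<epsilon> \<le> \<bar>w + of_int n - t\<bar>}"
  have "closed {w. \<forall>n::int. \<epsilon> \<le> \<bar>w + of_int n - s\<bar> \<and> \<epsilon> \<le> \<bar>w + of_int n - t\<bar>}"
    by (intro closed_Collect_all closed_Collect_conj closed_Collect_le continuous_intros)
  then have "compact K"
    unfolding K_def Collect_conj_eq Collect_mem_eq by (rule compact_Int_closed[OF compact_Icc])
  then have "closed (f ` K)"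
    using continuous continuous_on_subset by (intro compact_imp_closed compact_continuous_image) blast+
  moreover have "p \<notin> f ` K"
  proof
    assume "p \<in> f ` K"
    then obtain w where w: "w \<in> K" "f w = p" by blast
    have "w - s \<in> \<int> \<or> w - t \<in> \<int>" using no_triple[of w s t] st w(2) by auto
    then obtain n where "w - s = of_int n \<or> w - t = of_int n" by (auto elim: Ints_cases)
    then have "w + of_int (- n) - s = 0 \<or> w + of_int (- n) - t = 0" by auto
    moreover have "\<epsilon> \<le> \<bar>w + of_int (- n) - s\<bar> \<and> \<epsilon> \<le> \<bar>w + of_int (- n) - t\<bar>"
      using w(1) unfolding K_def by blast
    ultimately show False using \<open>\<epsilon> > 0\<close> by auto
  qed
  ultimately obtain \<eta> where \<eta>: "\<eta> > 0" "ball p \<eta> \<subseteq> - f ` K"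
    by (metis ComplI open_Compl open_contains_ball)
  have "\<exists>n::int. \<bar>w + of_int n - s\<bar> < \<epsilon> \<or> \<bar>w + of_int n - t\<bar> < \<epsilon>" if w: "dist (f w) p < \<eta>" for w
  proof (rule ccontr)
    assume far: "\<not> ?thesis"
    obtain m where m: "w + of_int m \<in> {0..<0 + 1}" using exists_translate by blast
    have "\<epsilon> \<le> \<bar>w + of_int m + of_int n - s\<bar> \<and> \<epsilon> \<le> \<bar>w + of_int m + of_int n - t\<bar>" for n
    proof -
      have "w + of_int m + of_int n = w + of_int (m + n)" by simp
      then show ?thesis using far by (metis not_le)
    qed
    then have "w + of_int m \<in> K" unfolding K_def using m by auto
    then have "f w \<in> f ` K" using periodic_of_int[of w m] by (metis imageI)
    then show False using \<eta>(2) w by (auto simp: dist_commute)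
  qed
  then show ?thesis using \<eta>(1) by blast
qed

text \<open>The two tangent vectors are independent by transversality and orthogonal to
  \<open>p\<close>, because the curve stays on the sphere; so with \<open>p\<close> they form a
  basis and the cone map is locally injective. Scaling the chart keeps it close to \<open>p\<close>
  and away from the rest of the curve.\<close>

lemma small_crossing_chart:
  assumes gen: "generic_immersion f" and p: "p \<in> double_points f" and "\<delta> > 0"
  shows "\<exists>\<phi>. crossing_chart f p \<phi> \<and> \<phi> ` cball 0 1 \<subseteq> ball p \<delta>"
proof -
  interpret closed_curve f using gen by (rule generic_immersion_closed_curve)
  have sm: "smooth f" and S2: "\<And>x. f x \<in> S2"
    using gen unfolding generic_immersion_def immersion_def by blast+
  obtain s t where st: "s - t \<notin> \<int>" "f s = p" "f t = p" using p unfolding double_points_def by auto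
  let ?f' = "\<lambda>x. vector_derivative f (at x)"
  have f': "(f has_vector_derivative ?f' x) (at x)" "isCont ?f' x" for x
    using smooth_derivatives[OF sm] by blast+
  define v where "v = (\<lambda>(x, y). f (s + x) + f (t + y) - p)"
  have norm_p: "norm p = 1" using S2[of s] st by simp
  have v0: "v (0, 0) = p" "v (x, 0) = f (s + x)" "v (0, y) = f (t + y)" for x y
    unfolding v_def using st by simp_all
  have dv: "(v has_derivative (\<lambda>(h, k). h *\<^sub>R ?f' (s + x) + k *\<^sub>R ?f' (t + y))) (at (x, y))" for x y
  proof -
    have d: "(f has_derivative (\<lambda>h. h *\<^sub>R ?f' w)) (at w)" for w
      using f'(1)[of w] by (simp add: has_vector_derivative_def)
    have "((\<lambda>w. f (s + fst w)) has_derivative (\<lambda>w. fst w *\<^sub>R ?f' (s + x))) (at (x, y))"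
      by (rule has_derivative_compose[of "\<lambda>w. s + fst w" fst "(x, y)" UNIV f "\<lambda>h. h *\<^sub>R ?f' (s + x)", simplified])
        (auto intro!: derivative_eq_intros d)
    moreover have "((\<lambda>w. f (t + snd w)) has_derivative (\<lambda>w. snd w *\<^sub>R ?f' (t + y))) (at (x, y))"
      by (rule has_derivative_compose[of "\<lambda>w. t + snd w" snd "(x, y)" UNIV f "\<lambda>h. h *\<^sub>R ?f' (t + y)", simplified])
        (auto intro!: derivative_eq_intros d)
    ultimately have "((\<lambda>w. f (s + fst w) + f (t + snd w) - p) has_derivative
        (\<lambda>w. fst w *\<^sub>R ?f' (s + x) + snd w *\<^sub>R ?f' (t + y) - 0)) (at (x, y))"
      by (intro has_derivative_diff has_derivative_add has_derivative_const)
    then show ?thesis unfolding v_def case_prod_beta' by simp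
  qed
  have shift: "isCont (\<lambda>x. ?f' (u + x)) 0" for u
    using f'(2)[of u] by (intro continuous_at_compose[of 0 "\<lambda>x. u + x" ?f', unfolded o_def]) (auto intro: continuous_intros)
  have noncol: "\<not> collinear {0, ?f' s, ?f' t}"
    using gen st unfolding generic_immersion_def by metis
  have "p \<noteq> 0" using norm_p by auto
  have orth: "p \<bullet> ?f' s = 0" "p \<bullet> ?f' t = 0"
    using sphere_curve_orthogonal[OF f'(1) S2, of s] sphere_curve_orthogonal[OF f'(1) S2, of t] st by simp_all
  obtain r where r: "r > 0" "inj_on (\<lambda>(w, c). c *\<^sub>R v w) (ball ((0, 0), 1) r)"
  proof (rule has_derivative_locally_injective_cone[OF dv shift shift])
    show "x = 0 \<and> y = 0 \<and> z = 0"
      if "x *\<^sub>R ?f' (s + 0) + y *\<^sub>R ?f' (t + 0) + z *\<^sub>R v (0, 0) = 0" for x y z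
      using independent_combination[OF noncol orth \<open>p \<noteq> 0\<close>, of x y z] that v0(1) by simp
  qed
  define \<Phi> where "\<Phi> w = (1 / norm (v w)) *\<^sub>R v w" for w
  have contv: "isCont v w" for w
    using dv[of "fst w" "snd w"] has_derivative_continuous by fastforce
  \<comment> \<open>The cone map takes the value \<open>\<Phi> w\<close> at this pair, so its
    injectivity passes to \<Phi>.\<close>
  have "isCont (\<lambda>w. (w, 1 / norm (v w))) (0, 0)"
    using contv[of "(0, 0)"] v0(1) \<open>p \<noteq> 0\<close> by (intro continuous_intros) auto
  then have ev: "\<forall>\<^sub>F w in nhds (0, 0). (w, 1 / norm (v w)) \<in> ball ((0, 0), 1) r"
    using v0(1) norm_p r(1) unfolding isCont_def tendsto_iff
    by (auto simp: eventually_nhds_conv_at dist_commute)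
  have "isCont (\<lambda>w. v w) (0, 0)" by (rule contv)
  then have "\<forall>\<^sub>F w in nhds (0, 0). v w \<noteq> 0"
    using v0(1) \<open>p \<noteq> 0\<close> tendsto_imp_eventually_ne unfolding isCont_def
    by (fastforce simp: eventually_nhds_conv_at)
  from eventually_conj[OF ev this] obtain \<epsilon>0 where \<epsilon>0: "\<epsilon>0 > 0"
    "\<And>w. norm w < \<epsilon>0 \<Longrightarrow> (w, 1 / norm (v w)) \<in> ball ((0, 0), 1) r \<and> v w \<noteq> 0"
    unfolding eventually_nhds_metric by (auto simp: zero_prod_def[symmetric])
  have \<Phi>_inj: "w = w'" if "norm w < \<epsilon>0" "norm w' < \<epsilon>0" "\<Phi> w = \<Phi> w'" for w w'
    using inj_onD[OF r(2), of "(w, 1 / norm (v w))" "(w', 1 / norm (v w'))"] \<epsilon>0(2)[OF that(1)] \<epsilon>0(2)[OF that(2)]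
      that(3) unfolding \<Phi>_def by auto
  have \<Phi>_cont: "isCont \<Phi> w" if "norm w < \<epsilon>0" for w
    unfolding \<Phi>_def using \<epsilon>0(2)[OF that] contv by (intro continuous_intros) auto
  \<comment> \<open>The strands already lie on the unit sphere, so the projection changes nothing on
    the axes.\<close>
  have \<Phi>_axes: "\<Phi> (x, 0) = f (s + x)" "\<Phi> (0, y) = f (t + y)" for x y
    unfolding \<Phi>_def v0 using S2 by simp_all
  obtain \<eta> where \<eta>: "\<eta> > 0"
    "\<And>w. dist (f w) p < \<eta> \<Longrightarrow> \<exists>n::int. \<bar>w + of_int n - s\<bar> < \<epsilon>0 \<or> \<bar>w + of_int n - t\<bar> < \<epsilon>0"
    using near_crossing[OF st(2,3,1) \<epsilon>0(1)] by blast
  have \<Phi>0: "\<Phi> 0 = p" using \<Phi>_axes(1)[of 0] st by (simp add: zero_prod_def)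
  have "isCont \<Phi> 0" using \<Phi>_cont[of 0] \<epsilon>0(1) by simp
  then obtain \<epsilon>1 where \<epsilon>1: "\<epsilon>1 > 0" "\<And>w. norm w < \<epsilon>1 \<Longrightarrow> dist (\<Phi> w) p < min \<eta> \<delta>"
    unfolding continuous_at_eps_delta using \<eta>(1) \<open>\<delta> > 0\<close> \<Phi>0
    by (metis diff_zero dist_norm min_less_iff_conj)
  \<comment> \<open>Half of the smaller radius, so that the closed disk goes into both open
    balls.\<close>
  define \<epsilon> where "\<epsilon> = min \<epsilon>0 \<epsilon>1 / 2"
  have \<epsilon>: "0 < \<epsilon>" "\<epsilon> < \<epsilon>0" "\<epsilon> < \<epsilon>1" unfolding \<epsilon>_def using \<epsilon>0(1) \<epsilon>1(1) by auto
  define m where "m z = (\<epsilon> * Re z, \<epsilon> * Im z)" for z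
  have norm_m: "norm (m z) = \<epsilon> * cmod z" for z
    unfolding m_def norm_prod_def cmod_def using \<epsilon>(1)
    by (simp add: power_mult_distrib real_sqrt_mult flip: distrib_left)
  have small: "norm (m z) < \<epsilon>0" "norm (m z) < \<epsilon>1" if "z \<in> cball 0 1" for z
  proof -
    have "\<epsilon> * cmod z \<le> \<epsilon> * 1" using that \<epsilon>(1) by (intro mult_left_mono) auto
    then show "norm (m z) < \<epsilon>0" "norm (m z) < \<epsilon>1" unfolding norm_m using \<epsilon>(2,3) by linarith+
  qed
  define \<phi> where "\<phi> z = \<Phi> (m z)" for z
  have \<phi>_axes: "\<phi> (r *\<^sub>R 1) = f (s + \<epsilon> * r)" "\<phi> (r *\<^sub>R \<i>) = f (t + \<epsilon> * r)"
    "\<phi> (r *\<^sub>R - 1) = f (s - \<epsilon> * r)" "\<phi> (r *\<^sub>R - \<i>) = f (t - \<epsilon> * r)" for r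
    unfolding \<phi>_def m_def using \<Phi>_axes(1)[of "\<epsilon> * r"] \<Phi>_axes(1)[of "- \<epsilon> * r"]
      \<Phi>_axes(2)[of "\<epsilon> * r"] \<Phi>_axes(2)[of "- \<epsilon> * r"] by simp_all
  have branch: "branch f \<phi> c e" if ax: "\<And>r. \<phi> (r *\<^sub>R e) = f (c + \<epsilon> * r)" "\<And>r. \<phi> (r *\<^sub>R - e) = f (c - \<epsilon> * r)" for c e
  proof -
    have "f z \<in> \<phi> ` (\<lambda>r. r *\<^sub>R e) ` {0<..<1}" if "c < z" "z < c + \<epsilon>" for z
    proof -
      have "(z - c) / \<epsilon> \<in> {0<..<1}" "f z = \<phi> (((z - c) / \<epsilon>) *\<^sub>R e)"
        unfolding ax using that \<epsilon>(1) by (simp_all add: field_simps)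
      then show ?thesis by blast
    qed
    moreover have "f z \<in> \<phi> ` (\<lambda>r. r *\<^sub>R - e) ` {0<..<1}" if "c - \<epsilon> < z" "z < c" for z
    proof -
      have "(c - z) / \<epsilon> \<in> {0<..<1}" "f z = \<phi> (((c - z) / \<epsilon>) *\<^sub>R - e)"
        unfolding ax using that \<epsilon>(1) by (simp_all add: field_simps)
      then show ?thesis by blast
    qed
    ultimately show ?thesis
      unfolding branch_def using \<epsilon>(1)
      by (intro conjI eventually_at_leftI'[of "c - \<epsilon>"] eventually_at_rightI'[of _ "c + \<epsilon>"]) auto
  qed
  have "crossing_chart f p \<phi>"
    unfolding crossing_chart_iff
  proof (intro conjI)
    have "continuous_on (cball 0 1) m" unfolding m_def by (intro continuous_intros)
    moreover have "continuous_on (m ` cball 0 1) \<Phi>"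
    proof (intro continuous_at_imp_continuous_on ballI)
      fix w assume "w \<in> m ` cball 0 1"
      then show "isCont \<Phi> w" using \<Phi>_cont small(1) by blast
    qed
    ultimately show "continuous_on (cball 0 1) \<phi>"
      unfolding \<phi>_def by (intro continuous_on_compose2[of "m ` cball 0 1" \<Phi> "cball 0 1" m]) auto
    show "inj_on \<phi> (cball 0 1)"
    proof (rule inj_onI)
      fix z w assume "z \<in> cball 0 1" "w \<in> cball 0 1" "\<phi> z = \<phi> w"
      then have "m z = m w" using \<Phi>_inj small unfolding \<phi>_def by blast
      then show "z = w" unfolding m_def using \<epsilon>(1) by (simp add: complex_eq_iff)
    qed
    show "\<phi> ` cball 0 1 \<subseteq> S2"
    proof
      fix q assume "q \<in> \<phi> ` cball 0 1"
      then obtain z where "z \<in> cball 0 1" "q = \<phi> z" by blast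
      then show "q \<in> S2" using \<epsilon>0(2)[OF small(1)] unfolding \<phi>_def \<Phi>_def by simp
    qed
    show "\<phi> 0 = p" unfolding \<phi>_def m_def using \<Phi>0 by (simp add: zero_prod_def)
    show "range f \<inter> \<phi> ` cball 0 1 = \<phi> ` cross"
    proof (intro equalityI subsetI)
      fix q assume "q \<in> range f \<inter> \<phi> ` cball 0 1"
      then obtain w z where wz: "q = f w" "z \<in> cball 0 1" "q = \<phi> z" by blast
      have "dist (f w) p < \<eta>"
        using \<epsilon>1(2)[OF small(2)[OF wz(2)]] wz unfolding \<phi>_def by simp
      then obtain n :: int where n: "\<bar>w + of_int n - s\<bar> < \<epsilon>0 \<or> \<bar>w + of_int n - t\<bar> < \<epsilon>0"
        using \<eta>(2) by blast
      have "Im z = 0 \<or> Re z = 0"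
        using n
      proof
        assume n: "\<bar>w + of_int n - s\<bar> < \<epsilon>0"
        \<comment> \<open>A point of the curve close to \<open>p\<close> is the image of a point on
          an axis; injectivity of \<Phi> puts \<open>m z\<close> on that axis.\<close>
        have "\<Phi> (w + of_int n - s, 0) = \<Phi> (m z)"
          using \<Phi>_axes(1)[of "w + of_int n - s"] periodic_of_int[of w n] wz unfolding \<phi>_def by simp
        then have "(w + of_int n - s, 0) = m z"
          using n small(1)[OF wz(2)] by (intro \<Phi>_inj) (auto simp: norm_Pair)
        then show ?thesis unfolding m_def using \<epsilon>(1) by simp
      next
        assume n: "\<bar>w + of_int n - t\<bar> < \<epsilon>0"
        have "\<Phi> (0, w + of_int n - t) = \<Phi> (m z)"
          using \<Phi>_axes(2)[of "w + of_int n - t"] periodic_of_int[of w n] wz unfolding \<phi>_def by simp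
        then have "(0, w + of_int n - t) = m z"
          using n small(1)[OF wz(2)] by (intro \<Phi>_inj) (auto simp: norm_Pair)
        then show ?thesis unfolding m_def using \<epsilon>(1) by simp
      qed
      then have "z \<in> cross" unfolding cross_iff using wz(2) by blast
      then show "q \<in> \<phi> ` cross" using wz(3) by blast
    next
      fix q assume "q \<in> \<phi> ` cross"
      then obtain z where z: "z \<in> cross" "q = \<phi> z" by blast
      then have "z \<in> cball 0 1" "Re z = 0 \<or> Im z = 0" unfolding cross_iff by auto
      moreover have "q \<in> range f"
        using \<open>Re z = 0 \<or> Im z = 0\<close>
      proof
        assume "Re z = 0"
        then show ?thesis unfolding z(2) \<phi>_def m_def by (simp add: \<Phi>_axes)
      next
        assume "Im z = 0"
        then show ?thesis unfolding z(2) \<phi>_def m_def by (simp add: \<Phi>_axes)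
      qed
      ultimately show "q \<in> range f \<inter> \<phi> ` cball 0 1" using z(2) by blast
    qed
    show "\<exists>s t. f s = p \<and> f t = p \<and> branch f \<phi> s 1 \<and> branch f \<phi> t \<i>"
      using st branch[of 1 s] branch[of \<i> t] \<phi>_axes by blast
  qed
  moreover have "\<phi> ` cball 0 1 \<subseteq> ball p \<delta>"
  proof
    fix q assume "q \<in> \<phi> ` cball 0 1"
    then obtain z where "q = \<Phi> (m z)" "z \<in> cball 0 1" unfolding \<phi>_def by (rule imageE)
    then show "q \<in> ball p \<delta>" using \<epsilon>1(2)[OF small(2)] by (simp add: dist_commute)
  qed
  ultimately show ?thesis by blast
qed

text \<open>Charts inside balls of at most half the least distance between double points are
  disjoint.\<close>

lemma resolution_exists:
  assumes gen: "generic_immersion f"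
  shows "\<exists>T. non_Seifert_resolution f T"
proof -
  have fin: "finite (double_points f)" using gen unfolding generic_immersion_def by blast
  have "\<exists>\<delta>>0. \<forall>p\<in>double_points f. \<forall>q\<in>double_points f. p \<noteq> q \<longrightarrow> 2 * \<delta> \<le> dist p q"
  proof -
    let ?S = "(\<lambda>(p, q). dist p q) ` {(p, q) \<in> double_points f \<times> double_points f. p \<noteq> q}"
    have "finite ?S" using fin by (intro finite_imageI finite_subset[OF _ finite_cartesian_product[OF fin fin]]) auto
    \<comment> \<open>The extra element 1 provides a minimum also when there are no two double
      points.\<close>
    moreover have "Min (insert 1 ?S) > 0" using \<open>finite ?S\<close> by (subst Min_gr_iff) auto
    ultimately show ?thesis
      by (intro exI[of _ "Min (insert 1 ?S) / 2"]) (auto intro!: Min_le)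
  qed
  then obtain \<delta> where \<delta>: "\<delta> > 0" "\<And>p q. p \<in> double_points f \<Longrightarrow> q \<in> double_points f \<Longrightarrow> p \<noteq> q \<Longrightarrow> 2 * \<delta> \<le> dist p q"
    by blast
  obtain \<phi> where \<phi>: "\<And>p. p \<in> double_points f \<Longrightarrow> crossing_chart f p (\<phi> p) \<and> \<phi> p ` cball 0 1 \<subseteq> ball p \<delta>"
    using small_crossing_chart[OF gen _ \<delta>(1)] by metis
  have "disjoint_family_on (\<lambda>p. \<phi> p ` cball 0 1) (double_points f)"
    unfolding disjoint_family_on_def
  proof (intro ballI impI)
    fix p q assume pq: "p \<in> double_points f" "q \<in> double_points f" "p \<noteq> q"
    have "ball p \<delta> \<inter> ball q \<delta> = {}"
      using \<delta>(2)[OF pq] by (intro disjoint_ballI) simp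
    then show "\<phi> p ` cball 0 1 \<inter> \<phi> q ` cball 0 1 = {}"
      using \<phi>[OF pq(1)] \<phi>[OF pq(2)] by blast
  qed
  then show ?thesis
    unfolding non_Seifert_resolution_def using \<phi> by blast
qed

section \<open>The circle number\<close>

lemma resolution_charts: "non_Seifert_resolution f T \<Longrightarrow> p \<in> double_points f \<Longrightarrow> \<exists>\<phi>. crossing_chart f p \<phi>"
  unfolding non_Seifert_resolution_def by blast

text \<open>The choice in \<open>\<tau>\<close> may rest on another parametrisation \<open>g\<close>
  and on other charts; the first is settled by \<open>circuits_same_image\<close>, the second by
  \<open>card_components_resolution\<close>.\<close>

lemma circle_number_eq_circuits:
  assumes gen: "generic_immersion f"
  shows "circle_number (range f) = circuits f"
proof -
  obtain T where T: "non_Seifert_resolution f T" using resolution_exists[OF gen] by blast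
  have "\<exists>\<C>. circle_arrangement (range f) \<C>"
    unfolding circle_arrangement_def using gen T by blast
  then have "circle_arrangement (range f) (\<tau> (range f))"
    unfolding \<tau>_def by (rule someI_ex)
  then obtain g T' where g: "generic_immersion g" "range f = range g" "non_Seifert_resolution g T'"
    "\<tau> (range f) = components T'"
    unfolding circle_arrangement_def by blast
  have "circle_number (range f) = circuits g"
    unfolding circle_number_def g(4)
    using card_components_resolution[OF generic_immersion_closed_curve[OF g(1)] g(3)] .
  also have "\<dots> = circuits f"
    using circuits_same_image[OF generic_immersion_closed_curve[OF g(1)] resolution_charts[OF g(3)]
        generic_immersion_closed_curve[OF gen] resolution_charts[OF T] T] g(2) by simp
  finally show ?thesis .
qed

text \<open>Composing with \<open>h\<close> changes no coincidence of parameters, so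
  \<open>linked\<close> is literally the same relation. The composite may fail to be smooth, but it
  has charts, carried over by \<open>h\<close>, and the same image as \<open>g\<close>.\<close>

lemma circuits_homeomorphic:
  assumes h: "homeomorphic_map S2_top S2_top h"
    and f: "generic_immersion f" and g: "generic_immersion g" and img: "h ` range f = range g"
  shows "circuits f = circuits g"
proof -
  interpret f: closed_curve f using f by (rule generic_immersion_closed_curve)
  have S2: "f x \<in> S2" for x using f unfolding generic_immersion_def immersion_def by blast
  have conth: "continuous_on S2 h"
    using homeomorphic_imp_continuous_map[OF h] by simp
  have injh: "inj_on h S2"
    using homeomorphic_imp_injective_map[OF h] by simp
  have surjh: "h ` S2 = S2"
    using homeomorphic_imp_surjective_map[OF h] by simp
  let ?F = "\<lambda>x. h (f x)"
  have eq: "?F x = ?F y \<longleftrightarrow> f x = f y" for x y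
    using inj_onD[OF injh _ S2 S2] by auto
  have D: "?F x \<in> double_points ?F \<longleftrightarrow> f x \<in> double_points f" for x
    unfolding double_points_def mem_Collect_eq eq by blast
  have C: "crossing_params ?F = crossing_params f"
    unfolding crossing_params_def D ..
  have link: "linked ?F = linked f"
    unfolding linked_def C eq ..
  have DF: "double_points ?F = h ` double_points f"
  proof (intro equalityI subsetI)
    fix p assume p: "p \<in> double_points ?F"
    then obtain x where "?F x = p" unfolding double_points_def by auto
    then show "p \<in> h ` double_points f" using D[of x] p by blast
  next
    fix p assume "p \<in> h ` double_points f"
    then obtain q where q: "p = h q" "q \<in> double_points f" by (rule imageE)
    then obtain x where "f x = q" unfolding double_points_def by auto
    then show "p \<in> double_points ?F" using D[of x] q by simp
  qed
  have F: "closed_curve ?F"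
  proof
    show "continuous_on UNIV ?F"
      by (rule continuous_on_compose2[OF conth f.continuous]) (use S2 in blast)
    show "finite (double_points ?F)" unfolding DF using f.finite_double_points by simp
  qed (use f.no_triple in \<open>auto simp: eq f.periodic\<close>)
  have charts: "\<exists>\<phi>. crossing_chart ?F p \<phi>" if p: "p \<in> double_points ?F" for p
  proof -
    obtain q where q: "q \<in> double_points f" "p = h q" using p unfolding DF by blast
    obtain T where T: "non_Seifert_resolution f T" using resolution_exists[OF f] by blast
    obtain \<phi> where \<phi>: "crossing_chart f q \<phi>" using resolution_charts[OF T q(1)] by blast
    then obtain s t where st: "f s = q" "f t = q" "branch f \<phi> s 1" "branch f \<phi> t \<i>"
      and c: "continuous_on (cball 0 1) \<phi>" "inj_on \<phi> (cball 0 1)" "\<phi> ` cball 0 1 \<subseteq> S2" "\<phi> 0 = q"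
        "range f \<inter> \<phi> ` cball 0 1 = \<phi> ` cross"
      unfolding crossing_chart_iff by blast
    have br: "branch ?F (\<lambda>z. h (\<phi> z)) c e" if "branch f \<phi> c e" for c e
      using that unfolding branch_def by (auto elim!: eventually_mono)
    have "crossing_chart ?F p (\<lambda>z. h (\<phi> z))"
      unfolding crossing_chart_iff
    proof (intro conjI)
      show "continuous_on (cball 0 1) (\<lambda>z. h (\<phi> z))" by (rule continuous_on_compose2[OF conth c(1,3)])
      show "inj_on (\<lambda>z. h (\<phi> z)) (cball 0 1)"
        using comp_inj_on[OF c(2) inj_on_subset[OF injh c(3)]] by (simp add: o_def)
      have img: "(\<lambda>z. h (\<phi> z)) ` A = h ` (\<phi> ` A)" for A by auto
      show "(\<lambda>z. h (\<phi> z)) ` cball 0 1 \<subseteq> S2"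
        unfolding img using image_mono[OF c(3), of h] surjh by simp
      show "h (\<phi> 0) = p" using c(4) q(2) by simp
      have "range ?F = h ` range f" by auto
      then have "range ?F \<inter> (\<lambda>z. h (\<phi> z)) ` cball 0 1 = h ` (range f \<inter> \<phi> ` cball 0 1)"
        unfolding img using S2 c(3) by (subst inj_on_image_Int[OF injh]) auto
      then show "range ?F \<inter> (\<lambda>z. h (\<phi> z)) ` cball 0 1 = (\<lambda>z. h (\<phi> z)) ` cross"
        unfolding c(5) img .
      show "\<exists>s t. h (f s) = p \<and> h (f t) = p \<and> branch ?F (\<lambda>z. h (\<phi> z)) s 1 \<and> branch ?F (\<lambda>z. h (\<phi> z)) t \<i>"
        by (rule exI[of _ s], rule exI[of _ t]) (use st br q(2) in simp)
    qed
    then show ?thesis by blast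
  qed
  obtain T where T: "non_Seifert_resolution g T" using resolution_exists[OF g] by blast
  have "range ?F = range g" using img by auto
  then have "circuits ?F = circuits g"
    using circuits_same_image[OF F charts generic_immersion_closed_curve[OF g] resolution_charts[OF T] T] by simp
  then show ?thesis unfolding circuits_def link .
qed

lemma circle_number_step:
  assumes "knot_projection P" "knot_projection Q" "isotopic P Q \<or> RI P Q \<or> strong_RII P Q"
  shows "circle_number P = circle_number Q"
  using assms(3)
proof (elim disjE)
  assume "isotopic P Q"
  then obtain h where h: "homotopic_with (homeomorphic_map S2_top S2_top) S2_top S2_top id h" "h ` P = Q"
    unfolding isotopic_def by blast
  have "homeomorphic_map S2_top S2_top h" using homotopic_with_imp_property[OF h(1)] by blast
  moreover obtain f g where "generic_immersion f" "P = range f" "generic_immersion g" "Q = range g"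
    using assms(1,2) unfolding knot_projection_def by blast
  ultimately show ?thesis
    using circuits_homeomorphic[of h f g] circle_number_eq_circuits h(2) by simp
next
  assume "RI P Q"
  then obtain f g D a b s t where m: "P = range f" "Q = range g"
      "a < s" "s < t" "t < b" "b < a + 1" "local_change D {a..b} f g"
      "inj_on f {a..b}" "inj_on g ({a..b} - {s})" "one_gon g s t"
    unfolding RI_def by blast
  then have "circuits f = circuits g"
    using circuits_RI[of a s t b D f g] unfolding one_gon_def by blast
  moreover have "generic_immersion f" "generic_immersion g"
    using m(7) unfolding local_change_def by blast+
  ultimately show ?thesis using circle_number_eq_circuits m(1,2) by simp
next
  assume "strong_RII P Q"
  then obtain f g D a b c d s t u v where m: "P = range f" "Q = range g"
      "a < s" "s < t" "t < b" "b < c" "c < u" "u < v" "v < d" "d < a + 1"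
      "local_change D ({a..b} \<union> {c..d}) f g" "inj_on f ({a..b} \<union> {c..d})"
      "inj_on g {a..b}" "inj_on g {c..d}" "g ` {a..b} \<inter> g ` {c..d} = {g s, g t}"
      "coherent_two_gon g s t u v"
    unfolding strong_RII_def by blast
  have "g t = g u" "g v = g s" using m(16) unfolding coherent_two_gon_def by blast+
  then have "circuits f = circuits g" using circuits_strong_RII[OF m(3-15)] by blast
  moreover have "generic_immersion f" "generic_immersion g"
    using m(11) unfolding local_change_def by blast+
  ultimately show ?thesis using circle_number_eq_circuits m(1,2) by simp
qed

theorem corollary3:
  fixes P P' :: "(real^3) set"
  assumes "knot_projection P" and "knot_projection P'"
    and "strongly_12_homotopic P P'"
  shows "circle_number P = circle_number P'"
  using assms(3) unfolding strongly_12_homotopic_def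
proof (induction rule: equivclp_induct)
  case (step Q R)
  then show ?case using circle_number_step[of Q R] circle_number_step[of R Q] by auto
qed simp

end
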